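(* Let $A$ be either of the two matrices $$\begin{pmatrix}3/4&-1/4\\-1/4&3/4\end{pmatrix},\qquad \begin{pmatrix}3/2&1/2\\1/2&3/2\end{pmatrix}.$$ Then there exist $B\in\mathbb{Q}^2$ and $C\in\mathbb{Q}$ such that $F_{A,B,C}$ is a modular function, but it is not true that the element $[Q_1]+[Q_2]$ is torsion in the corresponding Bloch group for every solution $(Q_1,Q_2)$ of the system $$1-Q_i=\prod_{j=1}^2Q_j^{A_{ij}},\qquad i=1,2 .$$ (Thus these matrices are counterexamples to Nahm's conjecture, which asserts that for a positive definite symmetric rational matrix $A$ the existence of $B,C$ rational with $F_{A,B,C}$ modular is equivalent to $[Q_1]+\dots+[Q_r]$ being torsion for every solution.)
   Context: Let $q=e^{2\pi iz}$, $\operatorname{Im}z>0$, $(q)_n=\prod_{k=1}^n(1-q^k)$. For a real positive definite symmetric $r\times r$ matrix $A$, $B\in\mathbb{R}^r$, $C\in\mathbb{R}$, $$F_{A,B,C}(q)=\sum_{n\in(\mathbb{Z}_{\ge0})^r}\frac{q^{\frac12n^TAn+n^TB+C}}{(q)_{n_1}\cdots(q)_{n_r}}.$$ It is a modular function if $f(z)=F_{A,B,C}(e^{2\pi iz})$ is a modular function of some integer weight for some finite index subgroup of $SL(2,\mathbb{Z})$ (holomorphic on the upper half-plane, meromorphic at cusps). Solutions with fractional exponents: if $d$ is a positive integer with $dA$ integral, a solution of $1-Q_i=\prod_jQ_j^{A_{ij}}$ is a tuple of nonzero complex numbers $Q_i$, $Q_i\neq 1$, for which there are $x_i\in\mathbb{C}^*$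 with $x_i^d=Q_i$ and $1-Q_i=\prod_jx_j^{dA_{ij}}$ for all $i$ (i.e. the system is regarded as algebraic in the variables $Q_i^{1/d}$; here $d=4$ for the first matrix and $d=2$ for the second). Bloch group $B(K)$ of a field $K$: the quotient of the kernel of $\mathbb{Z}[K^*\setminus\{1\}]\to\Lambda^2K^*$, $[x]\mapsto x\wedge(1-x)$ (with $\Lambda^2K^*$ taken modulo torsion) by the subgroup generated by all elements $[x]+[1-x]$, $[x]+[1/x]$, and $[x]+[y]+[1-xy]+\bigl[\frac{1-x}{1-xy}\bigr]+\bigl[\frac{1-y}{1-xy}\bigr]$ (with $xy\ne1$). For a solution in a number field $K$, symmetry of $A$ implies that $\sum_i[Q_i]$ lies in this kernel, and "the corresponding Bloch group" is $B(K)$ with $K=\mathbb{Q}(Q_1,\dots,Q_r)$. *)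

theory Defs
  imports
    "HOL-Complex_Analysis.Complex_Analysis"
    "HOL-Algebra.Free_Abelian_Groups"
    "HOL-Algebra.Generated_Fields"
    "HOL-Algebra.Algebraic_Closure_Type"
begin

no_notation fps_nth (infixl "$" 75)

section \<open>Modular functions\<close>

definition upper_half_plane :: "complex set" where
  "upper_half_plane = {z. Im z > 0}"

definition SL2Z :: "(int ^ 2 ^ 2) monoid" where
  "SL2Z = \<lparr>carrier = {M. det M = 1}, monoid.mult = (**), one = mat 1\<rparr>"

definition slash :: "int \<Rightarrow> (complex \<Rightarrow> complex) \<Rightarrow> int ^ 2 ^ 2 \<Rightarrow> complex \<Rightarrow> complex" where
  "slash k f M z =
     (of_int (M $ 2 $ 1) * z + of_int (M $ 2 $ 2)) powi (- k) *
     f ((of_int (M $ 1 $ 1) * z + of_int (M $ 1 $ 2)) /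
        (of_int (M $ 2 $ 1) * z + of_int (M $ 2 $ 2)))"

text \<open>On the half-plane \<open>f\<close> is a function of \<open>exp (2 \<pi> i z / h)\<close> for some width \<open>h\<close>, and this
  function has at most a pole at \<open>0\<close>.  The value of \<open>g\<close> at \<open>0\<close> itself plays no role.\<close>

definition meromorphic_at_ii_inf :: "(complex \<Rightarrow> complex) \<Rightarrow> bool" where
  "meromorphic_at_ii_inf f \<longleftrightarrow>
     (\<exists>h::nat. h > 0 \<and> (\<exists>g. g meromorphic_on {0} \<and>
        (\<forall>z\<in>upper_half_plane. f z = g (exp (2 * of_real pi * \<i> * z / of_nat h)))))"

text \<open>Every cusp is the image of \<open>i\<infinity>\<close> under some element of \<open>SL(2,\<int>)\<close>, hence the quantification
  over all of \<open>SL(2,\<int>)\<close> in the last conjunct.\<close>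

definition modular_function_of ::
    "int \<Rightarrow> (int ^ 2 ^ 2) set \<Rightarrow> (complex \<Rightarrow> complex) \<Rightarrow> bool" where
  "modular_function_of k \<Gamma> f \<longleftrightarrow>
     f holomorphic_on upper_half_plane \<and>
     (\<forall>M\<in>\<Gamma>. \<forall>z\<in>upper_half_plane. slash k f M z = f z) \<and>
     (\<forall>M\<in>carrier SL2Z. meromorphic_at_ii_inf (slash k f M))"

definition modular_function :: "(complex \<Rightarrow> complex) \<Rightarrow> bool" where
  "modular_function f \<longleftrightarrow>
     (\<exists>k \<Gamma>. subgroup \<Gamma> SL2Z \<and> finite (rcosets\<^bsub>SL2Z\<^esub> \<Gamma>) \<and> modular_function_of k \<Gamma> f)"


section \<open>Nahm sums\<close>

definition qpoch :: "complex \<Rightarrow> nat \<Rightarrow> complex" where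
  "qpoch q n = (\<Prod>k=1..n. 1 - q ^ k)"

definition nahm_exponent ::
    "real ^ 'r ^ 'r \<Rightarrow> real ^ 'r \<Rightarrow> real \<Rightarrow> nat ^ 'r \<Rightarrow> real" where
  "nahm_exponent A B C n =
     (let v = (\<chi> i. real (n $ i)) in v \<bullet> (A *v v) / 2 + v \<bullet> B + C)"

text \<open>The Nahm sum as a function of \<open>z\<close>, where \<open>q = exp (2 \<pi> i z)\<close>; the real powers \<open>q\<^sup>s\<close> are read as
  \<open>exp (2 \<pi> i z s)\<close>.\<close>

definition nahm_sum ::
    "real ^ 'r ^ 'r \<Rightarrow> real ^ 'r \<Rightarrow> real \<Rightarrow> complex \<Rightarrow> complex" where
  "nahm_sum A B C z =
     (\<Sum>\<^sub>\<infinity>n\<in>UNIV. exp (2 * of_real pi * \<i> * z * of_real (nahm_exponent A B C n)) /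
                 (\<Prod>i\<in>UNIV. qpoch (exp (2 * of_real pi * \<i> * z)) (n $ i)))"

text \<open>Meaningful only if all entries of \<open>d \<cdot> A\<close> are integers, in which case the floor just converts
  them to \<^typ>\<open>int\<close>.\<close>

definition nahm_solution :: "nat \<Rightarrow> real ^ 'r ^ 'r \<Rightarrow> complex ^ 'r \<Rightarrow> bool" where
  "nahm_solution d A Q \<longleftrightarrow>
     (\<forall>i. Q $ i \<noteq> 0 \<and> Q $ i \<noteq> 1) \<and>
     (\<exists>x :: complex ^ 'r. \<forall>i. x $ i \<noteq> 0 \<and> (x $ i) ^ d = Q $ i \<and>
        1 - Q $ i = (\<Prod>j\<in>UNIV. (x $ j) powi \<lfloor>real d * A $ i $ j\<rfloor>))"


section \<open>The Bloch group\<close>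

text \<open>A field is given as a subfield \<open>K\<close> of an ambient type of class \<^class>\<open>field\<close>.  All groups are
  written multiplicatively as \<^typ>\<open>'a monoid\<close>, except that elements of free abelian groups are
  formal sums.\<close>

definition torsion_elements :: "('g, 'm) monoid_scheme \<Rightarrow> 'g set" where
  "torsion_elements G = {x \<in> carrier G. \<exists>n::nat. n > 0 \<and> x [^]\<^bsub>G\<^esub> n = \<one>\<^bsub>G\<^esub>}"

abbreviation free_pairs :: "'a::field set \<Rightarrow> ('a \<times> 'a \<Rightarrow>\<^sub>0 int) monoid" where
  "free_pairs K \<equiv> free_Abelian_group ((K - {0}) \<times> (K - {0}))"

definition wedge_relations :: "'a::field set \<Rightarrow> ('a \<times> 'a \<Rightarrow>\<^sub>0 int) set" where
  "wedge_relations K = generate (free_pairs K)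
     ({frag_of (x * y, z) - frag_of (x, z) - frag_of (y, z) | x y z.
         x \<in> K - {0} \<and> y \<in> K - {0} \<and> z \<in> K - {0}} \<union>
      {frag_of (x, y * z) - frag_of (x, y) - frag_of (x, z) | x y z.
         x \<in> K - {0} \<and> y \<in> K - {0} \<and> z \<in> K - {0}} \<union>
      {frag_of (x, x) | x. x \<in> K - {0}})"

definition exterior_square :: "'a::field set \<Rightarrow> ('a \<times> 'a \<Rightarrow>\<^sub>0 int) set monoid" where
  "exterior_square K = free_pairs K Mod wedge_relations K"

definition exterior_square_mod_torsion ::
    "'a::field set \<Rightarrow> ('a \<times> 'a \<Rightarrow>\<^sub>0 int) set set monoid" where
  "exterior_square_mod_torsion K = exterior_square K Mod torsion_elements (exterior_square K)"

text \<open>The homomorphism with \<open>[x] \<mapsto> x \<and> (1 - x)\<close>: extend linearly to formal sums of pairs, then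
  pass to the two successive quotients.\<close>

definition bloch_boundary ::
    "'a::field set \<Rightarrow> ('a \<Rightarrow>\<^sub>0 int) \<Rightarrow> ('a \<times> 'a \<Rightarrow>\<^sub>0 int) set set" where
  "bloch_boundary K \<xi> =
     torsion_elements (exterior_square K) #>\<^bsub>exterior_square K\<^esub>
       (wedge_relations K #>\<^bsub>free_pairs K\<^esub> frag_extend (\<lambda>x. frag_of (x, 1 - x)) \<xi>)"

definition bloch_kernel :: "'a::field set \<Rightarrow> ('a \<Rightarrow>\<^sub>0 int) set" where
  "bloch_kernel K =
     kernel (free_Abelian_group (K - {0, 1})) (exterior_square_mod_torsion K) (bloch_boundary K)"

definition bloch_relations :: "'a::field set \<Rightarrow> ('a \<Rightarrow>\<^sub>0 int) set" where
  "bloch_relations K = generate (free_Abelian_group (K - {0, 1}))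
     ({frag_of x + frag_of (1 - x) | x. x \<in> K - {0, 1}} \<union>
      {frag_of x + frag_of (1 / x) | x. x \<in> K - {0, 1}} \<union>
      {frag_of x + frag_of y + frag_of (1 - x * y) + frag_of ((1 - x) / (1 - x * y)) +
         frag_of ((1 - y) / (1 - x * y)) | x y.
         x \<in> K - {0, 1} \<and> y \<in> K - {0, 1} \<and> x * y \<noteq> 1})"

definition bloch_group :: "'a::field set \<Rightarrow> ('a \<Rightarrow>\<^sub>0 int) set monoid" where
  "bloch_group K =
     (free_Abelian_group (K - {0, 1}))\<lparr>carrier := bloch_kernel K\<rparr> Mod bloch_relations K"

text \<open>The class in \<open>B(K)\<close> of an element \<open>\<xi>\<close> of the kernel.\<close>

definition bloch_class :: "'a::field set \<Rightarrow> ('a \<Rightarrow>\<^sub>0 int) \<Rightarrow> ('a \<Rightarrow>\<^sub>0 int) set" where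
  "bloch_class K \<xi> =
     bloch_relations K #>\<^bsub>(free_Abelian_group (K - {0, 1}))\<lparr>carrier := bloch_kernel K\<rparr>\<^esub> \<xi>"

definition solution_field :: "complex ^ 'r \<Rightarrow> complex set" where
  "solution_field Q = generate_field ring_of_type_algebra (range (($) Q))"


section \<open>Well-definedness\<close>

lemma SL2Z_det_iff: "M \<in> carrier SL2Z \<longleftrightarrow> M $ 1 $ 1 * M $ 2 $ 2 - M $ 1 $ 2 * M $ 2 $ 1 = 1"
  by (simp add: SL2Z_def det_2)

lemma group_SL2Z: "group SL2Z"
proof (rule groupI)
  fix M assume M: "M \<in> carrier SL2Z"
  define N :: "int ^ 2 ^ 2" where
    "N = vector [vector [M $ 2 $ 2, - M $ 1 $ 2], vector [- M $ 2 $ 1, M $ 1 $ 1]]"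
  have "N \<in> carrier SL2Z"
    using M by (simp add: SL2Z_det_iff N_def vector_2 algebra_simps)
  moreover have "N ** M = mat 1"
    using M unfolding vec_eq_iff forall_2 matrix_matrix_mult_def mat_def sum_2
    by (simp add: SL2Z_det_iff N_def vector_2 mult.commute)
  ultimately show "\<exists>N\<in>carrier SL2Z. N \<otimes>\<^bsub>SL2Z\<^esub> M = \<one>\<^bsub>SL2Z\<^esub>"
    by (auto simp: SL2Z_def)
qed (auto simp: SL2Z_def det_mul matrix_mul_assoc)

lemma subfield_closed:
  assumes "subfield K (ring_of_type_algebra :: 'a::field ring)"
  shows "0 \<in> K" "1 \<in> K" "\<And>x. x \<in> K \<Longrightarrow> - x \<in> K" "\<And>x y. x \<in> K \<Longrightarrow> y \<in> K \<Longrightarrow> x + y \<in> K"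
    "\<And>x y. x \<in> K \<Longrightarrow> y \<in> K \<Longrightarrow> x - y \<in> K" "\<And>x y. x \<in> K \<Longrightarrow> y \<in> K \<Longrightarrow> x * y \<in> K"
    "\<And>x. x \<in> K \<Longrightarrow> inverse x \<in> K" "\<And>x y. x \<in> K \<Longrightarrow> y \<in> K \<Longrightarrow> x / y \<in> K"
proof -
  let ?R = "ring_of_type_algebra :: 'a ring"
  interpret R: field ?R by (rule field_from_type_algebra)
  note sr = subfieldE(1)[OF assms]
  have ops: "\<one>\<^bsub>?R\<^esub> = 1" "\<zero>\<^bsub>?R\<^esub> = 0" "\<And>x y. x \<oplus>\<^bsub>?R\<^esub> y = x + y" "\<And>x y. x \<otimes>\<^bsub>?R\<^esub> y = x * y"
    "carrier ?R = UNIV"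
    by (auto simp: ring_of_type_algebra_def)
  have um: "\<ominus>\<^bsub>?R\<^esub> x = - x" for x
    by (rule R.minus_equality) (auto simp: ops)
  show z: "0 \<in> K" and "1 \<in> K" and neg: "\<And>x. x \<in> K \<Longrightarrow> - x \<in> K"
    and add: "\<And>x y. x \<in> K \<Longrightarrow> y \<in> K \<Longrightarrow> x + y \<in> K"
    and mul: "\<And>x y. x \<in> K \<Longrightarrow> y \<in> K \<Longrightarrow> x * y \<in> K"
    using subringE(2,3,5,6,7)[OF sr] by (auto simp: ops um)
  show "\<And>x y. x \<in> K \<Longrightarrow> y \<in> K \<Longrightarrow> x - y \<in> K"
    using add neg by (metis diff_conv_add_uminus)
  show inv: "\<And>x. x \<in> K \<Longrightarrow> inverse x \<in> K"
  proof -
    fix x assume x: "x \<in> K"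
    show "inverse x \<in> K"
    proof (cases "x = 0")
      case False
      have "inv\<^bsub>?R\<^esub> x = inverse x"
        by (rule R.comm_inv_char) (use False in \<open>auto simp: ops\<close>)
      moreover have "inv\<^bsub>?R\<^esub> x \<in> K"
        using R.subfield_m_inv(1)[OF assms, of x] x False by (auto simp: ops)
      ultimately show ?thesis by simp
    qed (use z in auto)
  qed
  show "\<And>x y. x \<in> K \<Longrightarrow> y \<in> K \<Longrightarrow> x / y \<in> K"
    using inv mul by (simp add: divide_inverse)
qed

lemma subfield_solution_field: "subfield (solution_field Q) ring_of_type_algebra"
  unfolding solution_field_def
  by (rule field.generate_field_is_subfield[OF field_from_type_algebra])
     (auto simp: ring_of_type_algebra_def)

lemma solution_in_solution_field: "Q $ i \<in> solution_field Q"
  unfolding solution_field_def by (rule generate_field.incl) auto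

lemma subgroup_torsion_elements:
  fixes G (structure)
  assumes "comm_group G"
  shows "subgroup (torsion_elements G) G"
proof -
  interpret comm_group G by (rule assms)
  show ?thesis
  proof
    show "torsion_elements G \<subseteq> carrier G" by (auto simp: torsion_elements_def)
    show "\<one> \<in> torsion_elements G" by (auto simp: torsion_elements_def intro!: exI[of _ 1])
  next
    fix x y assume "x \<in> torsion_elements G" "y \<in> torsion_elements G"
    then obtain m n :: nat where *: "x \<in> carrier G" "y \<in> carrier G" "m > 0" "n > 0"
      "x [^] m = \<one>" "y [^] n = \<one>" by (auto simp: torsion_elements_def)
    have "x [^] (m * n) = \<one>" "y [^] (m * n) = \<one>"
      using * by (metis nat_pow_pow nat_pow_one, metis nat_pow_pow nat_pow_one mult.commute)
    then have "(x \<otimes> y) [^] (m * n) = \<one>"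
      using * by (simp add: nat_pow_distrib)
    with * show "x \<otimes> y \<in> torsion_elements G"
      by (auto simp: torsion_elements_def intro!: exI[of _ "m * n"])
  next
    fix x assume "x \<in> torsion_elements G"
    then obtain m :: nat where *: "x \<in> carrier G" "m > 0" "x [^] m = \<one>"
      by (auto simp: torsion_elements_def)
    then have "(inv x) [^] m = \<one>" by (simp add: nat_pow_inv)
    with * show "inv x \<in> torsion_elements G"
      by (auto simp: torsion_elements_def)
  qed
qed

text \<open>Facts valid in every subfield \<open>K\<close>.  \<open>W\<close> abbreviates the group of relations of the exterior
  square; membership in the kernel is reduced to membership of a multiple in \<open>W\<close>.\<close>

locale bloch_subfield =
  fixes K :: "'a::field set"
  assumes subfield: "subfield K ring_of_type_algebra"
begin

abbreviation "U \<equiv> K - {0}"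
abbreviation "W \<equiv> wedge_relations K"

lemmas closed = subfield_closed[OF subfield]

lemma subgroup_W: "subgroup W (free_pairs K)"
  unfolding wedge_relations_def
proof (rule group.generate_is_subgroup)
  have k: "Poly_Mapping.keys (frag_of p - frag_of q - frag_of r) \<subseteq> U \<times> U"
    if "p \<in> U \<times> U" "q \<in> U \<times> U" "r \<in> U \<times> U" for p q r
    using that keys_diff[of "frag_of p - frag_of q" "frag_of r"] keys_diff[of "frag_of p" "frag_of q"]
    by auto
  have *: "frag_of p - frag_of q - frag_of r \<in> carrier (free_pairs K)"
    if "p \<in> U \<times> U" "q \<in> U \<times> U" "r \<in> U \<times> U" for p q r
    unfolding carrier_free_Abelian_group_iff by (rule k[OF that])
  have U_mult: "x * y \<in> U" if "x \<in> U" "y \<in> U" for x y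
    using that closed(6) by auto
  show "{frag_of (x * y, z) - frag_of (x, z) - frag_of (y, z) | x y z.
         x \<in> U \<and> y \<in> U \<and> z \<in> U} \<union>
      {frag_of (x, y * z) - frag_of (x, y) - frag_of (x, z) | x y z.
         x \<in> U \<and> y \<in> U \<and> z \<in> U} \<union>
      {frag_of (x, x) | x. x \<in> U} \<subseteq> carrier (free_pairs K)"
    apply (intro Un_least subsetI)
    subgoal by (elim CollectE exE conjE, hypsubst, rule *) (use U_mult in blast)+
    subgoal by (elim CollectE exE conjE, hypsubst, rule *) (use U_mult in blast)+
    subgoal by auto
    done
qed simp

lemma W_keys: "w \<in> W \<Longrightarrow> Poly_Mapping.keys w \<subseteq> U \<times> U"
  using subgroup.mem_carrier[OF subgroup_W] unfolding carrier_free_Abelian_group_iff .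

lemma W_0: "0 \<in> W"
  using subgroup.one_closed[OF subgroup_W] by simp

lemma W_add: "v \<in> W \<Longrightarrow> w \<in> W \<Longrightarrow> v + w \<in> W"
  using subgroup.m_closed[OF subgroup_W] by simp

lemma W_minus: "w \<in> W \<Longrightarrow> - w \<in> W"
  using subgroup.m_inv_closed[OF subgroup_W] W_keys by (metis inv_free_Abelian_group)

lemma W_diff: "v \<in> W \<Longrightarrow> w \<in> W \<Longrightarrow> v - w \<in> W"
  using W_add W_minus by (metis diff_conv_add_uminus)

lemma W_cmul: assumes "w \<in> W" shows "frag_cmul k w \<in> W"
proof (induction k rule: int_induct[where k = 0])
  case (step1 i)
  then show ?case using W_add[OF _ assms] by (simp add: frag_cmul_distrib)
next
  case (step2 i)
  then show ?case using W_diff[OF _ assms] by (simp add: frag_cmul_diff_distrib frag_cmul_distrib left_diff_distrib)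
qed (simp add: W_0)

lemma W_sum: "(\<And>i. i \<in> I \<Longrightarrow> f i \<in> W) \<Longrightarrow> sum f I \<in> W"
  by (induction I rule: infinite_finite_induct) (auto simp: W_0 W_add)

lemma W_mult_left:
  "x \<in> U \<Longrightarrow> y \<in> U \<Longrightarrow> z \<in> U \<Longrightarrow> frag_of (x * y, z) - frag_of (x, z) - frag_of (y, z) \<in> W"
  unfolding wedge_relations_def by (rule generate.incl) blast

lemma W_mult_right:
  "x \<in> U \<Longrightarrow> y \<in> U \<Longrightarrow> z \<in> U \<Longrightarrow> frag_of (x, y * z) - frag_of (x, y) - frag_of (x, z) \<in> W"
  unfolding wedge_relations_def by (rule generate.incl) blast

lemma W_diag: "x \<in> U \<Longrightarrow> frag_of (x, x) \<in> W"
  unfolding wedge_relations_def by (rule generate.incl) blast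

lemma W_antisym:
  assumes "x \<in> U" "y \<in> U"
  shows "frag_of (x, y) + frag_of (y, x) \<in> W"
proof -
  have xy: "x * y \<in> U" using assms closed(6) by auto
  have "frag_of (x * y, x * y)
     - (frag_of (x * y, x * y) - frag_of (x, x * y) - frag_of (y, x * y))
     - (frag_of (x, x * y) - frag_of (x, x) - frag_of (x, y))
     - (frag_of (y, x * y) - frag_of (y, x) - frag_of (y, y))
     - frag_of (x, x) - frag_of (y, y) \<in> W"
    by (intro W_diff W_diag W_mult_left W_mult_right assms xy)
  then show ?thesis by (simp add: algebra_simps)
qed

lemma comm_group_exterior_square: "comm_group (exterior_square K)"
  unfolding exterior_square_def
  by (rule comm_group.abelian_FactGroup[OF abelian_free_Abelian_group subgroup_W])

lemma coset_hom: "(#>\<^bsub>free_pairs K\<^esub>) W \<in> hom (free_pairs K) (exterior_square K)"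
  unfolding exterior_square_def
  by (rule normal.r_coset_hom_Mod)
     (simp add: comm_group.normal_iff_subgroup[OF abelian_free_Abelian_group] subgroup_W)

lemma coset_eq_W_iff: "Poly_Mapping.keys w \<subseteq> U \<times> U \<Longrightarrow> W #>\<^bsub>free_pairs K\<^esub> w = W \<longleftrightarrow> w \<in> W"
  using group.coset_join1[OF group_free_Abelian_group _ _ subgroup_W]
    group.coset_join2[OF group_free_Abelian_group _ subgroup_W] carrier_free_Abelian_group_iff by metis

lemma torsion_coset_iff:
  assumes "Poly_Mapping.keys w \<subseteq> U \<times> U"
  shows "torsion_elements (exterior_square K) #>\<^bsub>exterior_square K\<^esub> (W #>\<^bsub>free_pairs K\<^esub> w)
            = torsion_elements (exterior_square K)
         \<longleftrightarrow> (\<exists>n::nat. n > 0 \<and> frag_cmul (int n) w \<in> W)"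
proof -
  interpret E: comm_group "exterior_square K" by (rule comm_group_exterior_square)
  interpret h: group_hom "free_pairs K" "exterior_square K" "(#>\<^bsub>free_pairs K\<^esub>) W"
    by (intro group_hom.intro group_hom_axioms.intro group_free_Abelian_group E.is_group coset_hom)
  let ?T = "torsion_elements (exterior_square K)"
  have T: "subgroup ?T (exterior_square K)"
    by (rule subgroup_torsion_elements[OF comm_group_exterior_square])
  have w: "W #>\<^bsub>free_pairs K\<^esub> w \<in> carrier (exterior_square K)"
    using h.hom_closed assms by simp
  have pow: "(W #>\<^bsub>free_pairs K\<^esub> w) [^]\<^bsub>exterior_square K\<^esub> n = W #>\<^bsub>free_pairs K\<^esub> (frag_cmul (int n) w)" for n :: nat
    using h.hom_nat_pow[of w n] assms by simp
  have one: "\<one>\<^bsub>exterior_square K\<^esub> = W" by (simp add: exterior_square_def)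
  have "?T #>\<^bsub>exterior_square K\<^esub> (W #>\<^bsub>free_pairs K\<^esub> w) = ?T \<longleftrightarrow> W #>\<^bsub>free_pairs K\<^esub> w \<in> ?T"
    using E.coset_join1[OF _ w T] E.coset_join2[OF w T] by blast
  also have "\<dots> \<longleftrightarrow> (\<exists>n::nat. n > 0 \<and> frag_cmul (int n) w \<in> W)"
  proof -
    have "Poly_Mapping.keys (frag_cmul (int n) w) \<subseteq> U \<times> U" for n
      using assms keys_cmul by (rule order_trans[rotated])
    then show ?thesis
      unfolding torsion_elements_def using w
      by (simp only: mem_Collect_eq pow one coset_eq_W_iff simp_thms)
  qed
  finally show ?thesis .
qed

lemma keys_boundary:
  assumes "Poly_Mapping.keys \<xi> \<subseteq> K - {0, 1}"
  shows "Poly_Mapping.keys (frag_extend (\<lambda>x. frag_of (x, 1 - x)) \<xi>) \<subseteq> U \<times> U"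
proof -
  have "Poly_Mapping.keys (frag_extend (\<lambda>x. frag_of (x, 1 - x)) \<xi>) \<subseteq> (\<Union>x\<in>Poly_Mapping.keys \<xi>. Poly_Mapping.keys (frag_of (x, 1 - x)))"
    by (rule keys_frag_extend)
  also have "\<dots> \<subseteq> U \<times> U" using assms closed(2,5) by auto
  finally show ?thesis .
qed

lemma bloch_kernel_iff:
  "\<xi> \<in> bloch_kernel K \<longleftrightarrow> Poly_Mapping.keys \<xi> \<subseteq> K - {0, 1} \<and>
     (\<exists>n::nat. n > 0 \<and> frag_cmul (int n) (frag_extend (\<lambda>x. frag_of (x, 1 - x)) \<xi>) \<in> W)"
  unfolding bloch_kernel_def kernel_def bloch_boundary_def exterior_square_mod_torsion_def
  using torsion_coset_iff[OF keys_boundary, of \<xi>]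
  by (simp only: mem_Collect_eq carrier_free_Abelian_group_iff one_FactGroup cong: conj_cong)

lemma bloch_class_in_carrier:
  "\<xi> \<in> bloch_kernel K \<Longrightarrow> bloch_class K \<xi> \<in> carrier (bloch_group K)"
  by (auto simp: bloch_class_def bloch_group_def FactGroup_def RCOSETS_def)

text \<open>Working modulo \<open>W\<close>.\<close>

definition weq (infix "\<approx>\<^sub>W" 50) where "v \<approx>\<^sub>W w \<longleftrightarrow> v - w \<in> W"

lemma weq_refl: "v \<approx>\<^sub>W v" by (simp add: weq_def W_0)

lemma weq_sym: "v \<approx>\<^sub>W w \<Longrightarrow> w \<approx>\<^sub>W v"
  unfolding weq_def using W_minus[of "v - w"] by simp

lemma weq_trans [trans]: "u \<approx>\<^sub>W v \<Longrightarrow> v \<approx>\<^sub>W w \<Longrightarrow> u \<approx>\<^sub>W w"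
  unfolding weq_def using W_add[of "u - v" "v - w"] by simp

lemma weq_add: "u \<approx>\<^sub>W v \<Longrightarrow> u' \<approx>\<^sub>W v' \<Longrightarrow> u + u' \<approx>\<^sub>W v + v'"
  unfolding weq_def using W_add[of "u - v" "u' - v'"] by (simp add: add_diff_add)

lemma frag_cmul_diff: "frag_cmul k (u - v) = frag_cmul k u - frag_cmul k v"
  by (rule poly_mapping_eqI) (simp add: lookup_minus right_diff_distrib)

lemma weq_cmul: "u \<approx>\<^sub>W v \<Longrightarrow> frag_cmul k u \<approx>\<^sub>W frag_cmul k v"
  unfolding weq_def frag_cmul_diff[symmetric] by (rule W_cmul)

lemma weq_sum: "(\<And>i. i \<in> I \<Longrightarrow> f i \<approx>\<^sub>W g i) \<Longrightarrow> sum f I \<approx>\<^sub>W sum g I"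
  unfolding weq_def using W_sum[of I "\<lambda>i. f i - g i"] by (simp add: sum_subtractf)

lemma weq_mult_right:
  "x \<in> U \<Longrightarrow> y \<in> U \<Longrightarrow> z \<in> U \<Longrightarrow> frag_of (x, y * z) \<approx>\<^sub>W frag_of (x, y) + frag_of (x, z)"
  using W_mult_right by (simp add: weq_def algebra_simps)

lemma U_one: "1 \<in> U"
  using closed(2) by simp

lemma U_mult: "x \<in> U \<Longrightarrow> y \<in> U \<Longrightarrow> x * y \<in> U"
  by (simp add: closed(6))

lemma U_inverse: "x \<in> U \<Longrightarrow> inverse x \<in> U"
  by (simp add: closed(7))

lemma U_power: assumes "x \<in> U" shows "x ^ n \<in> U"
proof (induction n)
  case 0
  show ?case using U_one by simp
next
  case (Suc n)
  show ?case unfolding power_Suc by (rule U_mult[OF assms Suc])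
qed

lemma U_powi: assumes "x \<in> U" shows "x powi k \<in> U"
proof (cases "k \<ge> 0")
  case True
  show ?thesis unfolding power_int_def if_P[OF True] by (rule U_power[OF assms])
next
  case False
  show ?thesis unfolding power_int_def if_not_P[OF False] by (rule U_power[OF U_inverse[OF assms]])
qed

lemma weq_one_right: assumes "x \<in> U" shows "frag_of (x, 1) \<approx>\<^sub>W 0"
  using W_minus[OF W_mult_right[OF assms U_one U_one]] unfolding weq_def by simp

lemma weq_power_right:
  assumes "x \<in> U" "y \<in> U" shows "frag_of (x, y ^ n) \<approx>\<^sub>W frag_cmul (int n) (frag_of (x, y))"
proof (induction n)
  case 0
  show ?case
    unfolding power_0 of_nat_0 frag_cmul_zero by (rule weq_one_right[OF assms(1)])
next
  case (Suc n)
  have "frag_of (x, y ^ Suc n) \<approx>\<^sub>W frag_of (x, y) + frag_of (x, y ^ n)"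
    unfolding power_Suc by (rule weq_mult_right[OF assms U_power[OF assms(2)]])
  also have "\<dots> \<approx>\<^sub>W frag_of (x, y) + frag_cmul (int n) (frag_of (x, y))"
    by (rule weq_add[OF weq_refl Suc])
  also have "\<dots> = frag_cmul (int (Suc n)) (frag_of (x, y))"
    by (simp add: frag_cmul_distrib)
  finally show ?case .
qed

lemma weq_inverse_right:
  assumes "x \<in> U" "y \<in> U" shows "frag_of (x, inverse y) \<approx>\<^sub>W - frag_of (x, y)"
proof -
  have "y * inverse y = 1" using assms(2) by simp
  then have "frag_of (x, 1) \<approx>\<^sub>W frag_of (x, y) + frag_of (x, inverse y)"
    using weq_mult_right[OF assms U_inverse[OF assms(2)]] by (simp only:)
  from weq_trans[OF weq_sym[OF this] weq_one_right[OF assms(1)]]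
  show ?thesis unfolding weq_def diff_minus_eq_add diff_0_right by (simp only: add.commute)
qed

lemma weq_powi_right:
  assumes "x \<in> U" "y \<in> U" shows "frag_of (x, y powi k) \<approx>\<^sub>W frag_cmul k (frag_of (x, y))"
proof (cases "k \<ge> 0")
  case True
  show ?thesis
    using weq_power_right[OF assms, of "nat k"] unfolding power_int_def nat_0_le[OF True] if_P[OF True] .
next
  case False
  then have k: "int (nat (- k)) = - k" by simp
  have "frag_of (x, y powi k) = frag_of (x, inverse y ^ nat (- k))"
    unfolding power_int_def if_not_P[OF False] ..
  also have "\<dots> \<approx>\<^sub>W frag_cmul (- k) (frag_of (x, inverse y))"
    using weq_power_right[OF assms(1) U_inverse[OF assms(2)], of "nat (- k)"] unfolding k .
  also have "\<dots> \<approx>\<^sub>W frag_cmul (- k) (- frag_of (x, y))"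
    by (rule weq_cmul[OF weq_inverse_right[OF assms]])
  also have "\<dots> = frag_cmul k (frag_of (x, y))"
    by (rule poly_mapping_eqI) simp
  finally show ?thesis .
qed

lemma weq_prod_right:
  assumes "finite I" "x \<in> U" "\<And>i. i \<in> I \<Longrightarrow> f i \<in> U"
  shows "frag_of (x, \<Prod>i\<in>I. f i) \<approx>\<^sub>W (\<Sum>i\<in>I. frag_of (x, f i)) \<and> (\<Prod>i\<in>I. f i) \<in> U"
  using assms(1,3)
proof (induction I rule: finite_induct)
  case empty
  show ?case
    unfolding prod.empty sum.empty using weq_one_right[OF assms(2)] U_one by (rule conjI)
next
  case (insert i I)
  have IH: "frag_of (x, prod f I) \<approx>\<^sub>W (\<Sum>i\<in>I. frag_of (x, f i)) \<and> prod f I \<in> U"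
    by (rule insert.IH) (rule insert.prems, rule insertI2)
  note * = conjunct1[OF IH] conjunct2[OF IH] insert.prems[OF insertI1]
  have "frag_of (x, f i * prod f I) \<approx>\<^sub>W frag_of (x, f i) + (\<Sum>i\<in>I. frag_of (x, f i))"
    by (rule weq_trans[OF weq_mult_right[OF assms(2) *(3,2)] weq_add[OF weq_refl *(1)]])
  with U_mult[OF *(3,2)] show ?case
    unfolding prod.insert[OF insert.hyps] sum.insert[OF insert.hyps] by (rule conjI[rotated])
qed

end

text \<open>By symmetry of \<open>A\<close>, the element attached to a solution lies in the kernel, so that
  \<^const>\<open>bloch_class\<close> of it is indeed an element of the Bloch group.\<close>

lemma nahm_solution_in_bloch_kernel:
  fixes A :: "real ^ 'r ^ 'r" and Q :: "complex ^ 'r"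
  assumes sym: "transpose A = A" and d: "d > 0"
    and sol: "nahm_solution d A Q"
  shows "(\<Sum>i\<in>UNIV. frag_of (Q $ i)) \<in> bloch_kernel (solution_field Q)"
proof -
  interpret bloch_subfield "solution_field Q"
    by (rule bloch_subfield.intro[OF subfield_solution_field])
  define M where "M i j = \<lfloor>real d * A $ i $ j\<rfloor>" for i j
  have M_sym: "M i j = M j i" for i j
    using arg_cong[OF sym, of "\<lambda>N. N $ i $ j"] by (simp add: M_def transpose_def)
  obtain x :: "complex ^ 'r" where x: "\<And>i. x $ i \<noteq> 0" "\<And>i. (x $ i) ^ d = Q $ i"
      "\<And>i. 1 - Q $ i = (\<Prod>j\<in>UNIV. (x $ j) powi M i j)"
    using sol unfolding nahm_solution_def M_def by blast
  have Q: "Q $ i \<in> U" "Q $ i \<noteq> 1" "1 - Q $ i \<in> U" for i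
    using sol solution_in_solution_field[of Q i] closed(5)[OF closed(2), of "Q $ i"]
    by (simp_all add: nahm_solution_def)
  have pow: "(1 - Q $ i) ^ d = (\<Prod>j\<in>UNIV. (Q $ j) powi M i j)" for i
  proof -
    have "(x $ j powi M i j) ^ d = (x $ j ^ d) powi M i j" for j
      by (simp add: power_int_power power_int_power' mult.commute)
    then show ?thesis unfolding x(3) prod_power_distrib by (simp only: x(2))
  qed
  define w where "w = (\<Sum>i\<in>UNIV. frag_of (Q $ i, 1 - Q $ i))"
  have "frag_cmul (int d) w = (\<Sum>i\<in>UNIV. frag_cmul (int d) (frag_of (Q $ i, 1 - Q $ i)))"
    unfolding w_def by (simp add: frag_cmul_sum)
  also have "weq \<dots> (\<Sum>i\<in>UNIV. frag_of (Q $ i, (1 - Q $ i) ^ d))"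
    by (intro weq_sum weq_sym[OF weq_power_right] Q)
  also have "weq \<dots> (\<Sum>i\<in>UNIV. \<Sum>j\<in>UNIV. frag_of (Q $ i, (Q $ j) powi M i j))"
    unfolding pow by (intro weq_sum conjunct1[OF weq_prod_right] Q U_powi) auto
  also have "weq \<dots> (\<Sum>i\<in>UNIV. \<Sum>j\<in>UNIV. frag_cmul (M i j) (frag_of (Q $ i, Q $ j)))" (is "weq _ ?S")
    by (intro weq_sum weq_powi_right Q)
  finally have 1: "weq (frag_cmul (int d) w) ?S" .
  have "?S = (\<Sum>i\<in>UNIV. \<Sum>j\<in>UNIV. frag_cmul (M i j) (frag_of (Q $ j, Q $ i)))"
    by (subst sum.swap) (simp add: M_sym)
  then have "?S + ?S = (\<Sum>i\<in>UNIV. \<Sum>j\<in>UNIV.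
      frag_cmul (M i j) (frag_of (Q $ i, Q $ j) + frag_of (Q $ j, Q $ i)))"
    by (simp add: frag_cmul_distrib2 sum.distrib)
  also have "\<dots> \<in> W" by (intro W_sum W_cmul W_antisym Q)
  finally have "frag_cmul (int d) w + frag_cmul (int d) w \<in> W"
    using W_add[of "frag_cmul (int d) w + frag_cmul (int d) w - (?S + ?S)" "?S + ?S"] weq_add[OF 1 1]
    unfolding weq_def by simp
  then have 2: "frag_cmul (int (d + d)) w \<in> W"
    by (simp only: of_nat_add frag_cmul_distrib)
  have "frag_extend (\<lambda>x. frag_of (x, 1 - x)) (\<Sum>i\<in>UNIV. frag_of (Q $ i)) = w"
    unfolding w_def by (simp add: frag_extend_sum)
  moreover have "Poly_Mapping.keys (\<Sum>i\<in>UNIV. frag_of (Q $ i)) \<subseteq> solution_field Q - {0, 1}"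
    using sum_closed_free_Abelian_group[of UNIV "\<lambda>i. frag_of (Q $ i)" "solution_field Q - {0, 1}"] Q
    by simp
  ultimately show ?thesis
    unfolding bloch_kernel_iff 
    by (intro conjI exI[of _ "d + d"]) (use 2 d in \<open>simp_all only: add_pos_pos\<close>)
qed

end

theory Submission
  imports Defs
begin

text \<open>Grouping the terms of each Nahm sum by \<open>n\<^sub>1 + n\<^sub>2\<close>, the inner sum is a Rogers--Szego polynomial at the
  square root of its base and factors. What remains is a Rogers--Ramanujan type sum, hence a quotient of
  products \<open>\<Prod>(1 - x q\<^sup>n)\<close>, that is, of Siegel functions. The Siegel functions of a given level are permuted
  by \<open>SL\<^sub>2(\<int>)\<close> up to roots of unity of bounded order; for the inversion this follows from Liouville's theorem.
  So the sums have finite orbits and are modular functions of weight 0.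
  On the other hand, the primitive sixth root of unity \<open>\<zeta>\<close> in the upper half-plane satisfies \<open>1 - \<zeta> = \<zeta>\<^sup>-\<^sup>1\<close>, and
  \<open>Q\<^sub>1 = Q\<^sub>2 = \<zeta>\<close> solves both systems. The Bloch--Wigner function defines a homomorphism from
  the Bloch group to the real numbers, and it does not vanish at \<open>\<zeta>\<close>.\<close>

section \<open>q-series\<close>

text \<open>Both matrices act as 1 on the direction (1, -1) and as 2 \<mu> on (1, 1), with \<mu> =
  1/4 and \<mu> = 1. The vector \<open>B\<close> = (1/4, -1/4) lies along (1, -1): the dependence on
  n1 - n2 then becomes half a triangular number, exactly the weight for which the inner sum factors.
  \<open>C\<close> is the power of q that leaves Siegel functions without an extra factor. The bad
  solution comes from the freedom in choosing the roots Q_i^(1/d). If both roots equal x, each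
  system becomes u^2 + u - 1 = 0 for u = x^2, so the Q_i are real and the Bloch--Wigner function
  vanishes there. The value \<zeta> appears only with two different roots of the same number.
  Multipliers of Siegel functions are not tracked exactly. Roots of unity of bounded order already
  give a finite orbit, a property that survives products, inverses and z -> p z / n, and that makes
  the stabiliser a subgroup of finite index. The one delicate multiplier is that of the inversion:
  Liouville's theorem is applied for fixed \<tau> and leaves a factor that could still vary with
  \<tau>.\<close>

definition qpinf :: "complex \<Rightarrow> complex \<Rightarrow> complex" where
  "qpinf x q = prodinf (\<lambda>n. 1 - x * q ^ n)"

lemma convergent_prod_qpinf:
  fixes q x :: complex
  assumes "norm q < 1"
  shows "convergent_prod (\<lambda>n. 1 - x * q ^ n)"
proof -
  have "summable (\<lambda>n. norm x * norm q ^ n)"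
    using assms by (intro summable_mult summable_geometric) auto
  then have "abs_convergent_prod (\<lambda>n. 1 - x * q ^ n)"
    by (intro summable_imp_abs_convergent_prod) (simp add: norm_mult norm_power)
  then show ?thesis by (rule abs_convergent_prod_imp_convergent_prod)
qed

lemma qpinf_LIMSEQ:
  assumes "norm q < 1"
  shows "(\<lambda>n. \<Prod>k<n. 1 - x * q ^ k) \<longlonglongrightarrow> qpinf x q"
  using convergent_prod_LIMSEQ[OF convergent_prod_qpinf[OF assms]]
  unfolding qpinf_def LIMSEQ_lessThan_iff_atMost by simp

text \<open>\<open>convergent_prod\<close> admits finitely many vanishing factors, and such a
  product is zero only through one of them.\<close>

lemma qpinf_eq_0_iff:
  assumes "norm q < 1"
  shows "qpinf x q = 0 \<longleftrightarrow> (\<exists>n. x * q ^ n = 1)"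
  using has_prod_eq_0_iff[OF convergent_prod_has_prod[OF convergent_prod_qpinf[OF assms, of x]]]
  unfolding qpinf_def by (auto simp: image_iff)

lemma qpinf_rec:
  assumes "norm q < 1"
  shows "qpinf x q = (1 - x) * qpinf (x * q) q"
proof (rule LIMSEQ_unique)
  show "(\<lambda>n. \<Prod>k<Suc n. 1 - x * q ^ k) \<longlonglongrightarrow> qpinf x q"
    using qpinf_LIMSEQ[OF assms] by (rule LIMSEQ_Suc)
  have "(\<Prod>k<Suc n. 1 - x * q ^ k) = (1 - x) * (\<Prod>k<n. 1 - x * q * q ^ k)" for n
    by (subst prod.lessThan_Suc_shift) (simp add: mult_ac)
  then show "(\<lambda>n. \<Prod>k<Suc n. 1 - x * q ^ k) \<longlonglongrightarrow> (1 - x) * qpinf (x * q) q"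
    using tendsto_mult_left[OF qpinf_LIMSEQ[OF assms]] by simp
qed

lemma qpinf_shift:
  assumes "norm q < 1"
  shows "qpinf x q = (\<Prod>k<n. 1 - x * q ^ k) * qpinf (x * q ^ n) q"
proof (induction n)
  case (Suc n)
  then show ?case using qpinf_rec[OF assms, of "x * q ^ n"] by (simp add: mult_ac)
qed simp

text \<open>Sorts the factors of (x; q)_\<infinity> = \<open>qpinf x q\<close> by the residue of the
  exponent modulo N; the partial products of length n N split exactly.\<close>

lemma qpinf_dissect:
  assumes "norm q < 1" "N > 0"
  shows "qpinf x q = (\<Prod>i<N. qpinf (x * q ^ i) (q ^ N))"
proof (rule LIMSEQ_unique)
  have "strict_mono (\<lambda>n. n * N)"
    using assms(2) by (simp add: strict_mono_def)
  then show "(\<lambda>n. \<Prod>k<n * N. 1 - x * q ^ k) \<longlonglongrightarrow> qpinf x q"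
    using LIMSEQ_subseq_LIMSEQ[OF qpinf_LIMSEQ[OF assms(1)]] by (simp add: o_def)
  have qN: "norm (q ^ N) < 1"
    using assms by (simp add: norm_power power_less_one_iff)
  have "(\<Prod>k<n * N. 1 - x * q ^ k) = (\<Prod>i<N. \<Prod>k<n. 1 - x * q ^ i * (q ^ N) ^ k)" for n
  proof -
    have "(\<Prod>k<n * N. 1 - x * q ^ k) = (\<Prod>m<n. \<Prod>k\<in>{m * N..<m * N + N}. 1 - x * q ^ k)"
      by (rule prod.nat_group[symmetric])
    also have "\<dots> = (\<Prod>m<n. \<Prod>i<N. 1 - x * q ^ (i + m * N))"
    proof (rule prod.cong[OF refl])
      fix m
      show "(\<Prod>k\<in>{m * N..<m * N + N}. 1 - x * q ^ k) = (\<Prod>i<N. 1 - x * q ^ (i + m * N))"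
        using prod.shift_bounds_nat_ivl[of "\<lambda>k. 1 - x * q ^ k" 0 "m * N" N]
        by (simp add: add.commute lessThan_atLeast0)
    qed
    also have "\<dots> = (\<Prod>i<N. \<Prod>m<n. 1 - x * q ^ (i + m * N))"
      by (rule prod.swap)
    finally show ?thesis
      by (simp add: power_add mult.assoc power_mult[symmetric] mult.commute)
  qed
  then show "(\<lambda>n. \<Prod>k<n * N. 1 - x * q ^ k) \<longlonglongrightarrow> (\<Prod>i<N. qpinf (x * q ^ i) (q ^ N))"
    using qpinf_LIMSEQ[OF qN] by (auto intro!: tendsto_prod)
qed

lemma qpinf_mult_neg:
  assumes "norm q < 1"
  shows "qpinf x q * qpinf (- x) q = qpinf (x\<^sup>2) (q\<^sup>2)"
proof (rule LIMSEQ_unique)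
  have q2: "norm (q\<^sup>2) < 1"
    using assms by (simp add: norm_power power_less_one_iff)
  have "(\<Prod>k<n. 1 - x * q ^ k) * (\<Prod>k<n. 1 - (- x) * q ^ k) = (\<Prod>k<n. 1 - x\<^sup>2 * (q\<^sup>2) ^ k)" for n
    unfolding prod.distrib[symmetric]
    by (intro prod.cong refl) (simp add: algebra_simps power2_eq_square power_mult_distrib)
  then show "(\<lambda>n. \<Prod>k<n. 1 - x\<^sup>2 * (q\<^sup>2) ^ k) \<longlonglongrightarrow> qpinf x q * qpinf (- x) q"
    using tendsto_mult[OF qpinf_LIMSEQ[OF assms, of x] qpinf_LIMSEQ[OF assms, of "- x"]] by simp
  show "(\<lambda>n. \<Prod>k<n. 1 - x\<^sup>2 * (q\<^sup>2) ^ k) \<longlonglongrightarrow> qpinf (x\<^sup>2) (q\<^sup>2)"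
    by (rule qpinf_LIMSEQ[OF q2])
qed

section \<open>Finite q-Pochhammer symbols and finite summation formulas\<close>

lemma qpoch_0 [simp]: "qpoch q 0 = 1"
  by (simp add: qpoch_def)

lemma qpoch_Suc: "qpoch q (Suc n) = (1 - q ^ Suc n) * qpoch q n"
  unfolding qpoch_def by (subst prod.nat_ivl_Suc') simp_all

lemma qpoch_altdef: "qpoch q n = (\<Prod>k<n. 1 - q * q ^ k)"
  by (induction n) (simp_all add: qpoch_Suc mult_ac)

lemma one_minus_power_nonzero:
  fixes q :: complex
  assumes "norm q < 1" "n > 0"
  shows "1 - q ^ n \<noteq> 0"
proof
  assume "1 - q ^ n = 0"
  then have "norm q ^ n = 1"
    by (metis norm_power norm_one right_minus_eq)
  moreover have "norm q ^ n < 1"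
    using assms by (simp add: power_less_one_iff)
  ultimately show False by simp
qed

lemma qpoch_nonzero:
  assumes "norm q < 1"
  shows "qpoch q n \<noteq> 0"
  using one_minus_power_nonzero[OF assms] by (induction n) (auto simp: qpoch_Suc simp del: power_Suc)

lemma qpoch_LIMSEQ:
  assumes "norm q < 1"
  shows "qpoch q \<longlonglongrightarrow> qpinf q q"
  using qpinf_LIMSEQ[OF assms, of q] unfolding qpoch_altdef[symmetric] .

lemma qpinf_self_nonzero:
  assumes "norm q < 1"
  shows "qpinf q q \<noteq> 0"
  using qpinf_eq_0_iff[OF assms, of q] one_minus_power_nonzero[OF assms, of "Suc n" for n] by auto

text \<open>The sequence 1 / (q)_n converges because its denominators tend to a nonzero limit. The
  bound supplies the dominating constants for the limit and summability arguments below.\<close>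

lemma inverse_qpoch_bound:
  assumes "norm q < 1"
  obtains C where "C > 0" "\<And>n. norm (1 / qpoch q n) \<le> C"
proof -
  have "(\<lambda>n. 1 / qpoch q n) \<longlonglongrightarrow> 1 / qpinf q q"
    by (intro tendsto_divide tendsto_const qpoch_LIMSEQ qpinf_self_nonzero assms)
  then have "Bseq (\<lambda>n. 1 / qpoch q n)"
    by (rule convergent_imp_Bseq[OF convergentI])
  then show ?thesis
    using that by (auto elim!: BseqE)
qed

text \<open>The ratio of consecutive terms is q^n r, which tends to 0 whatever the size of
  r.\<close>

lemma summable_power_choose_2:
  fixes q r :: real
  assumes "0 \<le> q" "q < 1" "r \<ge> 0"
  shows "summable (\<lambda>k. q ^ (k choose 2) * r ^ k)"
proof -
  have "(\<lambda>n. q ^ n * r) \<longlonglongrightarrow> 0 * r"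
    using assms by (intro tendsto_mult tendsto_const LIMSEQ_power_zero) auto
  then have "eventually (\<lambda>n. q ^ n * r < 1 / 2) sequentially"
    by (rule order_tendstoD) simp
  then obtain N where N: "\<And>n. n \<ge> N \<Longrightarrow> q ^ n * r < 1 / 2"
    by (auto simp: eventually_sequentially)
  show ?thesis
  proof (rule summable_ratio_test[of "1/2" N])
    fix n assume "n \<ge> N"
    have "q ^ (Suc n choose 2) * r ^ Suc n = (q ^ n * r) * (q ^ (n choose 2) * r ^ n)"
      by (simp add: numeral_2_eq_2 power_add)
    also have "\<dots> \<le> 1 / 2 * (q ^ (n choose 2) * r ^ n)"
      using N[OF \<open>n \<ge> N\<close>] assms by (intro mult_right_mono) auto
    finally show "norm (q ^ (Suc n choose 2) * r ^ Suc n) \<le> 1 / 2 * norm (q ^ (n choose 2) * r ^ n)"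
      using assms by simp
  qed simp
qed

text \<open>Splitting \<open>1 - q\<^sup>n\<^sup>+\<^sup>1\<close> as \<open>(1 - q\<^sup>j) + q\<^sup>j (1 - q\<^sup>i)\<close> with \<open>i + j = n + 1\<close> gives recurrences for
  all the finite sums below.\<close>

lemma qpoch_convolution_rec:
  assumes "norm q < 1"
  shows "(1 - q ^ Suc n) * (\<Sum>i\<le>Suc n. w i (Suc n - i) / (qpoch q i * qpoch q (Suc n - i))) =
    (\<Sum>i\<le>n. (w i (Suc (n - i)) + q ^ (n - i) * w (Suc i) (n - i)) / (qpoch q i * qpoch q (n - i)))"
proof -
  note nz = qpoch_nonzero[OF assms]
  have "(1 - q ^ Suc n) * (\<Sum>i\<le>Suc n. w i (Suc n - i) / (qpoch q i * qpoch q (Suc n - i))) =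
    (\<Sum>i\<le>Suc n. (1 - q ^ (Suc n - i)) * w i (Suc n - i) / (qpoch q i * qpoch q (Suc n - i))) +
    (\<Sum>i\<le>Suc n. q ^ (Suc n - i) * (1 - q ^ i) * w i (Suc n - i) / (qpoch q i * qpoch q (Suc n - i)))"
    unfolding sum.distrib[symmetric] sum_distrib_left
  proof (rule sum.cong[OF refl])
    fix i assume "i \<in> {..Suc n}"
    then have "q ^ Suc n = q ^ (Suc n - i) * q ^ i"
      by (simp flip: power_add)
    then have "1 - q ^ Suc n = (1 - q ^ (Suc n - i)) + q ^ (Suc n - i) * (1 - q ^ i)"
      by (simp add: algebra_simps)
    then show "(1 - q ^ Suc n) * (w i (Suc n - i) / (qpoch q i * qpoch q (Suc n - i))) =
      (1 - q ^ (Suc n - i)) * w i (Suc n - i) / (qpoch q i * qpoch q (Suc n - i)) +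
      q ^ (Suc n - i) * (1 - q ^ i) * w i (Suc n - i) / (qpoch q i * qpoch q (Suc n - i))"
      by (simp only: add_divide_distrib distrib_right times_divide_eq_right)
  qed
  also have "(\<Sum>i\<le>Suc n. (1 - q ^ (Suc n - i)) * w i (Suc n - i) / (qpoch q i * qpoch q (Suc n - i))) =
    (\<Sum>i\<le>n. w i (Suc (n - i)) / (qpoch q i * qpoch q (n - i)))"
  proof -
    have "(1 - q ^ (Suc n - i)) * w i (Suc n - i) / (qpoch q i * qpoch q (Suc n - i)) =
      w i (Suc (n - i)) / (qpoch q i * qpoch q (n - i))" if "i \<le> n" for i
      using that one_minus_power_nonzero[OF assms, of "Suc (n - i)"]
      by (simp add: Suc_diff_le qpoch_Suc divide_simps nz del: power_Suc)
    then show ?thesis by simp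
  qed
  also have "(\<Sum>i\<le>Suc n. q ^ (Suc n - i) * (1 - q ^ i) * w i (Suc n - i) / (qpoch q i * qpoch q (Suc n - i))) =
    (\<Sum>i\<le>n. q ^ (n - i) * w (Suc i) (n - i) / (qpoch q i * qpoch q (n - i)))"
  proof -
    have "q ^ (Suc n - Suc i) * (1 - q ^ Suc i) * w (Suc i) (Suc n - Suc i) /
        (qpoch q (Suc i) * qpoch q (Suc n - Suc i)) =
      q ^ (n - i) * w (Suc i) (n - i) / (qpoch q i * qpoch q (n - i))" for i
      using one_minus_power_nonzero[OF assms, of "Suc i"]
      by (simp add: qpoch_Suc divide_simps nz del: power_Suc)
    then show ?thesis by (subst sum.atMost_Suc_shift) simp
  qed
  finally show ?thesis
    by (simp add: sum.distrib[symmetric] add_divide_distrib)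
qed

lemma sum_atMost_reflect:
  fixes f :: "nat \<Rightarrow> nat \<Rightarrow> 'a::comm_monoid_add"
  shows "(\<Sum>i\<le>n. f i (n - i)) = (\<Sum>i\<le>n. f (n - i) i)"
  by (rule sum.reindex_bij_witness[of _ "\<lambda>i. n - i" "\<lambda>i. n - i"]) auto

text \<open>Gauss's q-binomial theorem divided by (q)_n. For this weight the recurrence collapses:
  passing from n to n + 1 contributes exactly the factor 1 + x q^n.\<close>

lemma q_binomial:
  assumes "norm q < 1"
  shows "(\<Sum>i\<le>n. q ^ (i choose 2) * x ^ i / (qpoch q i * qpoch q (n - i))) =
    (\<Prod>j<n. 1 + x * q ^ j) / qpoch q n"
proof (induction n)
  case (Suc n)
  have nz: "1 - q ^ Suc n \<noteq> 0"
    by (rule one_minus_power_nonzero[OF assms]) simp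
  have "(1 - q ^ Suc n) * (\<Sum>i\<le>Suc n. q ^ (i choose 2) * x ^ i / (qpoch q i * qpoch q (Suc n - i))) =
    (\<Sum>i\<le>n. (q ^ (i choose 2) * x ^ i + q ^ (n - i) * (q ^ (Suc i choose 2) * x ^ Suc i)) /
       (qpoch q i * qpoch q (n - i)))"
    by (rule qpoch_convolution_rec[OF assms, where w = "\<lambda>i j. q ^ (i choose 2) * x ^ i"])
  also have "\<dots> = (\<Sum>i\<le>n. (1 + x * q ^ n) * (q ^ (i choose 2) * x ^ i / (qpoch q i * qpoch q (n - i))))"
  proof (rule sum.cong[OF refl])
    fix i assume "i \<in> {..n}"
    then have "q ^ n = q ^ (n - i) * q ^ i" by (simp flip: power_add)
    then have "q ^ (n - i) * (q ^ (Suc i choose 2) * x ^ Suc i) = x * q ^ n * (q ^ (i choose 2) * x ^ i)"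
      by (simp add: numeral_2_eq_2 power_add)
    then show "(q ^ (i choose 2) * x ^ i + q ^ (n - i) * (q ^ (Suc i choose 2) * x ^ Suc i)) /
       (qpoch q i * qpoch q (n - i)) = (1 + x * q ^ n) * (q ^ (i choose 2) * x ^ i / (qpoch q i * qpoch q (n - i)))"
      by (simp add: algebra_simps)
  qed
  also have "\<dots> = (1 + x * q ^ n) * ((\<Prod>j<n. 1 + x * q ^ j) / qpoch q n)"
    unfolding sum_distrib_left[symmetric] Suc ..
  finally have "(\<Sum>i\<le>Suc n. q ^ (i choose 2) * x ^ i / (qpoch q i * qpoch q (Suc n - i))) =
      (1 + x * q ^ n) * ((\<Prod>j<n. 1 + x * q ^ j) / qpoch q n) / (1 - q ^ Suc n)"
    by (subst (asm) mult.commute) (rule eq_divide_imp[OF nz])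
  then show ?case by (simp add: qpoch_Suc mult_ac del: power_Suc sum.atMost_Suc)
qed (simp add: numeral_2_eq_2)

text \<open>The Rogers--Szego polynomial at \<open>s\<close> in base \<open>s\<^sup>2\<close>, and below the same polynomial in base \<open>s\<^sup>-\<^sup>2\<close>.\<close>

lemma rogers_szego_half:
  assumes "norm s < 1"
  shows "(\<Sum>i\<le>n. s ^ i / (qpoch (s\<^sup>2) i * qpoch (s\<^sup>2) (n - i))) = 1 / qpoch s n"
proof (induction n)
  case (Suc n)
  let ?S = "\<Sum>i\<le>Suc n. s ^ i / (qpoch (s\<^sup>2) i * qpoch (s\<^sup>2) (Suc n - i))"
  have s2: "norm (s\<^sup>2) < 1"
    using assms by (simp add: norm_power power_less_one_iff)
  have nz1: "(s\<^sup>2) ^ Suc n = s ^ Suc n * s ^ Suc n"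
    unfolding power2_eq_square by (rule power_mult_distrib)
  have nz: "(s\<^sup>2) ^ Suc n = s ^ Suc n * s ^ Suc n" "1 - s ^ Suc n * s ^ Suc n \<noteq> 0" "1 - s ^ Suc n \<noteq> 0"
    using one_minus_power_nonzero[OF s2, of "Suc n"] one_minus_power_nonzero[OF assms, of "Suc n"]
    unfolding nz1 by (simp_all only: not_False_eq_True simp_thms lessI zero_less_Suc)
  have "(1 - (s\<^sup>2) ^ Suc n) * (\<Sum>i\<le>Suc n. s ^ i / (qpoch (s\<^sup>2) i * qpoch (s\<^sup>2) (Suc n - i))) =
    (\<Sum>i\<le>n. (s ^ i + (s\<^sup>2) ^ (n - i) * s ^ Suc i) / (qpoch (s\<^sup>2) i * qpoch (s\<^sup>2) (n - i)))"
    by (rule qpoch_convolution_rec[OF s2, where w = "\<lambda>i j. s ^ i"])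
  \<comment> \<open>The second summand is s^(n+1) times the reflected weight, because 2 (n - i) + i
    + 1 = (n + 1) + (n - i). Reflection i -> n - i then identifies the two sums and leaves the
    factor 1 + s^(n+1), which cancels against 1 - s^(2n+2).\<close>
  also have "\<dots> = (\<Sum>i\<le>n. s ^ i / (qpoch (s\<^sup>2) i * qpoch (s\<^sup>2) (n - i))) +
     s ^ Suc n * (\<Sum>i\<le>n. s ^ (n - i) / (qpoch (s\<^sup>2) i * qpoch (s\<^sup>2) (n - i)))"
    unfolding sum_distrib_left sum.distrib[symmetric]
  proof (rule sum.cong[OF refl])
    fix i assume "i \<in> {..n}"
    then have "2 * (n - i) + Suc i = Suc n + (n - i)" by auto
    then have "(s\<^sup>2) ^ (n - i) * s ^ Suc i = s ^ Suc n * s ^ (n - i)"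
      by (simp only: power_mult[symmetric] power_add[symmetric])
    then show "(s ^ i + (s\<^sup>2) ^ (n - i) * s ^ Suc i) / (qpoch (s\<^sup>2) i * qpoch (s\<^sup>2) (n - i)) =
      s ^ i / (qpoch (s\<^sup>2) i * qpoch (s\<^sup>2) (n - i)) + s ^ Suc n * (s ^ (n - i) / (qpoch (s\<^sup>2) i * qpoch (s\<^sup>2) (n - i)))"
      by (simp add: add_divide_distrib del: power_Suc)
  qed
  also have "(\<Sum>i\<le>n. s ^ (n - i) / (qpoch (s\<^sup>2) i * qpoch (s\<^sup>2) (n - i))) =
      (\<Sum>i\<le>n. s ^ i / (qpoch (s\<^sup>2) i * qpoch (s\<^sup>2) (n - i)))"
    using sum_atMost_reflect[of "\<lambda>i j. s ^ j / (qpoch (s\<^sup>2) i * qpoch (s\<^sup>2) j)" n] by (simp add: mult_ac)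
  finally have "(1 - s ^ Suc n * s ^ Suc n) * (\<Sum>i\<le>Suc n. s ^ i / (qpoch (s\<^sup>2) i * qpoch (s\<^sup>2) (Suc n - i))) =
     (1 + s ^ Suc n) / qpoch s n"
    unfolding Suc nz(1) by (simp add: add_divide_distrib)
  moreover have "(1 - s ^ Suc n * s ^ Suc n) * (1 / qpoch s (Suc n)) = (1 + s ^ Suc n) / qpoch s n"
    using nz(3) qpoch_nonzero[OF assms, of n] by (simp add: qpoch_Suc field_simps del: power_Suc)
  ultimately have "(1 - s ^ Suc n * s ^ Suc n) * ?S = (1 - s ^ Suc n * s ^ Suc n) * (1 / qpoch s (Suc n))"
    by (simp only:)
  then show ?case
    using nz(2) by (simp only: mult_cancel_left) simp
qed simp

lemma rogers_szego_half_inverse_base: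
  fixes T :: "int \<Rightarrow> nat"
  assumes "norm s < 1" and T: "\<And>k. 2 * int (T k) = k * (k + 1)"
  shows "(\<Sum>i\<le>n. s ^ T (int i - int (n - i)) / (qpoch (s\<^sup>2) i * qpoch (s\<^sup>2) (n - i))) = 1 / qpoch s n"
proof (induction n)
  case 0
  have "T 0 = 0" using T[of 0] by simp
  then show ?case by simp
next
  case (Suc n)
  let ?S = "\<Sum>i\<le>Suc n. s ^ T (int i - int (Suc n - i)) / (qpoch (s\<^sup>2) i * qpoch (s\<^sup>2) (Suc n - i))"
  have s2: "norm (s\<^sup>2) < 1"
    using assms by (simp add: norm_power power_less_one_iff)
  have nz1: "(s\<^sup>2) ^ Suc n = s ^ Suc n * s ^ Suc n"
    unfolding power2_eq_square by (rule power_mult_distrib)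
  have nz: "(s\<^sup>2) ^ Suc n = s ^ Suc n * s ^ Suc n" "1 - s ^ Suc n * s ^ Suc n \<noteq> 0" "1 - s ^ Suc n \<noteq> 0"
    using one_minus_power_nonzero[OF s2, of "Suc n"] one_minus_power_nonzero[OF assms(1), of "Suc n"]
    unfolding nz1 by (simp_all only: not_False_eq_True simp_thms lessI zero_less_Suc)
  have "(1 - (s\<^sup>2) ^ Suc n) * (\<Sum>i\<le>Suc n. s ^ T (int i - int (Suc n - i)) / (qpoch (s\<^sup>2) i * qpoch (s\<^sup>2) (Suc n - i))) =
    (\<Sum>i\<le>n. (s ^ T (int i - int (Suc (n - i))) + (s\<^sup>2) ^ (n - i) * s ^ T (int (Suc i) - int (n - i))) / (qpoch (s\<^sup>2) i * qpoch (s\<^sup>2) (n - i)))"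
    by (rule qpoch_convolution_rec[OF s2, where w = "\<lambda>i j. s ^ T (int i - int j)"])
  also have "\<dots> = (\<Sum>i\<le>n. s ^ T (int (n - i) - int i) / (qpoch (s\<^sup>2) i * qpoch (s\<^sup>2) (n - i))) +
     s ^ Suc n * (\<Sum>i\<le>n. s ^ T (int i - int (n - i)) / (qpoch (s\<^sup>2) i * qpoch (s\<^sup>2) (n - i)))"
    unfolding sum_distrib_left sum.distrib[symmetric]
  proof (rule sum.cong[OF refl])
    fix i assume "i \<in> {..n}"
    then have n: "int n = int i + int (n - i)" by auto
    \<comment> \<open>Triangular numbers satisfy T(-k - 1) = T(k). Raising the second index
      therefore produces the reflected weight, just as in the previous lemma but with the roles of
      the two summands exchanged.\<close>
    have "2 * int (T (int i - int (Suc (n - i)))) = 2 * int (T (int (n - i) - int i))"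
      unfolding T by (simp add: algebra_simps)
    then have 1: "T (int i - int (Suc (n - i))) = T (int (n - i) - int i)" by simp
    have "2 * int (2 * (n - i) + T (int (Suc i) - int (n - i))) =
      2 * int (Suc n + T (int i - int (n - i)))"
      unfolding of_nat_add distrib_left T of_nat_mult of_nat_Suc n by (simp add: algebra_simps)
    then have "2 * (n - i) + T (int (Suc i) - int (n - i)) = Suc n + T (int i - int (n - i))"
      by (simp only: mult_cancel_left of_nat_eq_iff) simp
    then have 2: "(s\<^sup>2) ^ (n - i) * s ^ T (int (Suc i) - int (n - i)) = s ^ Suc n * s ^ T (int i - int (n - i))"
      by (simp only: power_mult[symmetric] power_add[symmetric])
    show "(s ^ T (int i - int (Suc (n - i))) + (s\<^sup>2) ^ (n - i) * s ^ T (int (Suc i) - int (n - i))) / (qpoch (s\<^sup>2) i * qpoch (s\<^sup>2) (n - i)) =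
      s ^ T (int (n - i) - int i) / (qpoch (s\<^sup>2) i * qpoch (s\<^sup>2) (n - i)) + s ^ Suc n * (s ^ T (int i - int (n - i)) / (qpoch (s\<^sup>2) i * qpoch (s\<^sup>2) (n - i)))"
      unfolding 1 2 by (simp add: add_divide_distrib del: power_Suc)
  qed
  also have "(\<Sum>i\<le>n. s ^ T (int (n - i) - int i) / (qpoch (s\<^sup>2) i * qpoch (s\<^sup>2) (n - i))) =
      (\<Sum>i\<le>n. s ^ T (int i - int (n - i)) / (qpoch (s\<^sup>2) i * qpoch (s\<^sup>2) (n - i)))"
    using sum_atMost_reflect[of "\<lambda>i j. s ^ T (int j - int i) / (qpoch (s\<^sup>2) i * qpoch (s\<^sup>2) j)" n] by (simp add: mult_ac)
  finally have "(1 - s ^ Suc n * s ^ Suc n) * (\<Sum>i\<le>Suc n. s ^ T (int i - int (Suc n - i)) / (qpoch (s\<^sup>2) i * qpoch (s\<^sup>2) (Suc n - i))) =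
     (1 + s ^ Suc n) / qpoch s n"
    unfolding Suc nz(1) by (simp add: add_divide_distrib)
  moreover have "(1 - s ^ Suc n * s ^ Suc n) * (1 / qpoch s (Suc n)) = (1 + s ^ Suc n) / qpoch s n"
    using nz(3) qpoch_nonzero[OF assms(1), of n] by (simp add: qpoch_Suc field_simps del: power_Suc)
  ultimately have "(1 - s ^ Suc n * s ^ Suc n) * ?S = (1 - s ^ Suc n * s ^ Suc n) * (1 / qpoch s (Suc n))"
    by (simp only:)
  then show ?case
    using nz(2) by (simp only: mult_cancel_left) simp
qed

text \<open>A case of the q-Chu--Vandermonde summation; it is the inner sum in Bailey's lemma. The
  induction keeps c arbitrary because the recurrence trades (n + 1, c) for (n, c + 1).\<close>

lemma q_vandermonde:
  assumes "norm q < 1"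
  shows "(\<Sum>i\<le>n. q ^ (i * (i + c)) / (qpoch q i * qpoch q (n - i) * qpoch q (i + c))) =
    1 / (qpoch q n * qpoch q (n + c))"
proof (induction n arbitrary: c)
  case (Suc n)
  \<comment> \<open>The weight is carried by j = n - i, so the sum is read backwards: only in this
    orientation do the two terms of the recurrence combine into the single weight for c + 1.\<close>
  define w where "w = (\<lambda>c (i::nat) j. q ^ (j * (j + c)) / qpoch q (j + c))"
  have w_sum: "(\<Sum>i\<le>n. q ^ (i * (i + c)) / (qpoch q i * qpoch q (n - i) * qpoch q (i + c))) =
     (\<Sum>i\<le>n. w c i (n - i) / (qpoch q i * qpoch q (n - i)))" for n c
    using sum_atMost_reflect[of "\<lambda>i j. w c i j / (qpoch q i * qpoch q j)" n]
    by (simp add: w_def mult_ac)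
  have nz: "1 - q ^ Suc n \<noteq> 0"
    by (rule one_minus_power_nonzero[OF assms]) simp
  have step: "w c i (Suc j) + q ^ j * w c (Suc i) j = w (Suc c) i j" for i j
  proof -
    have "Suc j * (Suc j + c) = j * (j + Suc c) + (j + Suc c)" "j * (j + Suc c) = j + j * (j + c)"
      by (simp_all add: algebra_simps)
    then have "w c i (Suc j) + q ^ j * w c (Suc i) j =
      q ^ (j * (j + Suc c)) * (q ^ Suc (j + c) / qpoch q (Suc (j + c)) + 1 / qpoch q (j + c))"
      unfolding w_def by (simp add: power_add distrib_left mult_ac)
    also have "q ^ Suc (j + c) / qpoch q (Suc (j + c)) + 1 / qpoch q (j + c) = 1 / qpoch q (Suc (j + c))"
      using one_minus_power_nonzero[OF assms, of "Suc (j + c)"] qpoch_nonzero[OF assms, of "j + c"]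
      by (simp add: qpoch_Suc field_simps del: power_Suc)
    finally show ?thesis by (simp add: w_def)
  qed
  have "(1 - q ^ Suc n) * (\<Sum>i\<le>Suc n. w c i (Suc n - i) / (qpoch q i * qpoch q (Suc n - i))) =
    (\<Sum>i\<le>n. w (Suc c) i (n - i) / (qpoch q i * qpoch q (n - i)))"
    unfolding qpoch_convolution_rec[OF assms, where w = "w c"] step ..
  also have "\<dots> = 1 / (qpoch q n * qpoch q (Suc n + c))"
    unfolding w_sum[symmetric] Suc by simp
  finally have "(\<Sum>i\<le>Suc n. w c i (Suc n - i) / (qpoch q i * qpoch q (Suc n - i))) =
      1 / (qpoch q n * qpoch q (Suc n + c)) / (1 - q ^ Suc n)"
    by (subst (asm) mult.commute) (rule eq_divide_imp[OF nz])
  also have "\<dots> = 1 / (qpoch q (Suc n) * qpoch q (Suc n + c))"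
    by (simp add: qpoch_Suc[of q n] mult_ac del: power_Suc)
  finally show ?case unfolding w_sum .
qed simp

text \<open>Tannery's theorem for sums whose upper limit also grows: the terms with k > n are
  replaced by 0, which affects no limit in n for fixed k.\<close>

lemma tannery_atMost:
  fixes a :: "nat \<Rightarrow> nat \<Rightarrow> complex"
  assumes lim: "\<And>k. (\<lambda>n. a k n) \<longlonglongrightarrow> b k" and bound: "\<And>k n. k \<le> n \<Longrightarrow> norm (a k n) \<le> M k"
    and M: "summable M"
  shows "(\<lambda>n. \<Sum>k\<le>n. a k n) \<longlonglongrightarrow> suminf b"
proof -
  define a' where "a' = (\<lambda>k n. if k \<le> n then a k n else 0)"
  have M0: "M k \<ge> 0" for k
    using bound[of k k] norm_ge_zero[of "a k k"] by linarith
  have "(\<lambda>n. a' k n) \<longlonglongrightarrow> b k" for k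
    using lim[of k]
    by (rule Lim_transform_eventually) (auto simp: a'_def eventually_sequentially intro!: exI[of _ k])
  moreover have "eventually (\<lambda>(k,n). norm (a' k n) \<le> M k) (at_top \<times>\<^sub>F sequentially)"
    using bound M0 by (intro always_eventually) (auto simp: a'_def)
  ultimately have "(\<lambda>n. suminf (\<lambda>k. a' k n)) \<longlonglongrightarrow> suminf b"
    using tannerys_theorem[of a' b sequentially M] M by simp
  moreover have "suminf (\<lambda>k. a' k n) = (\<Sum>k\<le>n. a k n)" for n
    by (subst suminf_finite[of "{..n}"]) (auto simp: a'_def)
  ultimately show ?thesis by simp
qed

lemma qpoch_diff_LIMSEQ:
  assumes "norm q < 1"
  shows "(\<lambda>n. qpoch q (n - k)) \<longlonglongrightarrow> qpinf q q"
  by (rule LIMSEQ_offset[where k = k]) (use qpoch_LIMSEQ[OF assms] in simp)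

text \<open>Euler's expansion of (-x; q)_\<infinity>, obtained by letting n tend to infinity on both
  sides of the q-binomial theorem and cancelling the common factor 1 / (q)_\<infinity>.\<close>

lemma euler_qpinf:
  assumes "norm q < 1"
  shows "suminf (\<lambda>i. q ^ (i choose 2) * x ^ i / qpoch q i) = qpinf (- x) q"
proof -
  obtain C where C: "C > 0" "\<And>n. norm (1 / qpoch q n) \<le> C"
    using inverse_qpoch_bound[OF assms] by blast
  note nz = qpinf_self_nonzero[OF assms]
  have "(\<lambda>n. \<Sum>i\<le>n. q ^ (i choose 2) * x ^ i / (qpoch q i * qpoch q (n - i))) \<longlonglongrightarrow>
      suminf (\<lambda>i. q ^ (i choose 2) * x ^ i / qpoch q i * (1 / qpinf q q))"
  proof (rule tannery_atMost)
    show "(\<lambda>n. q ^ (i choose 2) * x ^ i / (qpoch q i * qpoch q (n - i))) \<longlonglongrightarrow>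
      q ^ (i choose 2) * x ^ i / qpoch q i * (1 / qpinf q q)" for i
    proof -
      have "(\<lambda>n. qpoch q (n - i)) \<longlonglongrightarrow> qpinf q q"
      by (rule qpoch_diff_LIMSEQ[OF assms])
      then have "(\<lambda>n. q ^ (i choose 2) * x ^ i / qpoch q i * (1 / qpoch q (n - i))) \<longlonglongrightarrow>
         q ^ (i choose 2) * x ^ i / qpoch q i * (1 / qpinf q q)"
        by (intro tendsto_intros nz)
      then show ?thesis by simp
    qed
    show "norm (q ^ (i choose 2) * x ^ i / (qpoch q i * qpoch q (n - i))) \<le>
       norm q ^ (i choose 2) * norm x ^ i * (C * C)" for i n
    proof -
      have "norm (q ^ (i choose 2) * x ^ i / (qpoch q i * qpoch q (n - i))) =
        norm q ^ (i choose 2) * norm x ^ i * (norm (1 / qpoch q i) * norm (1 / qpoch q (n - i)))"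
        by (simp add: norm_mult norm_divide norm_power)
      also have "\<dots> \<le> norm q ^ (i choose 2) * norm x ^ i * (C * C)"
        using C by (intro mult_left_mono mult_mono) (auto intro: less_imp_le)
      finally show ?thesis .
    qed
    show "summable (\<lambda>i. norm q ^ (i choose 2) * norm x ^ i * (C * C))"
      using assms by (intro summable_mult2 summable_power_choose_2) auto
  qed
  then have "(\<lambda>n. (\<Prod>j<n. 1 + x * q ^ j) / qpoch q n) \<longlonglongrightarrow>
      suminf (\<lambda>i. q ^ (i choose 2) * x ^ i / qpoch q i * (1 / qpinf q q))"
    unfolding q_binomial[OF assms] .
  moreover have "(\<lambda>n. (\<Prod>j<n. 1 + x * q ^ j) / qpoch q n) \<longlonglongrightarrow> qpinf (- x) q / qpinf q q"
    using qpinf_LIMSEQ[OF assms, of "- x"] by (intro tendsto_divide qpoch_LIMSEQ nz assms) simp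
  ultimately have "suminf (\<lambda>i. q ^ (i choose 2) * x ^ i / qpoch q i * (1 / qpinf q q)) = qpinf (- x) q / qpinf q q"
    by (rule LIMSEQ_unique)
  moreover have "summable (\<lambda>i. q ^ (i choose 2) * x ^ i / qpoch q i)"
  proof (rule summable_comparison_test')
    show "summable (\<lambda>i. norm q ^ (i choose 2) * norm x ^ i * C)"
      using assms by (intro summable_mult2 summable_power_choose_2) auto
    show "norm (q ^ (i choose 2) * x ^ i / qpoch q i) \<le> norm q ^ (i choose 2) * norm x ^ i * C" for i
      using C(2)[of i] mult_left_mono[OF C(2)[of i], of "norm q ^ (i choose 2) * norm x ^ i"]
      by (simp add: norm_mult norm_divide norm_power)
  qed
  then have "suminf (\<lambda>i. q ^ (i choose 2) * x ^ i / qpoch q i) * (1 / qpinf q q) =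
      suminf (\<lambda>i. q ^ (i choose 2) * x ^ i / qpoch q i * (1 / qpinf q q))"
    by (rule suminf_mult2)
  ultimately show ?thesis
    using nz by simp
qed

section \<open>Bailey pairs, the Jacobi triple product and the first Rogers--Ramanujan
  identity\<close>

lemma sum_symmetric_atMost:
  fixes f :: "nat \<Rightarrow> 'a::comm_monoid_add"
  shows "(\<Sum>i\<le>2 * n. f i) = (\<Sum>k\<le>n. if k = 0 then f n else f (n + k) + f (n - k))"
proof -
  have "(\<Sum>i\<le>2 * n. f i) = (\<Sum>i\<in>{..<n} \<union> {n<..2 * n} \<union> {n}. f i)"
    by (rule sum.cong) auto
  also have "\<dots> = (\<Sum>i\<in>{..<n}. f i) + (\<Sum>i\<in>{n<..2 * n}. f i) + f n"
    by (subst sum.union_disjoint, simp, simp, fastforce, subst sum.union_disjoint, simp, simp, fastforce, simp)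
  also have "(\<Sum>i\<in>{..<n}. f i) = (\<Sum>k\<in>{1..n}. f (n - k))"
    by (rule sum.reindex_bij_witness[of _ "\<lambda>k. n - k" "\<lambda>k. n - k"]) auto
  also have "(\<Sum>i\<in>{n<..2 * n}. f i) = (\<Sum>k\<in>{1..n}. f (n + k))"
    by (rule sum.reindex_bij_witness[of _ "\<lambda>k. n + k" "\<lambda>k. k - n"]) auto
  finally have "(\<Sum>i\<le>2 * n. f i) = f n + (\<Sum>k\<in>{1..n}. f (n + k) + f (n - k))"
    by (simp add: sum.distrib ac_simps)
  also have "\<dots> = (\<Sum>k\<in>insert 0 {1..n}. if k = 0 then f n else f (n + k) + f (n - k))"
    by (subst sum.insert) (auto intro!: sum.cong)
  also have "insert 0 {1..n} = {..n}" by auto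
  finally show ?thesis .
qed

text \<open>The terms of the two-sided theta series \<Sum> (-1)^k q^(k(k-1)/2) z^k with the indices
  k and -k folded together; the term for k = 0 must be counted only once.\<close>

definition theta_coeff :: "complex \<Rightarrow> complex \<Rightarrow> nat \<Rightarrow> complex" where
  "theta_coeff q z k =
     (if k = 0 then 1 else (- 1) ^ k * (q ^ (k choose 2) * z ^ k + q ^ (Suc k choose 2) / z ^ k))"

text \<open>The sequence \<beta> of a Bailey pair (\<alpha>, \<beta>) relative to a = 1.\<close>

definition bailey_beta :: "complex \<Rightarrow> (nat \<Rightarrow> complex) \<Rightarrow> nat \<Rightarrow> complex" where
  "bailey_beta q \<alpha> n = (\<Sum>k\<le>n. \<alpha> k / (qpoch q (n - k) * qpoch q (n + k)))"

lemma choose_2_add: "(n + k) choose 2 = (n choose 2) + (k choose 2) + n * k"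
proof (induction k)
  case (Suc k)
  have "(Suc m choose 2) = (m choose 2) + m" for m by (simp add: numeral_2_eq_2)
  with Suc show ?case by simp
qed (simp add: numeral_2_eq_2)

text \<open>A finite form of the Jacobi triple product: the q-binomial theorem with 2 n in place of
  n, read from its middle term outwards.\<close>

lemma bailey_beta_theta_coeff:
  assumes q: "norm q < 1" "q \<noteq> 0" and z: "z \<noteq> 0"
  shows "bailey_beta q (theta_coeff q z) n =
    (\<Prod>j<n. 1 - z * q ^ j) * (\<Prod>j<n. 1 - q / z * q ^ j) / qpoch q (2 * n)"
proof -
  \<comment> \<open>The shift by q^n puts the centre of symmetry of the exponents at the middle
    index n. The upper half of the 2 n factors becomes the product for z, the lower half, after
    extraction of -z / q^(j+1), the product for q / z.\<close>
  define x where "x = - z / q ^ n"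
  define t where "t = (\<lambda>m. q ^ (m choose 2) * x ^ m)"
  have t_nz: "t n \<noteq> 0" using q z by (simp add: t_def x_def)
  have qx: "q ^ n * x = - z" using q by (simp add: x_def)
  have t_plus: "t (n + k) = t n * ((- 1) ^ k * (q ^ (k choose 2) * z ^ k))" for k
  proof -
    have "q ^ (n * k) * x ^ k = (- z) ^ k"
      by (simp only: qx power_mult power_mult_distrib[symmetric])
    also have "\<dots> = (- 1) ^ k * z ^ k" by (rule power_minus)
    finally show ?thesis by (simp add: t_def choose_2_add power_add mult_ac)
  qed
  have t_minus: "t (n - k) = t n * ((- 1) ^ k * (q ^ (Suc k choose 2) / z ^ k))" if "k \<le> n" for k
  proof -
    obtain m where m: "n = m + k" using \<open>k \<le> n\<close> by (metis le_add_diff_inverse2)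
    have "q ^ (n * k) * x ^ k = (- z) ^ k"
      by (simp only: qx power_mult power_mult_distrib[symmetric])
    also have "\<dots> = (- 1) ^ k * z ^ k" by (rule power_minus)
    finally have xk: "q ^ (n * k) * x ^ k = (- 1) ^ k * z ^ k" .
    have "(k choose 2) + (Suc k choose 2) = k * k"
      by (induction k) (simp_all add: numeral_2_eq_2)
    then have "(n choose 2) + (Suc k choose 2) = (m choose 2) + n * k"
      by (simp add: m choose_2_add algebra_simps)
    then have "q ^ (n choose 2) * q ^ (Suc k choose 2) = q ^ (m choose 2) * q ^ (n * k)"
      by (simp flip: power_add)
    then have "t n * q ^ (Suc k choose 2) = q ^ (m choose 2) * x ^ m * (q ^ (n * k) * x ^ k)"
      by (simp add: t_def m power_add mult_ac)
    also have "\<dots> = t (n - k) * ((- 1) ^ k * z ^ k)"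
      by (simp add: t_def m xk[unfolded m])
    finally have *: "t n * q ^ (Suc k choose 2) = t (n - k) * ((- 1) ^ k * z ^ k)" .
    have "t n * ((- 1) ^ k * (q ^ (Suc k choose 2) / z ^ k)) = (- 1) ^ k * (t n * q ^ (Suc k choose 2)) / z ^ k"
      by simp
    also have "\<dots> = (- 1) ^ k * (- 1) ^ k * t (n - k)"
      unfolding * using z by simp
    also have "(- 1) ^ k * (- 1) ^ k = (1::complex)"
      by (simp add: power_mult_distrib[symmetric])
    finally show ?thesis by simp
  qed
  \<comment> \<open>The factors extracted from the lower half multiply up to the middle term
    \<open>t n\<close>, which occurs on the side of the sum as well and finally cancels.\<close>
  have t_prod: "(\<Prod>j<n. - z / q ^ Suc j) = t n"
  proof -
    have "(\<Prod>j<m. - z / q ^ Suc j) = q ^ (m choose 2) * (- z / q ^ m) ^ m" for m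
    proof (induction m)
      case (Suc m)
      have "q ^ (m choose 2) * (- z / q ^ m) ^ m * (- z / q ^ Suc m) =
         q ^ (Suc m choose 2) * (- z / q ^ Suc m) ^ Suc m"
      proof -
        define Y where "Y = - z / q ^ Suc m"
        have "q * Y = - z / q ^ m" using q(2) by (simp add: Y_def)
        then have "(- z / q ^ m) ^ m = q ^ m * Y ^ m" by (simp only: power_mult_distrib[symmetric])
        moreover have "q ^ (Suc m choose 2) = q ^ (m choose 2) * q ^ m"
          by (simp add: numeral_2_eq_2 power_add)
        ultimately show ?thesis unfolding Y_def[symmetric] by simp
      qed
      then show ?case by (simp only: prod.lessThan_Suc Suc)
    qed (simp add: numeral_2_eq_2)
    then show ?thesis by (simp add: t_def x_def)
  qed
  have "(\<Prod>j<2 * n. 1 + x * q ^ j) = (\<Prod>j<n. 1 + x * q ^ j) * (\<Prod>j<n. 1 + x * q ^ (n + j))"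
  proof -
    have "(\<Prod>j<n + m. 1 + x * q ^ j) = (\<Prod>j<n. 1 + x * q ^ j) * (\<Prod>j<m. 1 + x * q ^ (n + j))" for m
      by (induction m) (simp_all add: mult_ac)
    then show ?thesis by (simp only: mult_2)
  qed
  also have "(\<Prod>j<n. 1 + x * q ^ (n + j)) = (\<Prod>j<n. 1 - z * q ^ j)"
    using q(2) by (simp add: x_def power_add)
  also have "(\<Prod>j<n. 1 + x * q ^ j) = (\<Prod>j<n. 1 + x * q ^ (n - Suc j))"
    by (rule prod.nat_diff_reindex[symmetric])
  also have "\<dots> = (\<Prod>j<n. (- z / q ^ Suc j) * (1 - q / z * q ^ j))"
  proof (rule prod.cong[OF refl])
    fix j assume "j \<in> {..<n}"
    then have "q ^ n = q ^ (n - Suc j) * q ^ Suc j"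
      by (simp only: power_add[symmetric]) simp
    then show "1 + x * q ^ (n - Suc j) = (- z / q ^ Suc j) * (1 - q / z * q ^ j)"
      using q(2) z by (simp add: x_def field_simps)
  qed
  finally have prod: "(\<Prod>j<2 * n. 1 + x * q ^ j) =
      t n * ((\<Prod>j<n. 1 - z * q ^ j) * (\<Prod>j<n. 1 - q / z * q ^ j))"
    unfolding prod.distrib t_prod by (simp only: mult_ac)
  have "(\<Sum>i\<le>2 * n. t i / (qpoch q i * qpoch q (2 * n - i))) =
     (\<Sum>k\<le>n. t n * (theta_coeff q z k / (qpoch q (n - k) * qpoch q (n + k))))"
    unfolding sum_symmetric_atMost
  proof (rule sum.cong[OF refl])
    fix k assume "k \<in> {..n}"
    then have k: "k \<le> n" "2 * n - (n + k) = n - k" "2 * n - (n - k) = n + k" by auto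
    show "(if k = 0 then t n / (qpoch q n * qpoch q (2 * n - n))
        else t (n + k) / (qpoch q (n + k) * qpoch q (2 * n - (n + k))) +
             t (n - k) / (qpoch q (n - k) * qpoch q (2 * n - (n - k)))) =
      t n * (theta_coeff q z k / (qpoch q (n - k) * qpoch q (n + k)))"
    proof (cases "k = 0")
      case False
      then show ?thesis
        by (simp add: k theta_coeff_def t_plus t_minus[OF k(1)] add_divide_distrib distrib_left mult_ac)
    qed (simp add: theta_coeff_def mult_2)
  qed
  also have "\<dots> = t n * bailey_beta q (theta_coeff q z) n"
    by (simp only: sum_distrib_left bailey_beta_def)
  also have "(\<Sum>i\<le>2 * n. t i / (qpoch q i * qpoch q (2 * n - i))) =
     t n * ((\<Prod>j<n. 1 - z * q ^ j) * (\<Prod>j<n. 1 - q / z * q ^ j)) / qpoch q (2 * n)"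
    unfolding t_def using q_binomial[OF q(1), of x "2 * n"] prod unfolding t_def by simp
  finally have "t n * bailey_beta q (theta_coeff q z) n =
      t n * ((\<Prod>j<n. 1 - z * q ^ j) * (\<Prod>j<n. 1 - q / z * q ^ j) / qpoch q (2 * n))"
    by (simp only: times_divide_eq_right)
  then show ?thesis using t_nz by (simp only: mult_cancel_left simp_thms)
qed

lemma summable_theta_coeff:
  assumes q: "norm q < 1" and z: "z \<noteq> 0"
  shows "summable (\<lambda>k. norm (theta_coeff q z k))"
proof (rule summable_comparison_test')
  show "summable (\<lambda>k. norm q ^ (k choose 2) * norm z ^ k + norm q ^ (k choose 2) * (norm q / norm z) ^ k)"
    using q by (intro summable_add summable_power_choose_2) auto
  show "norm (norm (theta_coeff q z k)) \<le>
    norm q ^ (k choose 2) * norm z ^ k + norm q ^ (k choose 2) * (norm q / norm z) ^ k" for k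
  proof (cases "k = 0")
    case False
    have "norm (theta_coeff q z k) = norm (q ^ (k choose 2) * z ^ k + q ^ (k choose 2) * (q / z) ^ k)"
      using False by (simp add: theta_coeff_def norm_mult norm_power numeral_2_eq_2 power_add power_divide mult_ac)
    also have "\<dots> \<le> norm (q ^ (k choose 2) * z ^ k) + norm (q ^ (k choose 2) * (q / z) ^ k)"
      by (rule norm_triangle_ineq)
    finally show ?thesis by (simp add: norm_mult norm_power norm_divide)
  qed (simp add: theta_coeff_def numeral_2_eq_2)
qed

lemma bailey_beta_LIMSEQ:
  assumes "norm q < 1" "summable (\<lambda>k. norm (\<alpha> k))"
  shows "bailey_beta q \<alpha> \<longlonglongrightarrow> suminf \<alpha> / (qpinf q q)\<^sup>2"
proof -
  obtain C where C: "C > 0" "\<And>n. norm (1 / qpoch q n) \<le> C"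
    using inverse_qpoch_bound[OF assms(1)] by blast
  have "(\<lambda>n. \<Sum>k\<le>n. \<alpha> k / (qpoch q (n - k) * qpoch q (n + k))) \<longlonglongrightarrow>
     suminf (\<lambda>k. \<alpha> k / (qpinf q q * qpinf q q))"
  proof (rule tannery_atMost)
    fix k
    have "(\<lambda>n. qpoch q (n - k)) \<longlonglongrightarrow> qpinf q q"
      by (rule qpoch_diff_LIMSEQ[OF assms(1)])
    moreover have "(\<lambda>n. qpoch q (n + k)) \<longlonglongrightarrow> qpinf q q"
      using qpoch_LIMSEQ[OF assms(1)] by (rule LIMSEQ_ignore_initial_segment)
    ultimately show "(\<lambda>n. \<alpha> k / (qpoch q (n - k) * qpoch q (n + k))) \<longlonglongrightarrow> \<alpha> k / (qpinf q q * qpinf q q)"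
      using qpinf_self_nonzero[OF assms(1)] by (intro tendsto_intros) auto
    show "norm (\<alpha> k / (qpoch q (n - k) * qpoch q (n + k))) \<le> norm (\<alpha> k) * (C * C)" for n
    proof -
      have "norm (\<alpha> k / (qpoch q (n - k) * qpoch q (n + k))) =
        norm (\<alpha> k) * (norm (1 / qpoch q (n - k)) * norm (1 / qpoch q (n + k)))"
        by (simp add: norm_mult norm_divide)
      also have "\<dots> \<le> norm (\<alpha> k) * (C * C)"
        using C by (intro mult_left_mono mult_mono) (auto intro: less_imp_le)
      finally show ?thesis .
    qed
    show "summable (\<lambda>k. norm (\<alpha> k) * (C * C))"
      using assms(2) by (rule summable_mult2)
  qed
  moreover have "suminf (\<lambda>k. \<alpha> k / (qpinf q q * qpinf q q)) = suminf \<alpha> / (qpinf q q)\<^sup>2"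
    using summable_norm_cancel[OF assms(2)] by (simp add: suminf_divide power2_eq_square)
  ultimately show ?thesis
    unfolding bailey_beta_def by simp
qed

text \<open>The limit of the same sequence \<beta>_n is computed twice, from its closed product form
  and termwise from the series.\<close>

lemma jacobi_triple_product:
  assumes q: "norm q < 1" "q \<noteq> 0" and z: "z \<noteq> 0"
  shows "suminf (theta_coeff q z) = qpinf z q * qpinf (q / z) q * qpinf q q"
proof -
  note nz = qpinf_self_nonzero[OF q(1)]
  have "strict_mono (\<lambda>n::nat. 2 * n)" by (simp add: strict_mono_def)
  then have "(\<lambda>n. qpoch q (2 * n)) \<longlonglongrightarrow> qpinf q q"
    using LIMSEQ_subseq_LIMSEQ[OF qpoch_LIMSEQ[OF q(1)]] by (simp add: o_def)
  then have "bailey_beta q (theta_coeff q z) \<longlonglongrightarrow> qpinf z q * qpinf (q / z) q / qpinf q q"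
    unfolding bailey_beta_theta_coeff[OF q z, abs_def]
    by (intro tendsto_divide tendsto_mult qpinf_LIMSEQ q nz)
  moreover have "bailey_beta q (theta_coeff q z) \<longlonglongrightarrow> suminf (theta_coeff q z) / (qpinf q q)\<^sup>2"
    by (intro bailey_beta_LIMSEQ summable_theta_coeff q z)
  ultimately have "qpinf z q * qpinf (q / z) q / qpinf q q = suminf (theta_coeff q z) / (qpinf q q)\<^sup>2"
    by (rule LIMSEQ_unique)
  then show ?thesis using nz by (simp add: field_simps power2_eq_square)
qed

text \<open>Bailey's lemma for a = 1 with both free parameters sent to infinity. After exchanging
  the summations and putting s = k + j, the inner sum over j is \<open>q_vandermonde\<close> with c
  = 2 k.\<close>

lemma bailey_lemma:
  assumes "norm q < 1"
  shows "(\<Sum>s\<le>n. q ^ s\<^sup>2 / qpoch q (n - s) * bailey_beta q \<alpha> s) = bailey_beta q (\<lambda>k. q ^ k\<^sup>2 * \<alpha> k) n"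
proof -
  define h where "h = (\<lambda>s k. q ^ s\<^sup>2 * \<alpha> k / (qpoch q (n - s) * qpoch q (s - k) * qpoch q (s + k)))"
  have "(\<Sum>s\<le>n. q ^ s\<^sup>2 / qpoch q (n - s) * bailey_beta q \<alpha> s) = (\<Sum>s\<le>n. \<Sum>k\<le>s. h s k)"
    by (simp add: bailey_beta_def sum_distrib_left h_def mult_ac)
  also have "\<dots> = (\<Sum>(s,k)\<in>(SIGMA s:{..n}. {..s}). h s k)"
    by (simp add: sum.Sigma)
  also have "\<dots> = (\<Sum>(k,j)\<in>(SIGMA k:{..n}. {..n - k}). h (k + j) k)"
    by (rule sum.reindex_bij_witness[of _ "\<lambda>(k,j). (k + j, k)" "\<lambda>(s,k). (k, s - k)"]) auto
  also have "\<dots> = (\<Sum>k\<le>n. \<Sum>j\<le>n - k. h (k + j) k)"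
    by (simp add: sum.Sigma)
  also have "\<dots> = (\<Sum>k\<le>n. q ^ k\<^sup>2 * \<alpha> k / (qpoch q (n - k) * qpoch q (n + k)))"
  proof (rule sum.cong[OF refl])
    fix k assume "k \<in> {..n}"
    then have k: "n - k + 2 * k = n + k" by auto
    have "h (k + j) k = q ^ k\<^sup>2 * \<alpha> k * (q ^ (j * (j + 2 * k)) /
        (qpoch q j * qpoch q (n - k - j) * qpoch q (j + 2 * k)))" for j
    proof -
      have "(k + j)\<^sup>2 = k\<^sup>2 + j * (j + 2 * k)" by (simp add: power2_eq_square algebra_simps)
      moreover have "k + j + k = j + 2 * k" "k + j - k = j" "n - (k + j) = n - k - j" by simp_all
      ultimately show ?thesis by (simp only: h_def power_add mult_ac times_divide_eq_right times_divide_eq_left)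
    qed
    then have "(\<Sum>j\<le>n - k. h (k + j) k) = q ^ k\<^sup>2 * \<alpha> k * (1 / (qpoch q (n - k) * qpoch q (n - k + 2 * k)))"
      unfolding q_vandermonde[OF assms, symmetric] by (simp only: sum_distrib_left)
    then show "(\<Sum>j\<le>n - k. h (k + j) k) = q ^ k\<^sup>2 * \<alpha> k / (qpoch q (n - k) * qpoch q (n + k))"
      by (simp add: k)
  qed
  finally show ?thesis by (simp add: bailey_beta_def)
qed

text \<open>Two applications of the Bailey lemma to the unit pair \<open>\<beta>\<^sub>n = \<delta>\<^sub>n\<^sub>,\<^sub>0\<close>.\<close>

theorem rogers_ramanujan:
  assumes q: "norm q < 1" "q \<noteq> 0"
  shows "suminf (\<lambda>n. q ^ n\<^sup>2 / qpoch q n) * (qpinf q (q ^ 5) * qpinf (q ^ 4) (q ^ 5)) = 1"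
proof -
  note nz = qpinf_self_nonzero[OF q(1)]
  \<comment> \<open>At z = 1 the closed form of \<beta>_n contains the factor 1 - z q^0 = 0 as soon
    as n > 0, so this \<alpha> belongs to the unit pair.\<close>
  define \<alpha> where "\<alpha> = theta_coeff q 1"
  have b0: "bailey_beta q \<alpha> n = (if n = 0 then 1 else 0)" for n
  proof (cases n)
    case (Suc m)
    have "(\<Prod>j<n. 1 - 1 * q ^ j) = 0"
      unfolding Suc by (subst prod.lessThan_Suc_shift) simp
    then show ?thesis
      unfolding \<alpha>_def bailey_beta_theta_coeff[OF q one_neq_zero] by (simp add: Suc)
  qed (simp add: \<alpha>_def bailey_beta_theta_coeff[OF q])
  have b1: "bailey_beta q (\<lambda>k. q ^ k\<^sup>2 * \<alpha> k) n = 1 / qpoch q n" for n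
    unfolding bailey_lemma[OF q(1), symmetric] b0 by (simp add: if_distrib sum.delta cong: if_cong)
  \<comment> \<open>The base q^5 arises here: 2 k^2 + k(k-1)/2 = 5 k(k-1)/2 + 2 k, and likewise 2
    k^2 + k(k+1)/2 = 5 k(k+1)/2 - 2 k.\<close>
  have \<alpha>2: "(\<lambda>k. q ^ k\<^sup>2 * (q ^ k\<^sup>2 * \<alpha> k)) = theta_coeff (q ^ 5) (q ^ 2)"
  proof
    fix k
    have "(k choose 2) + (Suc k choose 2) = k * k"
      by (induction k) (simp_all add: numeral_2_eq_2)
    moreover have Suc_choose: "Suc k choose 2 = (k choose 2) + k" by (simp add: numeral_2_eq_2)
    ultimately have *: "k\<^sup>2 = 2 * (k choose 2) + k" by (simp add: power2_eq_square)
    have gen: "a * (b * (c * (u + v))) = c * (a * (b * u) + a * (b * v))" for a b c u v :: complex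
      by (simp add: algebra_simps)
    have 1: "q ^ k\<^sup>2 * (q ^ k\<^sup>2 * q ^ (k choose 2)) = (q ^ 5) ^ (k choose 2) * (q ^ 2) ^ k"
      unfolding * by (simp only: power_mult[symmetric] power_add[symmetric]) (rule arg_cong[of _ _ "\<lambda>n. q ^ n"], simp)
    have 2: "q ^ k\<^sup>2 * (q ^ k\<^sup>2 * q ^ (Suc k choose 2)) = (q ^ 5) ^ (Suc k choose 2) / (q ^ 2) ^ k"
    proof -
      have "q ^ k\<^sup>2 * (q ^ k\<^sup>2 * q ^ (Suc k choose 2)) * (q ^ 2) ^ k = (q ^ 5) ^ (Suc k choose 2)"
        unfolding * Suc_choose
        by (simp only: power_mult[symmetric] power_add[symmetric]) (rule arg_cong[of _ _ "\<lambda>n. q ^ n"], simp)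
      then show ?thesis using q(2) by (simp add: field_simps)
    qed
    show "q ^ k\<^sup>2 * (q ^ k\<^sup>2 * \<alpha> k) = theta_coeff (q ^ 5) (q ^ 2) k"
    proof (cases "k = 0")
      case False
      then show ?thesis
        by (simp only: \<alpha>_def theta_coeff_def if_False gen power_one div_by_1 mult_1_right 1 2)
    qed (simp add: \<alpha>_def theta_coeff_def)
  qed
  have q5: "norm (q ^ 5) < 1" "q ^ 5 \<noteq> 0" "q ^ 2 \<noteq> 0"
    using q by (simp_all add: norm_power power_less_one_iff)
  obtain C where C: "C > 0" "\<And>n. norm (1 / qpoch q n) \<le> C"
    using inverse_qpoch_bound[OF q(1)] by blast
  have summ: "summable (\<lambda>s. norm q ^ s\<^sup>2 * C)" for C
  proof -
    have "s\<^sup>2 = (s choose 2) + (Suc s choose 2)" for s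
      by (induction s) (simp_all add: numeral_2_eq_2 power2_eq_square)
    then have "s choose 2 \<le> s\<^sup>2" for s
      by (metis le_add1)
    then have "norm q ^ s\<^sup>2 \<le> norm q ^ (s choose 2) * 1 ^ s" for s
      using q power_decreasing[of "s choose 2" "s\<^sup>2" "norm q"] by simp
    then have b: "norm (norm q ^ s\<^sup>2) \<le> norm q ^ (s choose 2) * 1 ^ s" for s
      by simp
    have "summable (\<lambda>s. norm q ^ (s choose 2) * 1 ^ s)"
      by (rule summable_power_choose_2) (use q in auto)
    then have "summable (\<lambda>s. norm q ^ s\<^sup>2)"
      by (rule summable_comparison_test'[where N = 0]) (rule b)
    then show ?thesis by (rule summable_mult2)
  qed
  \<comment> \<open>The second application of the Bailey lemma is used in the limit: the left side
    tends to the Rogers--Ramanujan sum over (q)_\<infinity>, the right side to a theta series in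
    base q^5.\<close>
  have "(\<lambda>n. \<Sum>s\<le>n. q ^ s\<^sup>2 / qpoch q (n - s) * (1 / qpoch q s)) \<longlonglongrightarrow>
     suminf (\<lambda>s. q ^ s\<^sup>2 / qpinf q q * (1 / qpoch q s))"
  proof (rule tannery_atMost)
    fix s
    have "(\<lambda>n. qpoch q (n - s)) \<longlonglongrightarrow> qpinf q q"
      by (rule qpoch_diff_LIMSEQ[OF q(1)])
    then show "(\<lambda>n. q ^ s\<^sup>2 / qpoch q (n - s) * (1 / qpoch q s)) \<longlonglongrightarrow> q ^ s\<^sup>2 / qpinf q q * (1 / qpoch q s)"
      using nz by (intro tendsto_intros) auto
    show "norm (q ^ s\<^sup>2 / qpoch q (n - s) * (1 / qpoch q s)) \<le> norm q ^ s\<^sup>2 * (C * C)" for n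
    proof -
      have "norm (q ^ s\<^sup>2 / qpoch q (n - s) * (1 / qpoch q s)) =
        norm q ^ s\<^sup>2 * (norm (1 / qpoch q (n - s)) * norm (1 / qpoch q s))"
        by (simp add: norm_mult norm_divide norm_power)
      also have "\<dots> \<le> norm q ^ s\<^sup>2 * (C * C)"
        using C by (intro mult_left_mono mult_mono) (auto intro: less_imp_le)
      finally show ?thesis .
    qed
    show "summable (\<lambda>s. norm q ^ s\<^sup>2 * (C * C))" by (rule summ)
  qed
  moreover have "(\<lambda>n. \<Sum>s\<le>n. q ^ s\<^sup>2 / qpoch q (n - s) * (1 / qpoch q s)) \<longlonglongrightarrow>
     suminf (theta_coeff (q ^ 5) (q ^ 2)) / (qpinf q q)\<^sup>2"
    unfolding b1[symmetric] bailey_lemma[OF q(1)] \<alpha>2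
    using bailey_beta_LIMSEQ[OF q(1) summable_theta_coeff[OF q5(1,3)]] .
  ultimately have "suminf (\<lambda>s. q ^ s\<^sup>2 / qpinf q q * (1 / qpoch q s)) =
      suminf (theta_coeff (q ^ 5) (q ^ 2)) / (qpinf q q)\<^sup>2"
    by (rule LIMSEQ_unique)
  moreover have "suminf (\<lambda>s. q ^ s\<^sup>2 / qpinf q q * (1 / qpoch q s)) = suminf (\<lambda>s. q ^ s\<^sup>2 / qpoch q s) / qpinf q q"
  proof -
    have "summable (\<lambda>s. q ^ s\<^sup>2 / qpoch q s)"
    proof (rule summable_comparison_test'[OF summ[of C]])
      show "norm (q ^ s\<^sup>2 / qpoch q s) \<le> norm q ^ s\<^sup>2 * C" for s
        using mult_left_mono[OF C(2)[of s], of "norm q ^ s\<^sup>2"] by (simp add: norm_divide norm_power)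
    qed
    from suminf_divide[OF this, of "qpinf q q"] show ?thesis by (simp add: mult.commute)
  qed
  ultimately have "suminf (\<lambda>s. q ^ s\<^sup>2 / qpoch q s) * qpinf q q =
      qpinf (q ^ 2) (q ^ 5) * qpinf (q ^ 5 / q ^ 2) (q ^ 5) * qpinf (q ^ 5) (q ^ 5)"
    using nz unfolding jacobi_triple_product[OF q5] by (simp add: field_simps power2_eq_square)
  also have "q ^ 5 / q ^ 2 = q ^ 3"
    using q(2) by (simp add: field_simps flip: power_add)
  finally have "suminf (\<lambda>s. q ^ s\<^sup>2 / qpoch q s) * qpinf q q =
      qpinf (q ^ 2) (q ^ 5) * qpinf (q ^ 3) (q ^ 5) * qpinf (q ^ 5) (q ^ 5)" .
  \<comment> \<open>Splitting (q)_\<infinity> modulo 5 cancels the residues 2, 3 and 0 that the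
    triple product supplies; the residues 1 and 4 remain.\<close>
  moreover have dis: "qpinf q q = qpinf q (q ^ 5) * qpinf (q ^ 2) (q ^ 5) * qpinf (q ^ 3) (q ^ 5) * qpinf (q ^ 4) (q ^ 5) * qpinf (q ^ 5) (q ^ 5)"
    using qpinf_dissect[OF q(1), of 5 q]
    by (simp add: numeral_eq_Suc lessThan_Suc mult_ac)
  ultimately show ?thesis
    using nz unfolding dis by (simp add: mult_ac)
qed

section \<open>Double series and a Rogers--Ramanujan type sum in base r^4\<close>

lemma pair_summable:
  fixes f :: "nat \<times> nat \<Rightarrow> complex"
  assumes "0 \<le> \<rho>" "\<rho> < 1" and bound: "\<And>n m. norm (f (n, m)) \<le> C * (\<rho> ^ n * \<rho> ^ m)"
  shows "(\<lambda>x. norm (f x)) summable_on UNIV"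
proof (rule Infinite_Sum.abs_summable_on_comparison_test')
  have g: "(\<lambda>n. norm (\<rho> ^ n)) summable_on UNIV"
    using assms summable_geometric[of \<rho>]
    by (simp add: summable_on_UNIV_nonneg_real_iff)
  have "(\<lambda>x. norm (C * (\<rho> ^ fst x * \<rho> ^ snd x))) summable_on (UNIV \<times> UNIV)"
    unfolding Infinite_Sum.abs_summable_on_Sigma_iff
  proof (intro conjI ballI)
    fix n
    show "(\<lambda>m. norm (C * (\<rho> ^ fst (n, m) * \<rho> ^ snd (n, m)))) summable_on UNIV"
      using summable_on_cmult_right[OF g, of "\<bar>C\<bar> * \<rho> ^ n"] assms
      by (simp add: abs_mult mult.assoc)
  next
    define L where "L = infsum (\<lambda>m. norm (\<rho> ^ m)) UNIV"
    have L: "L \<ge> 0" unfolding L_def by (rule infsum_nonneg) simp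
    have "norm (infsum (\<lambda>m. norm (C * (\<rho> ^ fst (n, m) * \<rho> ^ snd (n, m)))) UNIV) =
       \<bar>C\<bar> * L * norm (\<rho> ^ n)" for n
    proof -
      have "infsum (\<lambda>m. norm (C * (\<rho> ^ fst (n, m) * \<rho> ^ snd (n, m)))) UNIV =
        infsum (\<lambda>m. (\<bar>C\<bar> * norm (\<rho> ^ n)) * norm (\<rho> ^ m)) UNIV"
        by (simp add: abs_mult mult.assoc)
      also have "\<dots> = \<bar>C\<bar> * norm (\<rho> ^ n) * L"
        unfolding L_def by (rule infsum_cmult_right) (use g in auto)
      finally show ?thesis using L by (simp add: abs_mult)
    qed
    then show "(\<lambda>n. norm (infsum (\<lambda>m. norm (C * (\<rho> ^ fst (n, m) * \<rho> ^ snd (n, m)))) UNIV)) summable_on UNIV"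
      using summable_on_cmult_right[OF g, of "\<bar>C\<bar> * L"] by simp
  qed
  then show "(\<lambda>x. C * (\<rho> ^ fst x * \<rho> ^ snd x)) summable_on UNIV"
    unfolding UNIV_Times_UNIV by (rule Infinite_Sum.abs_summable_summable)
  show "norm (f x) \<le> C * (\<rho> ^ fst x * \<rho> ^ snd x)" for x
    using bound[of "fst x" "snd x"] by simp
qed

lemma infsum_nat_eq_suminf:
  fixes f :: "nat \<Rightarrow> complex"
  assumes "f summable_on UNIV"
  shows "infsum f UNIV = suminf f"
  using has_sum_imp_sums[OF has_sum_infsum[OF assms]] by (simp add: sums_iff)

text \<open>Domination by a product of geometric series allows both orders of summation, along n + m
  and iterated. A q-series identity follows whenever both can be evaluated.\<close>

lemma infsum_antidiagonal:
  fixes f :: "nat \<times> nat \<Rightarrow> complex"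
  assumes "0 \<le> \<rho>" "\<rho> < 1" and "\<And>n m. norm (f (n, m)) \<le> C * (\<rho> ^ n * \<rho> ^ m)"
  shows "infsum f UNIV = suminf (\<lambda>n. \<Sum>i\<le>n. f (i, n - i))"
    and "infsum f UNIV = suminf (\<lambda>n. suminf (\<lambda>m. f (n, m)))"
proof -
  have summ: "f summable_on UNIV"
    by (rule Infinite_Sum.abs_summable_summable[OF pair_summable[OF assms]])
  let ?h = "\<lambda>(n, i). (i, n - i)"
  have bij: "bij_betw ?h (SIGMA n:UNIV. {..n}) (UNIV :: (nat \<times> nat) set)"
    by (rule bij_betw_byWitness[where f' = "\<lambda>(i, j). (i + j, i)"]) auto
  have summ': "(\<lambda>x. f (?h x)) summable_on (SIGMA n:UNIV. {..n})"
    using summ unfolding summable_on_reindex_bij_betw[OF bij] .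
  have "infsum f UNIV = infsum (\<lambda>x. f (?h x)) (SIGMA n:UNIV. {..n})"
    by (rule infsum_reindex_bij_betw[OF bij, symmetric])
  also have "\<dots> = infsum (\<lambda>n. infsum (\<lambda>i. f (?h (n, i))) {..n}) UNIV"
    by (rule infsum_Sigma_banach[OF summ', symmetric])
  also have "\<dots> = infsum (\<lambda>n. \<Sum>i\<le>n. f (i, n - i)) UNIV"
    by simp
  also have "\<dots> = suminf (\<lambda>n. \<Sum>i\<le>n. f (i, n - i))"
    using summable_on_Sigma_banach[of "\<lambda>n i. f (?h (n, i))" UNIV "\<lambda>n. {..n}"] summ'
    by (intro infsum_nat_eq_suminf) (simp add: case_prod_unfold)
  finally show "infsum f UNIV = suminf (\<lambda>n. \<Sum>i\<le>n. f (i, n - i))" .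
  have s2: "f summable_on (UNIV \<times> UNIV)" using summ by simp
  have "infsum f UNIV = infsum (\<lambda>n. infsum (\<lambda>m. f (n, m)) UNIV) UNIV"
    using infsum_Sigma_banach[OF s2] by simp
  also have "\<dots> = infsum (\<lambda>n. suminf (\<lambda>m. f (n, m))) UNIV"
    using summable_on_SigmaD1[of "\<lambda>n m. f (n, m)" UNIV "\<lambda>_. UNIV"] s2
    by (intro infsum_cong infsum_nat_eq_suminf) (simp add: case_prod_unfold)
  also have "\<dots> = suminf (\<lambda>n. suminf (\<lambda>m. f (n, m)))"
  proof (rule infsum_nat_eq_suminf)
    have "(\<lambda>n. infsum (\<lambda>m. f (n, m)) UNIV) summable_on UNIV"
      using summable_on_Sigma_banach[of "\<lambda>n m. f (n, m)" UNIV "\<lambda>_. UNIV"] s2 by (simp add: case_prod_unfold)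
    moreover have "infsum (\<lambda>m. f (n, m)) UNIV = suminf (\<lambda>m. f (n, m))" for n
      using summable_on_SigmaD1[of "\<lambda>n m. f (n, m)" UNIV "\<lambda>_. UNIV"] s2
      by (intro infsum_nat_eq_suminf) (simp add: case_prod_unfold)
    ultimately show "(\<lambda>n. suminf (\<lambda>m. f (n, m))) summable_on UNIV" by simp
  qed
  finally show "infsum f UNIV = suminf (\<lambda>n. suminf (\<lambda>m. f (n, m)))" .
qed

text \<open>Both sides evaluate one double series with terms r^((n+m)^2 + m) / ((r^2; r^2)_m (r^2;
  r^2)_n). Along n + m the inner sum is \<open>rogers_szego_half\<close> with s = r; summed over m
  first, it is Euler's expansion with x = r^(2n+2), and (r^4; r^4)_n = (r^2; r^2)_n (-r^2; r^2)_n
  produces the base r^4.\<close>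

lemma slater_20:
  assumes r: "norm r < 1"
  shows "suminf (\<lambda>n. r ^ n\<^sup>2 / qpoch (r ^ 4) n) * qpinf (- (r\<^sup>2)) (r\<^sup>2) = suminf (\<lambda>n. r ^ n\<^sup>2 / qpoch r n)"
proof -
  have r2: "norm (r\<^sup>2) < 1" using r by (simp add: norm_power power_less_one_iff)
  obtain C where C: "C > 0" "\<And>n. norm (1 / qpoch (r\<^sup>2) n) \<le> C"
    using inverse_qpoch_bound[OF r2] by blast
  define f where "f = (\<lambda>(m, n). r ^ ((n + m)\<^sup>2 + m) / (qpoch (r\<^sup>2) m * qpoch (r\<^sup>2) n))"
  have "norm (f (m, n)) \<le> (C * C) * (norm r ^ m * norm r ^ n)" for m n
  proof -
    have "n + m \<le> (n + m)\<^sup>2" by (rule power2_nat_le_imp_le) simp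
    then have "norm r ^ ((n + m)\<^sup>2 + m) \<le> norm r ^ (m + n)"
      using r by (intro power_decreasing) auto
    then have "norm r ^ ((n + m)\<^sup>2 + m) * (norm (1 / qpoch (r\<^sup>2) m) * norm (1 / qpoch (r\<^sup>2) n)) \<le>
        norm r ^ (m + n) * (C * C)"
      using C by (intro mult_mono) (auto intro: less_imp_le)
    then show ?thesis
      by (simp add: f_def norm_divide norm_mult norm_power power_add mult_ac)
  qed
  note anti = infsum_antidiagonal[OF norm_ge_zero r this]
  have nz: "qpoch (r\<^sup>2) n \<noteq> 0" for n by (rule qpoch_nonzero[OF r2])
  have "infsum f UNIV = suminf (\<lambda>n. r ^ n\<^sup>2 / qpoch r n)"
  proof -
    have "(\<Sum>i\<le>n. f (i, n - i)) = r ^ n\<^sup>2 / qpoch r n" for n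
    proof -
      have "(\<Sum>i\<le>n. f (i, n - i)) = (\<Sum>i\<le>n. r ^ n\<^sup>2 * (r ^ i / (qpoch (r\<^sup>2) i * qpoch (r\<^sup>2) (n - i))))"
        by (rule sum.cong) (auto simp: f_def power_add)
      also have "\<dots> = r ^ n\<^sup>2 / qpoch r n"
        unfolding sum_distrib_left[symmetric] rogers_szego_half[OF r] by simp
      finally show ?thesis .
    qed
    then show ?thesis using anti(1) by simp
  qed
  moreover have "infsum f UNIV = suminf (\<lambda>n. r ^ n\<^sup>2 / qpoch (r ^ 4) n * qpinf (- (r\<^sup>2)) (r\<^sup>2))"
  proof -
    \<comment> \<open>The coordinates are exchanged because the iterated form of the sum runs over
      the second coordinate first, and here m has to be summed first.\<close>
    define f' where "f' = (\<lambda>(n, m). f (m, n))"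
    have "norm (f' (n, m)) \<le> (C * C) * (norm r ^ n * norm r ^ m)" for n m
      using \<open>\<And>m n. norm (f (m, n)) \<le> (C * C) * (norm r ^ m * norm r ^ n)\<close>[of m n]
      by (simp add: f'_def mult_ac)
    from infsum_antidiagonal(2)[OF norm_ge_zero r this]
    have "infsum f' UNIV = suminf (\<lambda>n. suminf (\<lambda>m. f' (n, m)))" .
    moreover have "infsum f' UNIV = infsum f UNIV"
    proof -
      have "bij_betw prod.swap (UNIV :: (nat \<times> nat) set) (UNIV :: (nat \<times> nat) set)"
        by (rule bij_betw_byWitness[where f' = prod.swap]) auto
      from infsum_reindex_bij_betw[OF this, of f] show ?thesis
        by (simp add: f'_def prod.swap_def case_prod_unfold)
    qed
    moreover have "suminf (\<lambda>m. f' (n, m)) = r ^ n\<^sup>2 / qpoch (r ^ 4) n * qpinf (- (r\<^sup>2)) (r\<^sup>2)" for n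
    proof -
      have f'_eq: "f' (n, m) = r ^ n\<^sup>2 / qpoch (r\<^sup>2) n * ((r\<^sup>2) ^ (m choose 2) * (r\<^sup>2 * (r\<^sup>2) ^ n) ^ m / qpoch (r\<^sup>2) m)" for m
      proof -
        have "(m choose 2) + (m choose 2) + m = m * m"
          by (induction m) (simp_all add: numeral_2_eq_2)
        then have "(n + m)\<^sup>2 + m = n\<^sup>2 + (2 * (m choose 2) + (2 + 2 * n) * m)"
          by (simp add: power2_eq_square algebra_simps)
        then have "r ^ ((n + m)\<^sup>2 + m) = r ^ n\<^sup>2 * ((r\<^sup>2) ^ (m choose 2) * (r\<^sup>2 * (r\<^sup>2) ^ n) ^ m)"
          by (simp only: power_mult[symmetric] power_add[symmetric] power_mult_distrib mult.assoc)
        then show ?thesis by (simp add: f'_def f_def mult_ac)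
      qed
      have "summable (\<lambda>m. (r\<^sup>2) ^ (m choose 2) * (r\<^sup>2 * (r\<^sup>2) ^ n) ^ m / qpoch (r\<^sup>2) m)"
      proof (rule summable_comparison_test'[where N = 0])
        show "summable (\<lambda>i. norm (r\<^sup>2) ^ (i choose 2) * norm (r\<^sup>2 * (r\<^sup>2) ^ n) ^ i * C)"
          using r2 by (intro summable_mult2 summable_power_choose_2) auto
        show "norm ((r\<^sup>2) ^ (i choose 2) * (r\<^sup>2 * (r\<^sup>2) ^ n) ^ i / qpoch (r\<^sup>2) i) \<le> norm (r\<^sup>2) ^ (i choose 2) * norm (r\<^sup>2 * (r\<^sup>2) ^ n) ^ i * C" for i
          using mult_left_mono[OF C(2)[of i], of "norm (r\<^sup>2) ^ (i choose 2) * norm (r\<^sup>2 * (r\<^sup>2) ^ n) ^ i"]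
          by (simp add: norm_mult norm_divide norm_power)
      qed
      from suminf_mult[OF this, of "r ^ n\<^sup>2 / qpoch (r\<^sup>2) n"]
      have "suminf (\<lambda>m. f' (n, m)) = r ^ n\<^sup>2 / qpoch (r\<^sup>2) n * qpinf (- (r\<^sup>2 * (r\<^sup>2) ^ n)) (r\<^sup>2)"
        unfolding f'_eq euler_qpinf[OF r2] .
      moreover have "qpinf (- (r\<^sup>2)) (r\<^sup>2) = (\<Prod>k<n. 1 + r\<^sup>2 * (r\<^sup>2) ^ k) * qpinf (- (r\<^sup>2 * (r\<^sup>2) ^ n)) (r\<^sup>2)"
        using qpinf_shift[OF r2, of "- (r\<^sup>2)" n] by simp
      moreover have "qpoch (r ^ 4) n = qpoch (r\<^sup>2) n * (\<Prod>k<n. 1 + r\<^sup>2 * (r\<^sup>2) ^ k)"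
      proof -
        have "1 - r ^ 4 * (r ^ 4) ^ k = (1 - r\<^sup>2 * (r\<^sup>2) ^ k) * (1 + r\<^sup>2 * (r\<^sup>2) ^ k)" for k
        proof -
          have "r ^ 4 * (r ^ 4) ^ k = (r\<^sup>2 * (r\<^sup>2) ^ k) * (r\<^sup>2 * (r\<^sup>2) ^ k)"
            by (simp only: power_mult[symmetric] power_add[symmetric]) (rule arg_cong[of _ _ "\<lambda>n. r ^ n"], simp)
          moreover have "1 - u * u = (1 - u) * (1 + u)" for u :: complex by (simp add: algebra_simps)
          ultimately show ?thesis by metis
        qed
        then show ?thesis unfolding qpoch_altdef prod.distrib[symmetric] by simp
      qed
      moreover have "qpoch (r ^ 4) n \<noteq> 0"
        using r by (intro qpoch_nonzero) (simp add: norm_power power_less_one_iff)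
      ultimately show ?thesis by (simp add: field_simps)
    qed
    ultimately show ?thesis by simp
  qed
  ultimately have *: "suminf (\<lambda>n. r ^ n\<^sup>2 / qpoch (r ^ 4) n * qpinf (- (r\<^sup>2)) (r\<^sup>2)) = suminf (\<lambda>n. r ^ n\<^sup>2 / qpoch r n)"
    by simp
  have "summable (\<lambda>n. r ^ n\<^sup>2 / qpoch (r ^ 4) n)"
  proof -
    have r4: "norm (r ^ 4) < 1" using r by (simp add: norm_power power_less_one_iff)
    obtain C where C: "C > 0" "\<And>n. norm (1 / qpoch (r ^ 4) n) \<le> C"
      using inverse_qpoch_bound[OF r4] by blast
    show ?thesis
    proof (rule summable_comparison_test'[where N = 0])
      show "summable (\<lambda>n. norm r ^ n * C)"
        using r by (intro summable_mult2 summable_geometric) auto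
      show "norm (r ^ n\<^sup>2 / qpoch (r ^ 4) n) \<le> norm r ^ n * C" for n
      proof -
        have "norm r ^ n\<^sup>2 \<le> norm r ^ n"
          using r power2_nat_le_imp_le[of n "n\<^sup>2"] by (intro power_decreasing) auto
        then have "norm r ^ n\<^sup>2 * norm (1 / qpoch (r ^ 4) n) \<le> norm r ^ n * C"
          using C by (intro mult_mono) (auto intro: less_imp_le)
        then show ?thesis by (simp add: norm_divide norm_power)
      qed
    qed
  qed
  from suminf_mult2[OF this, of "qpinf (- (r\<^sup>2)) (r\<^sup>2)"] * show ?thesis by simp
qed

section \<open>Siegel functions\<close>

definition eul :: "complex \<Rightarrow> complex" where
  "eul z = exp (2 * of_real pi * \<i> * z)"

lemma eul_add: "eul (x + y) = eul x * eul y"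
  by (simp add: eul_def distrib_left exp_add)

lemma eul_0 [simp]: "eul 0 = 1"
  by (simp add: eul_def)

lemma eul_nonzero [simp]: "eul z \<noteq> 0"
  by (simp add: eul_def)

lemma eul_minus: "eul (- x) = inverse (eul x)"
  by (simp add: eul_def exp_minus)

lemma eul_diff: "eul (x - y) = eul x / eul y"
  using eul_add[of x "- y"] by (simp add: eul_minus field_simps)

lemma eul_power: "eul z ^ n = eul (of_nat n * z)"
  by (simp add: eul_def exp_of_nat_mult[symmetric] mult_ac)

lemma eul_power_int: "eul z powi n = eul (of_int n * z)"
proof (cases "n \<ge> 0")
  case True
  then show ?thesis using eul_power[of z "nat n"] by (simp add: power_int_def)
next
  case False
  then have "eul z powi n = inverse (eul (of_nat (nat (- n)) * z))"
    by (simp add: power_int_def eul_power power_inverse)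
  also have "of_nat (nat (- n)) * z = - (of_int n * z)" using False by (simp add: of_nat_nat)
  finally show ?thesis by (simp add: eul_minus)
qed

lemma norm_eul: "norm (eul z) = exp (- 2 * pi * Im z)"
  by (simp add: eul_def norm_exp_eq_Re)

lemma norm_eul_less_1: "Im z > 0 \<Longrightarrow> norm (eul z) < 1"
  by (simp add: norm_eul)

lemma eul_eq_1_iff: "eul z = 1 \<longleftrightarrow> z \<in> \<int>"
proof -
  have "eul z = 1 \<longleftrightarrow> Im z = 0 \<and> (\<exists>n::int. Re z = of_int n)"
    by (auto simp: eul_def exp_eq_1)
  also have "\<dots> \<longleftrightarrow> z \<in> \<int>"
    by (auto simp: complex_eq_iff Ints_def image_iff)
  finally show ?thesis .
qed

lemma eul_of_int [simp]: "eul (of_int n) = 1"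
  by (simp add: eul_eq_1_iff)

lemma eul_1 [simp]: "eul 1 = 1"
  using eul_of_int[of 1] by simp

lemma eul_half: "eul (1 / 2) = - 1"
  by (simp add: eul_def)

lemma eul_quarter: "eul (1 / 4) = \<i>"
proof -
  have "eul (1 / 4) = exp (of_real (pi / 2) * \<i>)" by (simp add: eul_def mult.commute)
  then show ?thesis by (simp add: exp_eq_polar complex_eq_iff)
qed

lemma holomorphic_eul [holomorphic_intros]:
  "f holomorphic_on A \<Longrightarrow> (\<lambda>z. eul (f z)) holomorphic_on A"
  unfolding eul_def by (intro holomorphic_intros)

text \<open>Argument and base may both vary. On a closed disc |q| attains a maximum below 1 and |x|
  is bounded, so a geometric series dominates |x q^k| and the partial products converge
  uniformly.\<close>

lemma holomorphic_qpinf: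
  assumes A: "open A" and x: "x holomorphic_on A" and q: "q holomorphic_on A"
    and less: "\<And>z. z \<in> A \<Longrightarrow> norm (q z) < 1"
  shows "(\<lambda>z. qpinf (x z) (q z)) holomorphic_on A"
proof (rule holomorphic_uniform_sequence[OF A])
  show "(\<lambda>z. \<Prod>k<n. 1 - x z * q z ^ k) holomorphic_on A" for n
    by (intro holomorphic_intros x q)
  fix z assume "z \<in> A"
  then obtain d where d: "d > 0" "cball z d \<subseteq> A"
    using A open_contains_cball by blast
  have cx: "continuous_on (cball z d) x" and cq: "continuous_on (cball z d) q"
    using x q d holomorphic_on_imp_continuous_on continuous_on_subset by blast+
  have ne: "cball z d \<noteq> {}" using d by simp
  obtain z1 where z1: "z1 \<in> cball z d" "\<And>w. w \<in> cball z d \<Longrightarrow> norm (q w) \<le> norm (q z1)"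
    using continuous_attains_sup[OF compact_cball ne continuous_on_norm[OF cq]] by blast
  obtain z2 where z2: "\<And>w. w \<in> cball z d \<Longrightarrow> norm (x w) \<le> norm (x z2)"
    using continuous_attains_sup[OF compact_cball ne continuous_on_norm[OF cx]] by blast
  have "uniformly_convergent_on (cball z d) (\<lambda>n w. \<Sum>k<n. norm (1 - x w * q w ^ k - 1))"
  proof (rule Weierstrass_m_test')
    show "norm (norm (1 - x w * q w ^ k - 1)) \<le> norm (x z2) * norm (q z1) ^ k" if "w \<in> cball z d" for k w
      using that z1 z2 by (simp add: norm_mult norm_power mult_mono power_mono)
    show "summable (\<lambda>k. norm (x z2) * norm (q z1) ^ k)"
      using less[of z1] z1 d by (intro summable_mult summable_geometric) auto
  qed
  then have "uniformly_convergent_on (cball z d) (\<lambda>n w. \<Prod>k<n. 1 - x w * q w ^ k)"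
    by (intro uniformly_convergent_on_prod') (auto intro!: continuous_intros cx cq)
  then have ul: "uniform_limit (cball z d) (\<lambda>n w. \<Prod>k<n. 1 - x w * q w ^ k)
      (\<lambda>w. lim (\<lambda>n. \<Prod>k<n. 1 - x w * q w ^ k)) sequentially"
    by (simp only: uniformly_convergent_uniform_limit_iff)
  have "lim (\<lambda>n. \<Prod>k<n. 1 - x w * q w ^ k) = qpinf (x w) (q w)" if "w \<in> cball z d" for w
    using that d less by (intro limI qpinf_LIMSEQ) auto
  then have "uniform_limit (cball z d) (\<lambda>n w. \<Prod>k<n. 1 - x w * q w ^ k)
      (\<lambda>w. qpinf (x w) (q w)) sequentially"
    by (rule uniform_limit_cong'[THEN iffD1, OF refl _ ul])
  with d show "\<exists>d>0. cball z d \<subseteq> A \<and> uniform_limit (cball z d) (\<lambda>n w. \<Prod>k<n. 1 - x w * q w ^ k)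
      (\<lambda>w. qpinf (x w) (q w)) sequentially"
    by blast
qed

section \<open>A theta function and its inversion formula\<close>

text \<open>The quotient of a Jacobi theta function by the Dedekind eta function, up to a constant.\<close>

definition theta_eta :: "complex \<Rightarrow> complex \<Rightarrow> complex" where
  "theta_eta w \<tau> = eul (\<tau> / 12 - w / 2) * qpinf (eul w) (eul \<tau>) * qpinf (eul \<tau> / eul w) (eul \<tau>)"

lemma theta_eta_add_1: "theta_eta (w + 1) \<tau> = - theta_eta w \<tau>"
proof -
  have eq: "\<tau> / 12 - (w + 1) / 2 = (\<tau> / 12 - w / 2) - 1 / 2" by (simp add: field_simps)
  have "eul (\<tau> / 12 - (w + 1) / 2) = - eul (\<tau> / 12 - w / 2)"
    unfolding eq eul_diff[of "\<tau> / 12 - w / 2" "1 / 2"] eul_half by simp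
  then show ?thesis by (simp add: theta_eta_def eul_add)
qed

text \<open>Translation by \<tau> removes the first factor of one product and adds a factor to the
  other; the quotient (1 - 1/e(w)) / (1 - e(w)) = -1/e(w) accounts for the multiplier.\<close>

lemma theta_eta_add_tau:
  assumes "Im \<tau> > 0"
  shows "theta_eta (w + \<tau>) \<tau> = - eul (- \<tau> / 2 - w) * theta_eta w \<tau>"
proof -
  note q = norm_eul_less_1[OF assms]
  have 1: "qpinf (eul w) (eul \<tau>) = (1 - eul w) * qpinf (eul w * eul \<tau>) (eul \<tau>)"
    by (rule qpinf_rec[OF q])
  have 2: "qpinf (1 / eul w) (eul \<tau>) = (1 - 1 / eul w) * qpinf (eul \<tau> / eul w) (eul \<tau>)"
    using qpinf_rec[OF q, of "1 / eul w"] by simp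
  have "\<tau> / 12 - (w + \<tau>) / 2 = (\<tau> / 12 - w / 2) + (- \<tau> / 2)" by (simp add: field_simps)
  then have 3: "eul (\<tau> / 12 - (w + \<tau>) / 2) = eul (\<tau> / 12 - w / 2) * eul (- \<tau> / 2)"
    by (simp only: eul_add)
  have 4: "eul (- \<tau> / 2 - w) = eul (- \<tau> / 2) / eul w" by (rule eul_diff)
  have 5: "eul \<tau> / eul (w + \<tau>) = 1 / eul w" by (simp add: eul_add)
  \<comment> \<open>The comparison is made after multiplication by 1 - e(w). If e(w) = 1 this says
    nothing, but then a vanishing factor makes both sides zero.\<close>
  show ?thesis
  proof (cases "eul w = 1")
    case True
    then show ?thesis using 1 2 unfolding theta_eta_def 5 eul_add by simp
  next
    case False
    have "(1 - eul w) * theta_eta (w + \<tau>) \<tau> =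
      eul (\<tau> / 12 - w / 2) * eul (- \<tau> / 2) * qpinf (eul w) (eul \<tau>) *
        ((1 - 1 / eul w) * qpinf (eul \<tau> / eul w) (eul \<tau>))"
      unfolding theta_eta_def 5 3 2[symmetric] 1 by (simp add: eul_add mult_ac)
    also have "\<dots> = (1 - eul w) * (- eul (- \<tau> / 2 - w) * theta_eta w \<tau>)"
      unfolding theta_eta_def 4 by (simp add: field_simps)
    finally show ?thesis using False by (simp only: mult_cancel_left) simp
  qed
qed

lemma holomorphic_theta_eta:
  assumes "open A" "f holomorphic_on A" "t holomorphic_on A" "\<And>z. z \<in> A \<Longrightarrow> Im (t z) > 0"
  shows "(\<lambda>z. theta_eta (f z) (t z)) holomorphic_on A"
  unfolding theta_eta_def using assms
  by (intro holomorphic_intros holomorphic_qpinf norm_eul_less_1) auto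

text \<open>The zeros are the lattice points: those with m \<le> 0 come from the first product,
  those with m \<ge> 1 from the second.\<close>

lemma theta_eta_eq_0_iff:
  assumes "Im \<tau> > 0"
  shows "theta_eta w \<tau> = 0 \<longleftrightarrow> (\<exists>m n::int. w = of_int m * \<tau> + of_int n)"
proof -
  note q = norm_eul_less_1[OF assms]
  have "theta_eta w \<tau> = 0 \<longleftrightarrow> (\<exists>n. eul w * eul \<tau> ^ n = 1) \<or> (\<exists>n. eul \<tau> / eul w * eul \<tau> ^ n = 1)"
    by (simp add: theta_eta_def qpinf_eq_0_iff[OF q])
  also have "\<dots> \<longleftrightarrow> (\<exists>m n::int. w = of_int m * \<tau> + of_int n)"
  proof -
    have 1: "eul w * eul \<tau> ^ k = 1 \<longleftrightarrow> (\<exists>n::int. w = of_int (- int k) * \<tau> + of_int n)" for k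
    proof -
      have "eul w * eul \<tau> ^ k = eul (w + of_nat k * \<tau>)" by (simp add: eul_add eul_power)
      then show ?thesis by (auto simp: eul_eq_1_iff Ints_def image_iff algebra_simps)
    qed
    have 2: "eul \<tau> / eul w * eul \<tau> ^ k = 1 \<longleftrightarrow> (\<exists>n::int. w = of_int (int (Suc k)) * \<tau> + of_int n)" for k
    proof -
      have "eul \<tau> / eul w * eul \<tau> ^ k = inverse (eul (w - of_int (int (Suc k)) * \<tau>))"
        by (simp add: eul_add eul_diff eul_power distrib_right)
      then have "eul \<tau> / eul w * eul \<tau> ^ k = 1 \<longleftrightarrow> w - of_int (int (Suc k)) * \<tau> \<in> \<int>"
        by (simp only: inverse_eq_1_iff eul_eq_1_iff)
      then show ?thesis by (auto simp: Ints_def algebra_simps)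
    qed
    show ?thesis
    proof
      assume "(\<exists>n. eul w * eul \<tau> ^ n = 1) \<or> (\<exists>n. eul \<tau> / eul w * eul \<tau> ^ n = 1)"
      then show "\<exists>m n::int. w = of_int m * \<tau> + of_int n"
        unfolding 1 2 by (elim disjE exE) blast+
    next
      assume "\<exists>m n::int. w = of_int m * \<tau> + of_int n"
      then obtain m n :: int where w: "w = of_int m * \<tau> + of_int n" by (elim exE)
      show "(\<exists>n. eul w * eul \<tau> ^ n = 1) \<or> (\<exists>n. eul \<tau> / eul w * eul \<tau> ^ n = 1)"
      proof (cases "m \<le> 0")
        case True
        then have "m = - int (nat (- m))" by simp
        with w have "eul w * eul \<tau> ^ nat (- m) = 1" unfolding 1 by metis
        then show ?thesis by (intro disjI1 exI)
      next
        case False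
        then have "m = int (Suc (nat (m - 1)))" by simp
        with w have "eul \<tau> / eul w * eul \<tau> ^ nat (m - 1) = 1" unfolding 2 by metis
        then show ?thesis by (intro disjI2 exI)
      qed
    qed
  qed
  finally show ?thesis .
qed

text \<open>Isolates the factor responsible for the zero at 0 and thereby shows that this zero is
  simple.\<close>

lemma theta_eta_factor:
  assumes "Im \<tau> > 0"
  obtains u where "u holomorphic_on UNIV" "u 0 \<noteq> 0" "\<And>w. theta_eta w \<tau> = (1 - eul w) * u w"
proof
  note q = norm_eul_less_1[OF assms]
  let ?u = "\<lambda>w. eul (\<tau> / 12 - w / 2) * qpinf (eul w * eul \<tau>) (eul \<tau>) * qpinf (eul \<tau> / eul w) (eul \<tau>)"
  show "?u holomorphic_on UNIV"
    by (intro holomorphic_intros holomorphic_qpinf) (auto simp: q)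
  show "?u 0 \<noteq> 0"
    using qpinf_self_nonzero[OF q] by simp
  show "theta_eta w \<tau> = (1 - eul w) * ?u w" for w
    unfolding theta_eta_def qpinf_rec[OF q, of "eul w"] by (simp add: mult_ac)
qed

lemma periodic_of_int:
  fixes f :: "complex \<Rightarrow> 'a"
  assumes "\<And>z. f (z + p) = f z"
  shows "f (z + of_int n * p) = f z"
proof (induction n rule: int_induct[where k = 0])
  case (step1 i)
  have "z + of_int (i + 1) * p = z + of_int i * p + p" by (simp add: algebra_simps)
  then show ?case using step1(2) by (simp only: assms)
next
  case (step2 i)
  have "z + of_int i * p = z + of_int (i - 1) * p + p" by (simp add: algebra_simps)
  then show ?case using step2(2) by (simp only: assms)
qed simp

text \<open>All values are already taken on a compact period parallelogram, so the function is
  bounded and Liouville's theorem applies.\<close>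

lemma doubly_periodic_entire_constant:
  assumes hol: "f holomorphic_on UNIV" and \<tau>: "Im \<tau> > 0"
    and per: "\<And>z. f (z + 1) = f z" "\<And>z. f (z + \<tau>) = f z"
  obtains c where "\<And>z. f z = c"
proof -
  let ?K = "(\<lambda>(s, t). complex_of_real s * \<tau> + of_real t) ` ({0..1} \<times> {0..1})"
  have "compact ?K"
    by (intro compact_continuous_image compact_Times compact_Icc)
       (auto intro!: continuous_intros simp: case_prod_unfold)
  moreover have "continuous_on ?K f"
    by (rule continuous_on_subset[OF holomorphic_on_imp_continuous_on[OF hol] subset_UNIV])
  ultimately have "compact (f ` ?K)"
    by (rule compact_continuous_image[rotated])
  moreover have "range f \<subseteq> f ` ?K"
  proof safe
    fix z
    define s where "s = Im z / Im \<tau>"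
    define t where "t = Re (z - of_real s * \<tau>)"
    have z: "z = of_real s * \<tau> + of_real t"
      using \<tau> by (simp add: complex_eq_iff s_def t_def)
    let ?z = "of_real (frac s) * \<tau> + of_real (frac t)"
    have "z = ?z + of_int \<lfloor>t\<rfloor> * 1 + of_int \<lfloor>s\<rfloor> * \<tau>"
    proof -
      have "of_real s = complex_of_real (frac s) + of_int \<lfloor>s\<rfloor>" "of_real t = complex_of_real (frac t) + of_int \<lfloor>t\<rfloor>"
        by (simp_all add: frac_def)
      then show ?thesis unfolding z by (simp add: algebra_simps)
    qed
    then have "f z = f (?z + of_int \<lfloor>t\<rfloor> * 1 + of_int \<lfloor>s\<rfloor> * \<tau>)" by (rule arg_cong)
    then have "f z = f ?z"
      by (simp only: periodic_of_int[of f \<tau>, OF per(2)] periodic_of_int[of f 1, OF per(1)])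
    moreover have "?z \<in> ?K"
      by (intro image_eqI[of _ _ "(frac s, frac t)"]) (auto simp: frac_lt_1 less_imp_le)
    ultimately show "f z \<in> f ` ?K" by blast
  qed
  ultimately have "bounded (range f)"
    using bounded_subset compact_imp_bounded by blast
  with hol have "f constant_on UNIV" by (rule Liouville_theorem)
  then show ?thesis using that by (auto simp: constant_on_def)
qed

text \<open>Both sides have the same quasi-periods and the same simple zeros, so their quotient is an elliptic
  function without poles.\<close>

lemma theta_eta_S:
  assumes \<tau>: "Im \<tau> > 0"
  obtains c where "\<And>w. theta_eta (w / \<tau>) (- 1 / \<tau>) = c * (eul (w\<^sup>2 / (2 * \<tau>)) * theta_eta w \<tau>)"
proof -
  define \<tau>' where "\<tau>' = - 1 / \<tau>"
  have \<tau>0: "\<tau> \<noteq> 0" using \<tau> by auto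
  have \<tau>': "Im \<tau>' > 0"
    using \<tau> by (simp add: \<tau>'_def Im_divide sum_power2_gt_zero_iff divide_pos_pos)
  define F where "F = (\<lambda>w. theta_eta (w / \<tau>) \<tau>')"
  \<comment> \<open>The Gaussian factor is chosen so that H acquires the same multipliers as F under
    w -> w + 1 and w -> w + \<tau>: its quotient at w + \<tau> and w cancels the multiplier of the
    theta function, and its quotient at w + 1 and w creates the one that F has.\<close>
  define H where "H = (\<lambda>w. eul (w\<^sup>2 / (2 * \<tau>)) * theta_eta w \<tau>)"
  define \<Lambda> where "\<Lambda> = {w. \<exists>m n::int. w = of_int m * \<tau> + of_int n}"
  have H0: "H w = 0 \<longleftrightarrow> w \<in> \<Lambda>" for w
    by (simp add: H_def theta_eta_eq_0_iff[OF \<tau>] \<Lambda>_def)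
  have F0: "F w = 0 \<longleftrightarrow> w \<in> \<Lambda>" for w
  proof -
    have "w / \<tau> = of_int m * \<tau>' + of_int n \<longleftrightarrow> w = of_int n * \<tau> + of_int (- m)" for m n :: int
      using \<tau>0 by (auto simp: \<tau>'_def field_simps)
    then have "F w = 0 \<longleftrightarrow> (\<exists>m n::int. w = of_int n * \<tau> + of_int (- m))"
      by (simp add: F_def theta_eta_eq_0_iff[OF \<tau>'])
    also have "\<dots> \<longleftrightarrow> w \<in> \<Lambda>"
      unfolding \<Lambda>_def mem_Collect_eq by (metis minus_minus)
    finally show ?thesis .
  qed
  have F\<tau>: "F (w + \<tau>) = - F w" for w
  proof -
    have "(w + \<tau>) / \<tau> = w / \<tau> + 1" using \<tau>0 by (simp add: field_simps)
    then show ?thesis by (simp add: F_def theta_eta_add_1)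
  qed
  have H\<tau>: "H (w + \<tau>) = - H w" for w
  proof -
    have "(w + \<tau>)\<^sup>2 / (2 * \<tau>) + (- \<tau> / 2 - w) = w\<^sup>2 / (2 * \<tau>)"
      using \<tau>0 by (simp add: field_simps power2_eq_square)
    then have "eul ((w + \<tau>)\<^sup>2 / (2 * \<tau>)) * eul (- \<tau> / 2 - w) = eul (w\<^sup>2 / (2 * \<tau>))"
      by (simp only: eul_add[symmetric])
    then show ?thesis by (simp add: H_def theta_eta_add_tau[OF \<tau>])
  qed
  have H1: "H (w + 1) = - eul (w / \<tau> + 1 / (2 * \<tau>)) * H w" for w
  proof -
    have "(w + 1)\<^sup>2 / (2 * \<tau>) = w\<^sup>2 / (2 * \<tau>) + (w / \<tau> + 1 / (2 * \<tau>))"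
      using \<tau>0 by (simp add: field_simps power2_eq_square)
    then have "eul ((w + 1)\<^sup>2 / (2 * \<tau>)) = eul (w\<^sup>2 / (2 * \<tau>)) * eul (w / \<tau> + 1 / (2 * \<tau>))"
      by (simp only: eul_add)
    then show ?thesis by (simp add: H_def theta_eta_add_1)
  qed
  have F1: "F (w + 1) = - eul (w / \<tau> + 1 / (2 * \<tau>)) * F w" for w
  proof -
    have "F w = theta_eta ((w + 1) / \<tau> + \<tau>') \<tau>'"
      using \<tau>0 by (simp add: F_def \<tau>'_def field_simps)
    also have "\<dots> = - eul (- \<tau>' / 2 - (w + 1) / \<tau>) * F (w + 1)"
      by (simp add: theta_eta_add_tau[OF \<tau>'] F_def)
    also have "- \<tau>' / 2 - (w + 1) / \<tau> = - (w / \<tau> + 1 / (2 * \<tau>))"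
      using \<tau>0 by (simp add: \<tau>'_def field_simps)
    finally have "F w = - inverse (eul (w / \<tau> + 1 / (2 * \<tau>))) * F (w + 1)"
      by (simp only: eul_minus)
    then show ?thesis by (simp add: field_simps)
  qed
  have holF: "F holomorphic_on UNIV"
    unfolding F_def using \<tau>' \<tau>0 by (intro holomorphic_theta_eta holomorphic_intros) auto
  have "(\<lambda>w. theta_eta w \<tau>) holomorphic_on UNIV"
    using \<tau> by (intro holomorphic_theta_eta holomorphic_intros) auto
  then have holH: "H holomorphic_on UNIV"
    unfolding H_def using \<tau>0 by (intro holomorphic_intros) auto
  obtain u where u: "u holomorphic_on UNIV" "u 0 \<noteq> 0" "\<And>w. theta_eta w \<tau> = (1 - eul w) * u w"
    using theta_eta_factor[OF \<tau>] by blast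
  obtain v where v: "v holomorphic_on UNIV" "v 0 \<noteq> 0" "\<And>w. theta_eta w \<tau>' = (1 - eul w) * v w"
    using theta_eta_factor[OF \<tau>'] by blast
  have \<Lambda>_shift: "w + 1 \<in> \<Lambda> \<longleftrightarrow> w \<in> \<Lambda>" "w + \<tau> \<in> \<Lambda> \<longleftrightarrow> w \<in> \<Lambda>" for w
    unfolding H0[symmetric] H1 H\<tau> by simp_all
  \<comment> \<open>F and H both have a simple zero at the origin; dividing numerator and
    denominator by w exhibits the limit of the quotient.\<close>
  obtain l where l: "((\<lambda>w. F w / H w) \<longlongrightarrow> l) (at 0)"
  proof -
    have "((\<lambda>w. (1 - eul w) / w) \<longlongrightarrow> - (2 * of_real pi * \<i>)) (at 0)"
    proof -
      have "((\<lambda>w. 1 - eul w) has_field_derivative - (2 * of_real pi * \<i>)) (at 0)"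
        unfolding eul_def by (auto intro!: derivative_eq_intros)
      then show ?thesis by (simp add: has_field_derivative_iff)
    qed
    moreover have "((\<lambda>w. (1 - eul (w / \<tau>)) / w) \<longlongrightarrow> - (2 * of_real pi * \<i> / \<tau>)) (at 0)"
    proof -
      have "((\<lambda>w. 1 - eul (w / \<tau>)) has_field_derivative - (2 * of_real pi * \<i> / \<tau>)) (at 0)"
        unfolding eul_def using \<tau>0 by (auto intro!: derivative_eq_intros)
      then show ?thesis by (simp add: has_field_derivative_iff)
    qed
    moreover have "((\<lambda>w. v (w / \<tau>)) \<longlongrightarrow> v 0) (at 0)"
    proof -
      have "((\<lambda>w. w / \<tau>) \<longlongrightarrow> 0 / \<tau>) (at 0)" using \<tau>0 by (intro tendsto_intros)
      then have "((\<lambda>w. v (w / \<tau>)) \<longlongrightarrow> v (0 / \<tau>)) (at 0)"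
        by (intro continuous_on_tendsto_compose[OF holomorphic_on_imp_continuous_on[OF v(1)]]) auto
      then show ?thesis by simp
    qed
    moreover have "(u \<longlongrightarrow> u 0) (at 0)"
      using holomorphic_on_imp_continuous_on[OF u(1)] by (simp add: continuous_on_eq_continuous_at isCont_def)
    moreover have "((\<lambda>w. eul (w\<^sup>2 / (2 * \<tau>))) \<longlongrightarrow> 1) (at 0)"
    proof -
      have "((\<lambda>w. eul (w\<^sup>2 / (2 * \<tau>))) \<longlongrightarrow> eul (0\<^sup>2 / (2 * \<tau>))) (at 0)"
        unfolding eul_def using \<tau>0 by (intro tendsto_intros) auto
      then show ?thesis by simp
    qed
    ultimately have "((\<lambda>w. ((1 - eul (w / \<tau>)) / w * v (w / \<tau>)) / (eul (w\<^sup>2 / (2 * \<tau>)) * ((1 - eul w) / w * u w))) \<longlongrightarrow>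
        (- (2 * of_real pi * \<i> / \<tau>) * v 0) / (1 * (- (2 * of_real pi * \<i>) * u 0))) (at 0)"
      using u(2) by (intro tendsto_intros) auto
    moreover have "eventually (\<lambda>w. ((1 - eul (w / \<tau>)) / w * v (w / \<tau>)) / (eul (w\<^sup>2 / (2 * \<tau>)) * ((1 - eul w) / w * u w)) =
        F w / H w) (at 0)"
    proof -
      have aux: "(a / w * b) / (c * (d / w * e)) = (a * b) / (c * (d * e))" if "w \<noteq> 0" for a b c d e w :: complex
        using that by simp
      show ?thesis
        unfolding eventually_at_filter F_def H_def u(3) v(3)
        by (intro always_eventually allI impI aux)
    qed
    ultimately have "((\<lambda>w. F w / H w) \<longlongrightarrow> (- (2 * of_real pi * \<i> / \<tau>) * v 0) / (1 * (- (2 * of_real pi * \<i>) * u 0))) (at 0)"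
      by (rule Lim_transform_eventually)
    then show ?thesis by (rule that)
  qed
  \<comment> \<open>A single value \<open>l\<close> serves at all lattice points: the quotient is
    doubly periodic, so its limit at each of them is the limit at 0.\<close>
  define G where "G = (\<lambda>w. if w \<in> \<Lambda> then l else F w / H w)"
  have G\<tau>: "G (w + \<tau>) = G w" for w
    by (simp add: G_def \<Lambda>_shift F\<tau> H\<tau>)
  have G1: "G (w + 1) = G w" for w
    by (simp add: G_def \<Lambda>_shift F1 H1)
  \<comment> \<open>A point where H is nonzero is required by the theorem on isolated zeros.\<close>
  have "1 / 2 \<notin> \<Lambda>"
  proof
    assume "1 / 2 \<in> \<Lambda>"
    then obtain m n :: int where mn: "(1 / 2 :: complex) = of_int m * \<tau> + of_int n" by (auto simp: \<Lambda>_def)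
    from arg_cong[OF this, of Im] have "m = 0" using \<tau> by simp
    with mn have "(1 / 2 :: complex) = of_int n" by simp
    then have "complex_of_int (2 * n) = of_int 1" by (simp add: mult.commute)
    then have "2 * n = 1" by (simp only: of_int_eq_iff)
    then show False by presburger
  qed
  then have Hnz: "H (1 / 2) \<noteq> 0" by (simp add: H0)
  have iso: "\<exists>r>0. \<forall>z\<in>ball w r - {w}. z \<notin> \<Lambda>" for w
  proof (cases "H w = 0")
    case True
    obtain r where "r > 0" "\<And>z. z \<in> ball w r - {w} \<Longrightarrow> H z \<noteq> 0"
      by (rule isolated_zeros[OF holH open_UNIV connected_UNIV UNIV_I True UNIV_I Hnz]) (rule that)
    then show ?thesis using H0 by (intro exI[of _ r]) simp
  next
    case False
    have "isCont H w" using holomorphic_on_imp_continuous_on[OF holH] by (simp add: continuous_on_eq_continuous_at)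
    from continuous_at_avoid[OF this False] obtain r where "r > 0 \<and> (\<forall>z. dist w z < r \<longrightarrow> H z \<noteq> 0)" ..
    then show ?thesis using H0 by (auto intro!: exI[of _ r])
  qed
  have lim\<Lambda>: "(G \<longlongrightarrow> l) (at w)" if w\<Lambda>: "w \<in> \<Lambda>" for w
  proof -
    obtain r where r: "r > 0" "\<forall>z\<in>ball 0 r - {0}. z \<notin> \<Lambda>" using iso[of 0] by blast
    have "eventually (\<lambda>z. F z / H z = G z) (at 0)"
      unfolding eventually_at using r by (auto intro!: exI[of _ r] simp: G_def)
    then have "(G \<longlongrightarrow> l) (at 0)" by (rule Lim_transform_eventually[OF l])
    moreover obtain m n :: int where w: "w = of_int m * \<tau> + of_int n" using w\<Lambda> by (auto simp: \<Lambda>_def)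
    have Gw: "G (z + w) = G z" for z
    proof -
      have "z + w = (z + of_int n * 1) + of_int m * \<tau>" by (simp add: w)
      then have "G (z + w) = G ((z + of_int n * 1) + of_int m * \<tau>)" by (rule arg_cong)
      then show ?thesis
        by (simp only: periodic_of_int[of G \<tau>, OF G\<tau>] periodic_of_int[of G 1, OF G1])
    qed
    ultimately have "((\<lambda>z. G (z + w)) \<longlongrightarrow> l) (at 0)"
      by (simp only: Gw)
    then show ?thesis using LIM_offset_zero_cancel[of G w l] by (simp add: add.commute)
  qed
  have "G holomorphic_on UNIV"
  proof -
    have "\<exists>A. open A \<and> w \<in> A \<and> G holomorphic_on A" for w
    proof -
      obtain r where r: "r > 0" "\<forall>z\<in>ball w r - {w}. z \<notin> \<Lambda>" using iso[of w] by blast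
      have hol: "(\<lambda>z. F z / H z) holomorphic_on (ball w r - {w})"
        using r H0 holF holH by (intro holomorphic_intros) (auto intro: holomorphic_on_subset)
      have eq: "G z = F z / H z" if "z \<in> ball w r - {w}" for z
        using r that by (simp add: G_def)
      have hol': "G holomorphic_on (ball w r - {w})"
        using hol by (rule holomorphic_transform) (rule eq[symmetric])
      have "(G \<longlongrightarrow> G w) (at w)"
      proof (cases "w \<in> \<Lambda>")
        case True
        then show ?thesis using lim\<Lambda> by (simp add: G_def)
      next
        case False
        have "((\<lambda>z. F z / H z) \<longlongrightarrow> F w / H w) (at w)"
          using holomorphic_on_imp_continuous_on[OF holH] holomorphic_on_imp_continuous_on[OF holF] False H0
          by (intro tendsto_divide) (auto simp: continuous_on_eq_continuous_at isCont_def)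
        moreover have "eventually (\<lambda>z. F z / H z = G z) (at w)"
          unfolding eventually_at using r eq by (auto intro!: exI[of _ r] simp: dist_commute)
        ultimately have "(G \<longlongrightarrow> F w / H w) (at w)" by (rule Lim_transform_eventually)
        then show ?thesis using False by (simp add: G_def)
      qed
      then have lim: "(G \<longlongrightarrow> G w) (at w within ball w r)" by (rule tendsto_within_subset) simp
      have "G holomorphic_on ball w r"
      proof (rule no_isolated_singularity'[where K = "{w}"])
        show "(G \<longlongrightarrow> G z) (at z within ball w r)" if "z \<in> {w}" for z
          using that lim by simp
      qed (use hol' in simp_all)
      then show ?thesis using r by (intro exI[of _ "ball w r"]) auto
    qed
    then have "G analytic_on UNIV"
      unfolding analytic_on_analytic_at[of G UNIV] analytic_at by blast
    then show ?thesis by (rule analytic_imp_holomorphic)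
  qed
  then obtain c where c: "\<And>w. G w = c"
    using doubly_periodic_entire_constant[OF _ \<tau> G1 G\<tau>] by blast
  have FH: "F w = c * H w" for w
  proof (cases "w \<in> \<Lambda>")
    case True
    then have "H w = 0" "F w = 0" by (simp_all only: H0 F0)
    then show ?thesis by simp
  next
    case False
    then have "H w \<noteq> 0" by (simp only: H0 not_False_eq_True)
    moreover have "F w / H w = c" using c[of w] False by (simp only: G_def if_False)
    ultimately show ?thesis by (auto simp: field_simps)
  qed
  show ?thesis
    by (rule that[of c]) (rule FH[unfolded F_def H_def \<tau>'_def])
qed

text \<open>Up to sign the classical Siegel function of characteristic (a, b). The prefactor
  contributes q to the power a^2/2 - a/2 + 1/12 = B_2(a)/2, with B_2 the second Bernoulli
  polynomial, and removes the Gaussian factor from the inversion formula.\<close>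

definition siegel :: "real \<Rightarrow> real \<Rightarrow> complex \<Rightarrow> complex" where
  "siegel a b \<tau> = eul (of_real a * (of_real a * \<tau> + of_real b) / 2) * theta_eta (of_real a * \<tau> + of_real b) \<tau>"

text \<open>An integral shift of the characteristic costs only a constant, which is a root of unity
  for rational (a, b); so only characteristics modulo 1 matter.\<close>

lemma siegel_add_left:
  assumes "Im \<tau> > 0"
  shows "siegel (a + 1) b \<tau> = - eul (- of_real b / 2) * siegel a b \<tau>"
proof -
  define w where "w = of_real a * \<tau> + of_real b"
  have w: "of_real (a + 1) * \<tau> + of_real b = w + \<tau>" by (simp add: w_def algebra_simps)
  have "of_real (a + 1) * (w + \<tau>) / 2 + (- \<tau> / 2 - w) = - of_real b / 2 + of_real a * w / 2"
    by (simp add: w_def field_simps)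
  then have e: "eul (of_real (a + 1) * (w + \<tau>) / 2) * eul (- \<tau> / 2 - w) = eul (- of_real b / 2) * eul (of_real a * w / 2)"
    by (simp only: eul_add[symmetric])
  have "siegel (a + 1) b \<tau> = - (eul (of_real (a + 1) * (w + \<tau>) / 2) * eul (- \<tau> / 2 - w)) * theta_eta w \<tau>"
    unfolding siegel_def w theta_eta_add_tau[OF assms] by simp
  also have "\<dots> = - eul (- of_real b / 2) * siegel a b \<tau>"
    unfolding e siegel_def w_def[symmetric] by simp
  finally show ?thesis .
qed

lemma siegel_add_right: "siegel a (b + 1) \<tau> = - eul (of_real a / 2) * siegel a b \<tau>"
proof -
  define w where "w = of_real a * \<tau> + of_real b"
  have w: "of_real a * \<tau> + of_real (b + 1) = w + 1" by (simp add: w_def)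
  have "of_real a * (w + 1) / 2 = of_real a / 2 + of_real a * w / 2"
    by (simp add: field_simps)
  then have e: "eul (of_real a * (w + 1) / 2) = eul (of_real a / 2) * eul (of_real a * w / 2)"
    by (simp only: eul_add)
  show ?thesis
    unfolding siegel_def w theta_eta_add_1 e w_def[symmetric] by simp
qed

text \<open>The characteristic is transformed as a row vector by the matrix of the translation; the
  constant e(1/12) comes from the factor q^(1/12).\<close>

lemma siegel_T: "siegel a b (\<tau> + 1) = eul (1 / 12) * siegel a (a + b) \<tau>"
proof -
  have w: "of_real a * (\<tau> + 1) + of_real b = of_real a * \<tau> + of_real (a + b)" by (simp add: algebra_simps)
  have "(\<tau> + 1) / 12 - w / 2 = 1 / 12 + (\<tau> / 12 - w / 2)" for w by (simp add: field_simps)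
  then have "theta_eta w (\<tau> + 1) = eul (1 / 12) * theta_eta w \<tau>" for w
    unfolding theta_eta_def by (simp only: eul_add eul_1 mult_1_right mult.assoc)
  then show ?thesis unfolding siegel_def w by simp
qed

lemma siegel_eq_0_iff:
  assumes "Im \<tau> > 0"
  shows "siegel a b \<tau> = 0 \<longleftrightarrow> a \<in> \<int> \<and> b \<in> \<int>"
proof -
  have "siegel a b \<tau> = 0 \<longleftrightarrow> (\<exists>m n::int. of_real a * \<tau> + of_real b = of_int m * \<tau> + of_int n)"
    by (simp add: siegel_def theta_eta_eq_0_iff[OF assms])
  also have "\<dots> \<longleftrightarrow> (\<exists>m n::int. a = of_int m \<and> b = of_int n)"
    using assms by (auto simp: complex_eq_iff)
  also have "\<dots> \<longleftrightarrow> a \<in> \<int> \<and> b \<in> \<int>"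
    by (auto simp: Ints_def)
  finally show ?thesis .
qed

lemma holomorphic_siegel: "siegel a b holomorphic_on {z. Im z > 0}"
  unfolding siegel_def
  by (intro holomorphic_intros holomorphic_theta_eta open_halfspace_Im_gt) auto

text \<open>Euler's identity relating partitions into distinct and into odd parts: (q; q) (-q; q) =
  (q^2; q^2) and (q; q) = (q; q^2) (q^2; q^2), all infinite products.\<close>

lemma qpinf_neg_mult_odd:
  assumes q: "norm q < 1"
  shows "qpinf (- q) q * qpinf q (q\<^sup>2) = 1"
proof -
  have q2: "norm (q\<^sup>2) < 1" using q by (simp add: norm_power power_less_one_iff)
  have "qpinf q q = qpinf q (q\<^sup>2) * qpinf (q\<^sup>2) (q\<^sup>2)"
    using qpinf_dissect[OF q, of 2 q] by (simp add: numeral_2_eq_2 mult_ac)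
  moreover have "qpinf q q * qpinf (- q) q = qpinf (q\<^sup>2) (q\<^sup>2)"
    by (rule qpinf_mult_neg[OF q])
  ultimately show ?thesis using qpinf_self_nonzero[OF q2] by (simp add: mult_ac)
qed

text \<open>The three nonzero 2-torsion points; by Euler's \<open>\<Prod>(1 + q\<^sup>n) (1 - q\<^sup>2\<^sup>n\<^sup>-\<^sup>1) = 1\<close> the product does not
  depend on \<open>\<tau>\<close>, which pins down the cube of the multiplier of the inversion.\<close>

lemma siegel_two_torsion_product:
  assumes \<tau>: "Im \<tau> > 0"
  shows "siegel 0 (1/2) \<tau> * siegel (1/2) 0 \<tau> * siegel (1/2) (1/2) \<tau> = 2 * eul (- 3 / 8)"
proof -
  note q = norm_eul_less_1[OF \<tau>]
  let ?q = "eul \<tau>" let ?s = "eul (\<tau> / 2)"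
  have ss: "?s * ?s = ?q" by (simp flip: eul_add)
  have h: "eul (\<tau> / 2 + 1 / 2) = - ?s" "eul (1 / 2) = - 1" by (simp_all add: eul_add eul_half)
  have s1: "siegel 0 (1/2) \<tau> = eul (\<tau> / 12 - 1 / 4) * (2 * (qpinf (- ?q) ?q)\<^sup>2)"
    using qpinf_rec[OF q, of "- 1"] by (simp add: siegel_def theta_eta_def h power2_eq_square)
  have s2: "siegel (1/2) 0 \<tau> = eul (\<tau> / 8) * eul (\<tau> / 12 - \<tau> / 4) * (qpinf ?s ?q)\<^sup>2"
  proof -
    have "?q / ?s = ?s" by (simp flip: ss)
    then show ?thesis by (simp add: siegel_def theta_eta_def power2_eq_square)
  qed
  have s3: "siegel (1/2) (1/2) \<tau> = eul ((\<tau> / 2 + 1 / 2) / 4) * eul (\<tau> / 12 - (\<tau> / 2 + 1 / 2) / 2) * (qpinf (- ?s) ?q)\<^sup>2"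
  proof -
    have "?q / - ?s = - ?s" by (simp flip: ss)
    then show ?thesis by (simp add: siegel_def theta_eta_def h power2_eq_square)
  qed
  have "qpinf ?s ?q * qpinf (- ?s) ?q = qpinf ?q (?q\<^sup>2)"
    using qpinf_mult_neg[OF q, of ?s] by (simp add: power2_eq_square ss)
  moreover have "qpinf (- ?q) ?q * qpinf ?q (?q\<^sup>2) = 1"
    by (rule qpinf_neg_mult_odd[OF q])
  ultimately have p: "qpinf (- ?q) ?q * (qpinf ?s ?q * qpinf (- ?s) ?q) = 1" by simp
  have "(\<tau> / 12 - 1 / 4) + (\<tau> / 8) + (\<tau> / 12 - \<tau> / 4) + (\<tau> / 2 + 1 / 2) / 4 + (\<tau> / 12 - (\<tau> / 2 + 1 / 2) / 2) = - 3 / 8"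
    by (simp add: field_simps)
  then have e: "eul (\<tau> / 12 - 1 / 4) * eul (\<tau> / 8) * eul (\<tau> / 12 - \<tau> / 4) * eul ((\<tau> / 2 + 1 / 2) / 4) *
      eul (\<tau> / 12 - (\<tau> / 2 + 1 / 2) / 2) = eul (- 3 / 8)"
    by (simp only: eul_add[symmetric])
  have "siegel 0 (1/2) \<tau> * siegel (1/2) 0 \<tau> * siegel (1/2) (1/2) \<tau> =
    2 * (eul (\<tau> / 12 - 1 / 4) * eul (\<tau> / 8) * eul (\<tau> / 12 - \<tau> / 4) * eul ((\<tau> / 2 + 1 / 2) / 4) *
      eul (\<tau> / 12 - (\<tau> / 2 + 1 / 2) / 2)) * (qpinf (- ?q) ?q * (qpinf ?s ?q * qpinf (- ?s) ?q))\<^sup>2"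
    unfolding s1 s2 s3 by (simp only: power_mult_distrib mult_ac)
  then show ?thesis unfolding p e by simp
qed

lemma Im_minus_inverse:
  assumes "Im \<tau> > 0"
  shows "Im (- 1 / \<tau>) > 0"
proof -
  have "Re \<tau> ^ 2 + Im \<tau> ^ 2 > 0" using assms by (simp add: sum_power2_gt_zero_iff)
  then show ?thesis using assms by (simp add: Im_divide)
qed

text \<open>The theta inversion gives a factor c(\<tau>) common to all (a, b). The product over the
  three 2-torsion points forces c(\<tau>)^3 = \<i>, so c takes finitely many values; being
  continuous on a connected half-plane, it is constant.\<close>

lemma siegel_S:
  obtains c where "c ^ 12 = 1" "\<And>a b \<tau>. Im \<tau> > 0 \<Longrightarrow> siegel a b (- 1 / \<tau>) = c * siegel b (- a) \<tau>"
proof -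
  have ex: "\<exists>c. \<forall>a b. siegel a b (- 1 / \<tau>) = c * siegel b (- a) \<tau>" if \<tau>: "Im \<tau> > 0" for \<tau>
  proof -
    have \<tau>0: "\<tau> \<noteq> 0" using \<tau> by auto
    obtain c where c: "\<And>w. theta_eta (w / \<tau>) (- 1 / \<tau>) = c * (eul (w\<^sup>2 / (2 * \<tau>)) * theta_eta w \<tau>)"
      by (rule theta_eta_S[OF \<tau>]) blast
    have "siegel a b (- 1 / \<tau>) = c * siegel b (- a) \<tau>" for a b
    proof -
      define w where "w = of_real b * \<tau> - of_real a"
      have w: "of_real a * (- 1 / \<tau>) + of_real b = w / \<tau>" "of_real b * \<tau> + of_real (- a) = w"
        using \<tau>0 by (simp_all add: w_def field_simps)
      have "of_real a * (w / \<tau>) / 2 + w\<^sup>2 / (2 * \<tau>) = w / (2 * \<tau>) * (of_real a + w)"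
        using \<tau>0 by (simp add: field_simps power2_eq_square)
      also have "of_real a + w = of_real b * \<tau>" by (simp add: w_def)
      also have "w / (2 * \<tau>) * (of_real b * \<tau>) = of_real b * w / 2"
        using \<tau>0 by simp
      finally have "eul (of_real a * (w / \<tau>) / 2) * eul (w\<^sup>2 / (2 * \<tau>)) = eul (of_real b * w / 2)"
        by (simp only: eul_add[symmetric])
      then show ?thesis
        unfolding siegel_def w c by (metis mult.assoc mult.left_commute)
    qed
    then show ?thesis by blast
  qed
  \<comment> \<open>The factor is defined by one explicit quotient with nonvanishing denominator,
    which makes its holomorphy in \<tau> visible.\<close>
  define c where "c \<tau> = siegel 0 (1/2) (- 1 / \<tau>) / siegel (1/2) 0 \<tau>" for \<tau>
  have half: "(1 / 2 :: real) \<notin> \<int>"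
  proof
    assume "(1 / 2 :: real) \<in> \<int>"
    then obtain n :: int where "1 / 2 = real_of_int n" by (auto simp: Ints_def)
    then have "real_of_int (2 * n) = of_int 1" by simp
    then have "2 * n = 1" by (simp only: of_int_eq_iff)
    then show False by presburger
  qed
  have nz: "siegel (1/2) 0 \<tau> \<noteq> 0" "siegel 0 (1/2) \<tau> \<noteq> 0" "siegel (1/2) (1/2) \<tau> \<noteq> 0" if "Im \<tau> > 0" for \<tau>
    using half by (simp_all add: siegel_eq_0_iff[OF that])
  have c: "siegel a b (- 1 / \<tau>) = c \<tau> * siegel b (- a) \<tau>" if \<tau>: "Im \<tau> > 0" for a b \<tau>
  proof -
    obtain c' where c': "\<And>a b. siegel a b (- 1 / \<tau>) = c' * siegel b (- a) \<tau>" using ex[OF \<tau>] by blast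
    have "c \<tau> = c'" using nz(1)[OF \<tau>] c'[of 0 "1/2"] by (simp add: c_def)
    then show ?thesis using c' by simp
  qed
  have c3: "c \<tau> ^ 3 = \<i>" if \<tau>: "Im \<tau> > 0" for \<tau>
  proof -
    let ?x = "siegel 0 (1/2) \<tau>" and ?y = "siegel (1/2) 0 \<tau>" and ?z = "siegel (1/2) (1/2) \<tau>"
    \<comment> \<open>Inversion permutes the 2-torsion characteristics only up to integral shifts.
      Undoing the shifts yields the factors -1 and \<i>, hence 1 = -\<i> c^3.\<close>
    have r1: "siegel 0 (- (1/2)) \<tau> = - ?x"
      using siegel_add_right[of 0 "- (1/2)" \<tau>] by simp
    have r2: "siegel (1/2) (- (1/2)) \<tau> = \<i> * ?z"
    proof -
      have "?z = - eul (1 / 4) * siegel (1/2) (- (1/2)) \<tau>"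
        using siegel_add_right[of "1/2" "- (1/2)" \<tau>] by simp
      then show ?thesis by (simp add: eul_quarter)
    qed
    have "?x * ?y * ?z = siegel 0 (1/2) (- 1 / \<tau>) * siegel (1/2) 0 (- 1 / \<tau>) * siegel (1/2) (1/2) (- 1 / \<tau>)"
      unfolding siegel_two_torsion_product[OF \<tau>] siegel_two_torsion_product[OF Im_minus_inverse[OF \<tau>]] ..
    also have "\<dots> = (c \<tau> * ?y) * (c \<tau> * - ?x) * (c \<tau> * (\<i> * ?z))"
      unfolding c[OF \<tau>] r1 r2 by simp
    finally have "(?x * ?y * ?z) * 1 = (?x * ?y * ?z) * (- \<i> * c \<tau> ^ 3)"
      by (simp add: power3_eq_cube mult_ac)
    then have "1 = - \<i> * c \<tau> ^ 3"
      using nz[OF \<tau>] by (simp only: mult_cancel_left mult_eq_0_iff) simp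
    then have "\<i> * 1 = \<i> * (- \<i> * c \<tau> ^ 3)" by (rule arg_cong)
    then show ?thesis by (simp add: mult.assoc[symmetric])
  qed
  have c12: "c \<tau> ^ 12 = 1" if "Im \<tau> > 0" for \<tau>
  proof -
    have "c \<tau> ^ 12 = (c \<tau> ^ 3) ^ 4" by (simp flip: power_mult)
    then show ?thesis using c3[OF that] by (simp add: power4_eq_xxxx)
  qed
  have "c holomorphic_on {z. Im z > 0}"
  proof -
    have "(siegel 0 (1/2) \<circ> (\<lambda>\<tau>. - 1 / \<tau>)) holomorphic_on {z. Im z > 0}"
      using Im_minus_inverse
      by (intro holomorphic_on_compose_gen[OF _ holomorphic_siegel] holomorphic_intros) auto
    then show ?thesis
      unfolding c_def using nz(1) holomorphic_siegel[of "1/2" 0]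
      by (intro holomorphic_on_divide) (auto simp: o_def)
  qed
  then have "continuous_on {z. Im z > 0} c" by (rule holomorphic_on_imp_continuous_on)
  moreover have "finite (c ` {z. Im z > 0})"
    by (rule finite_subset[OF _ finite_roots_unity[of 12]]) (auto simp: c12)
  moreover have "connected {z. Im z > 0}"
    by (intro convex_connected convex_halfspace_Im_gt)
  ultimately have "c constant_on {z. Im z > 0}"
    by (intro continuous_finite_range_constant)
  then obtain C where C: "\<And>\<tau>. Im \<tau> > 0 \<Longrightarrow> c \<tau> = C" by (auto simp: constant_on_def)
  show ?thesis
  proof (rule that[of C])
    show "C ^ 12 = 1" using c12[of \<i>] C[of \<i>] by simp
    show "siegel a b (- 1 / \<tau>) = C * siegel b (- a) \<tau>" if "Im \<tau> > 0" for a b \<tau>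
      using c[OF that] C[OF that] by simp
  qed
qed

text \<open>The order 24 N accommodates all multipliers that occur: twelfth roots of unity from
  translation and inversion, and -e(k/(2N)) from shifting the characteristic. The divisibility
  condition excludes integral characteristics, for which the function vanishes identically.\<close>

definition siegel_class :: "nat \<Rightarrow> (complex \<Rightarrow> complex) \<Rightarrow> bool" where
  "siegel_class N f \<longleftrightarrow> (\<exists>\<epsilon> m n. \<epsilon> ^ (24 * N) = 1 \<and> \<not> (int N dvd m \<and> int N dvd n) \<and>
     (\<forall>z. Im z > 0 \<longrightarrow> f z = \<epsilon> * siegel (of_int m / of_nat N) (of_int n / of_nat N) z))"

lemma siegel_classI:
  assumes "\<epsilon> ^ (24 * N) = 1" "\<not> (int N dvd m \<and> int N dvd n)"
    "\<And>z. Im z > 0 \<Longrightarrow> f z = \<epsilon> * siegel (of_int m / of_nat N) (of_int n / of_nat N) z"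
  shows "siegel_class N f"
  using assms unfolding siegel_class_def by blast

lemma siegel_class_S:
  assumes "siegel_class N f"
  shows "siegel_class N (\<lambda>z. f (- 1 / z))"
proof -
  obtain \<epsilon> m n where f: "\<epsilon> ^ (24 * N) = 1" "\<not> (int N dvd m \<and> int N dvd n)"
     "\<And>z. Im z > 0 \<Longrightarrow> f z = \<epsilon> * siegel (of_int m / of_nat N) (of_int n / of_nat N) z"
    using assms unfolding siegel_class_def by blast
  obtain c where c: "c ^ 12 = 1" "\<And>a b \<tau>. Im \<tau> > 0 \<Longrightarrow> siegel a b (- 1 / \<tau>) = c * siegel b (- a) \<tau>"
    using siegel_S by blast
  have "c ^ (24 * N) = (c ^ 12) ^ (2 * N)" by (simp flip: power_mult)
  then have "(\<epsilon> * c) ^ (24 * N) = 1" using c(1) f(1) by (simp add: power_mult_distrib)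
  moreover have "\<not> (int N dvd n \<and> int N dvd - m)" using f(2) by auto
  moreover have "f (- 1 / z) = \<epsilon> * c * siegel (of_int n / of_nat N) (of_int (- m) / of_nat N) z" if "Im z > 0" for z
    using f(3)[OF Im_minus_inverse[OF that]] c(2)[OF that] by simp
  ultimately show ?thesis by (rule siegel_classI)
qed

lemma siegel_class_T:
  assumes "siegel_class N f" and N: "N > 0"
  shows "siegel_class N (\<lambda>z. f (z + 1))" "siegel_class N (\<lambda>z. f (z - 1))"
proof -
  obtain \<epsilon> m n where f: "\<epsilon> ^ (24 * N) = 1" "\<not> (int N dvd m \<and> int N dvd n)"
     "\<And>z. Im z > 0 \<Longrightarrow> f z = \<epsilon> * siegel (of_int m / of_nat N) (of_int n / of_nat N) z"
    using assms unfolding siegel_class_def by blast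
  have "eul (1 / 12) ^ (24 * N) = eul (of_int (2 * int N))" by (simp add: eul_power)
  then have e: "eul (1 / 12) ^ (24 * N) = 1" by (simp only: eul_of_int)
  have "(\<epsilon> * eul (1 / 12)) ^ (24 * N) = 1" using e f(1) by (simp add: power_mult_distrib)
  moreover have "\<not> (int N dvd m \<and> int N dvd m + n)" using f(2) by (auto simp: dvd_add_right_iff)
  moreover have "f (z + 1) = \<epsilon> * eul (1 / 12) * siegel (of_int m / of_nat N) (of_int (m + n) / of_nat N) z" if "Im z > 0" for z
    using f(3)[of "z + 1"] that by (simp add: siegel_T add_divide_distrib)
  ultimately show "siegel_class N (\<lambda>z. f (z + 1))" by (rule siegel_classI)
  have "(\<epsilon> * inverse (eul (1 / 12))) ^ (24 * N) = 1" using e f(1) by (simp add: power_mult_distrib power_inverse)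
  moreover have "\<not> (int N dvd m \<and> int N dvd n - m)" using f(2) by (auto simp: dvd_diff_left_iff)
  moreover have "f (z - 1) = \<epsilon> * inverse (eul (1 / 12)) * siegel (of_int m / of_nat N) (of_int (n - m) / of_nat N) z" if "Im z > 0" for z
    using f(3)[of "z - 1"] that siegel_T[of "of_int m / of_nat N" "of_int (n - m) / of_nat N" "z - 1"]
    by (simp add: diff_divide_distrib)
  ultimately show "siegel_class N (\<lambda>z. f (z - 1))" by (rule siegel_classI)
qed

lemma siegel_class_translate:
  assumes "siegel_class N f" and N: "N > 0"
  shows "siegel_class N (\<lambda>z. f (z + of_int k))"
proof (induction k rule: int_induct[where k = 0])
  case base
  show ?case using assms(1) by simp
next
  case (step1 i)
  from siegel_class_T(1)[OF this(2) N] show ?case by (simp add: add_ac)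
next
  case (step2 i)
  from siegel_class_T(2)[OF this(2) N] show ?case by (simp add: algebra_simps)
qed

section \<open>The action of SL(2,Z) on Siegel functions of level N\<close>

definition moebz :: "int \<Rightarrow> int \<Rightarrow> int \<Rightarrow> int \<Rightarrow> complex \<Rightarrow> complex" where
  "moebz a b c d z = (of_int a * z + of_int b) / (of_int c * z + of_int d)"

lemma moebz_denom_nonzero:
  assumes "a * d - b * c > 0" "Im z > 0"
  shows "of_int c * z + of_int d \<noteq> (0 :: complex)"
proof
  assume 0: "of_int c * z + of_int d = (0 :: complex)"
  from arg_cong[OF this, of Im] assms(2) have "c = 0" by simp
  with 0 have "d = 0" by simp
  with \<open>c = 0\<close> assms(1) show False by simp
qed

lemma Im_moebz:
  assumes "a * d - b * c > 0" "Im z > 0"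
  shows "Im (moebz a b c d z) > 0"
proof -
  have "(norm (of_int c * z + of_int d :: complex))\<^sup>2 > 0"
    using moebz_denom_nonzero[OF assms] by simp
  moreover have "Im (moebz a b c d z) = of_int (a * d - b * c) * Im z / (norm (of_int c * z + of_int d))\<^sup>2"
    unfolding moebz_def Im_complex_div_gt_0 cmod_power2 by (simp add: Im_divide algebra_simps power2_eq_square)
  moreover have "real_of_int (a * d - b * c) * Im z > 0"
    using assms by (intro mult_pos_pos) (simp only: of_int_0_less_iff, simp)
  ultimately show ?thesis by simp
qed

lemma siegel_class_cong:
  assumes "siegel_class N f" "\<And>z. Im z > 0 \<Longrightarrow> g z = f z"
  shows "siegel_class N g"
  using assms unfolding siegel_class_def by (metis (no_types, lifting))

text \<open>Generation of SL(2,Z) by translation and inversion, carried out as the Euclidean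
  algorithm on the lower row; the induction is on the absolute value of c.\<close>

lemma siegel_class_moebz:
  assumes N: "N > 0"
  shows "siegel_class N f \<Longrightarrow> a * d - b * c = 1 \<Longrightarrow> siegel_class N (\<lambda>z. f (moebz a b c d z))"
proof (induction "nat \<bar>c\<bar>" arbitrary: a b c d rule: less_induct)
  case less
  show ?case
  proof (cases "c = 0")
    case True
    then have "a = 1 \<and> d = 1 \<or> a = - 1 \<and> d = - 1" using less.prems(2) by (simp add: zmult_eq_1_iff)
    then have "moebz a b c d z = z + of_int (b * d)" for z
      by (auto simp: moebz_def True)
    then show ?thesis using siegel_class_translate[OF less.prems(1) N, of "b * d"] by simp
  next
    case False
    \<comment> \<open>Division with remainder d = k c + d'. After z -> -1/(z + k) the remaining
      matrix has lower left entry d', smaller than c in absolute value.\<close>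
    define k d' b' where "k = d div c" and "d' = d - k * c" and "b' = b - k * a"
    have d': "nat \<bar>d'\<bar> < nat \<bar>c\<bar>"
      using False abs_mod_less[of c d] by (simp add: d'_def k_def minus_div_mult_eq_mod)
    have det: "b' * (- c) - (- a) * d' = 1"
      using less.prems(2) by (simp add: b'_def d'_def algebra_simps)
    have "siegel_class N (\<lambda>z. f (moebz b' (- a) d' (- c) z))"
      by (rule less.hyps[OF d' less.prems(1) det])
    from siegel_class_translate[OF siegel_class_S[OF this] N, of k]
    have A: "siegel_class N (\<lambda>z. f (moebz b' (- a) d' (- c) (- 1 / (z + of_int k))))" .
    have B: "moebz a b c d z = moebz b' (- a) d' (- c) (- 1 / (z + of_int k))" if "Im z > 0" for z
    proof -
      have nz: "z + of_int k \<noteq> 0" using that by (auto simp: complex_eq_iff)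
      have eqs: "of_int b' * (- 1 / (z + of_int k)) + of_int (- a) = - (of_int a * z + of_int b) / (z + of_int k)"
        "of_int d' * (- 1 / (z + of_int k)) + of_int (- c) = - (of_int c * z + of_int d) / (z + of_int k)"
        using nz by (simp_all add: b'_def d'_def field_simps)
      have "(- u / w) / (- v / w) = u / v" if "w \<noteq> 0" for u v w :: complex
        using that by simp
      from this[OF nz] show ?thesis unfolding moebz_def eqs by (rule sym)
    qed
    show ?thesis by (rule siegel_class_cong[OF A]) (simp only: B)
  qed
qed

text \<open>Leaves only finitely many possibilities for the multiplier and the characteristic, which
  is what makes the orbit finite.\<close>

lemma siegel_class_reduce:
  assumes "siegel_class N f" and N: "N > 0"
  obtains \<epsilon> m n where "\<epsilon> ^ (24 * N) = 1" "0 \<le> m" "m < int N" "0 \<le> n" "n < int N"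
    "\<And>z. Im z > 0 \<Longrightarrow> f z = \<epsilon> * siegel (of_int m / of_nat N) (of_int n / of_nat N) z"
proof -
  \<comment> \<open>Equality up to a root of unity of order dividing 24 N is an equivalence
    relation; the reduction of the characteristic modulo N is a chain of single shifts in
    it.\<close>
  define R where "R x y \<longleftrightarrow> (\<exists>\<epsilon>. \<epsilon> ^ (24 * N) = 1 \<and> (\<forall>z. Im z > 0 \<longrightarrow> x z = \<epsilon> * y z))"
    for x y :: "complex \<Rightarrow> complex"
  have R_refl: "R x x" for x unfolding R_def by (intro exI[of _ 1]) simp
  have R_sym: "R y x" if xy: "R x y" for x y
  proof -
    obtain \<epsilon> where "\<epsilon> ^ (24 * N) = 1" "\<And>z. Im z > 0 \<Longrightarrow> x z = \<epsilon> * y z" using xy by (auto simp: R_def)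
    moreover from this(1) have "\<epsilon> \<noteq> 0" using N by (auto simp: power_0_left)
    ultimately show ?thesis unfolding R_def by (intro exI[of _ "inverse \<epsilon>"]) (simp add: power_inverse)
  qed
  have R_trans: "R x z" if xy: "R x y" "R y z" for x y z
  proof -
    obtain \<epsilon> where "\<epsilon> ^ (24 * N) = 1 \<and> (\<forall>t. Im t > 0 \<longrightarrow> x t = \<epsilon> * y t)"
      using xy(1) unfolding R_def ..
    moreover obtain \<epsilon>' where "\<epsilon>' ^ (24 * N) = 1 \<and> (\<forall>t. Im t > 0 \<longrightarrow> y t = \<epsilon>' * z t)"
      using xy(2) unfolding R_def ..
    ultimately show ?thesis unfolding R_def by (intro exI[of _ "\<epsilon> * \<epsilon>'"]) (simp add: power_mult_distrib)
  qed
  have unit: "(- eul (of_int k / (2 * of_nat N))) ^ (24 * N) = 1" for k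
  proof -
    have "(- eul (of_int k / (2 * of_nat N))) ^ (24 * N) = eul (of_int k / (2 * of_nat N)) ^ (24 * N)"
      by (rule power_minus_even) simp
    also have "\<dots> = eul (of_int (12 * k))" using N by (simp add: eul_power)
    finally show ?thesis by (simp only: eul_of_int)
  qed
  define s where "s m n = siegel (of_int m / of_nat N) (of_int n / of_nat N)" for m n :: int
  have Rm: "R (s (m + int N) n) (s m n)" for m n
  proof -
    have *: "of_int (m + int N) / of_nat N = of_int m / real N + 1" using N by (simp add: field_simps)
    show ?thesis
      unfolding R_def s_def * using unit[of "- n"]
      by (intro exI[of _ "- eul (of_int (- n) / (2 * of_nat N))"]) (simp add: siegel_add_left mult.commute)
  qed
  have Rn: "R (s m (n + int N)) (s m n)" for m n
  proof -
    have *: "of_int (n + int N) / of_nat N = of_int n / real N + 1" using N by (simp add: field_simps)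
    show ?thesis
      unfolding R_def s_def * using unit[of m]
      by (intro exI[of _ "- eul (of_int m / (2 * of_nat N))"]) (simp add: siegel_add_right mult.commute)
  qed
  have Rmk: "R (s (m + k * int N) n) (s m n)" for m n k
  proof (induction k rule: int_induct[where k = 0])
    case (step1 i)
    have eq: "m + (i + 1) * int N = (m + i * int N) + int N" by (simp add: algebra_simps)
    show ?case unfolding eq by (rule R_trans[OF Rm step1(2)])
  next
    case (step2 i)
    have eq: "m + i * int N = (m + (i - 1) * int N) + int N" by (simp add: algebra_simps)
    show ?case by (rule R_trans[OF R_sym[OF Rm] step2(2)[unfolded eq]])
  qed (simp add: R_refl)
  have Rnk: "R (s m (n + k * int N)) (s m n)" for m n k
  proof (induction k rule: int_induct[where k = 0])
    case (step1 i)
    have eq: "n + (i + 1) * int N = (n + i * int N) + int N" by (simp add: algebra_simps)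
    show ?case unfolding eq by (rule R_trans[OF Rn step1(2)])
  next
    case (step2 i)
    have eq: "n + i * int N = (n + (i - 1) * int N) + int N" by (simp add: algebra_simps)
    show ?case by (rule R_trans[OF R_sym[OF Rn] step2(2)[unfolded eq]])
  qed (simp add: R_refl)
  obtain \<epsilon> m n where f: "\<epsilon> ^ (24 * N) = 1"
     "\<And>z. Im z > 0 \<Longrightarrow> f z = \<epsilon> * siegel (of_int m / of_nat N) (of_int n / of_nat N) z"
    using assms unfolding siegel_class_def by blast
  have "R f (s m n)" unfolding R_def s_def using f by (intro exI[of _ \<epsilon>]) simp
  moreover have "R (s m n) (s (m mod int N) n)"
    using Rmk[of "m mod int N" "m div int N" n] by simp
  moreover have "R (s (m mod int N) n) (s (m mod int N) (n mod int N))"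
    using Rnk[of "m mod int N" "n mod int N" "n div int N"] by simp
  ultimately have "R f (s (m mod int N) (n mod int N))"
    using R_trans by blast
  then show ?thesis
    using that[of _ "m mod int N" "n mod int N"] N unfolding R_def s_def by auto
qed

subsection \<open>Functions with finite modular orbit\<close>

lemma meromorphic_at_ii_infI:
  assumes "h > 0" "g meromorphic_on {0}" "\<And>z. Im z > 0 \<Longrightarrow> f z = g (eul (z / of_nat h))"
  shows "meromorphic_at_ii_inf f"
  unfolding meromorphic_at_ii_inf_def upper_half_plane_def
  using assms by (intro exI[of _ h] conjI exI[of _ g]) (auto simp: eul_def)

lemma meromorphic_at_ii_infE:
  assumes "meromorphic_at_ii_inf f"
  obtains h g where "h > 0" "g meromorphic_on {0}" "\<And>z. Im z > 0 \<Longrightarrow> f z = g (eul (z / of_nat h))"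
proof -
  obtain h g where "h > 0" "g meromorphic_on {0}"
    "\<forall>z\<in>upper_half_plane. f z = g (exp (2 * of_real pi * \<i> * z / of_nat h))"
    using assms unfolding meromorphic_at_ii_inf_def by blast
  then show ?thesis
    by (intro that[of h g]) (auto simp: eul_def upper_half_plane_def)
qed

lemma meromorphic_on_power_compose:
  assumes "g meromorphic_on {0}" "k > 0"
  shows "(\<lambda>Q. g (c * Q ^ k)) meromorphic_on {0}"
  by (rule meromorphic_on_compose[OF assms(1)]) (use assms(2) in \<open>auto intro!: analytic_intros\<close>)

lemma meromorphic_at_ii_inf_mult:
  assumes "meromorphic_at_ii_inf f" "meromorphic_at_ii_inf g"
  shows "meromorphic_at_ii_inf (\<lambda>z. f z * g z)"
proof -
  obtain h u where h: "h > 0" "u meromorphic_on {0}" "\<And>z. Im z > 0 \<Longrightarrow> f z = u (eul (z / of_nat h))"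
    using meromorphic_at_ii_infE[OF assms(1)] by blast
  obtain k v where k: "k > 0" "v meromorphic_on {0}" "\<And>z. Im z > 0 \<Longrightarrow> g z = v (eul (z / of_nat k))"
    using meromorphic_at_ii_infE[OF assms(2)] by blast
  show ?thesis
  proof (rule meromorphic_at_ii_infI)
    show "h * k > 0" using h k by simp
    show "(\<lambda>Q. u (1 * Q ^ k) * v (1 * Q ^ h)) meromorphic_on {0}"
      using h k by (intro meromorphic_on_mult meromorphic_on_power_compose)
    show "f z * g z = u (1 * eul (z / of_nat (h * k)) ^ k) * v (1 * eul (z / of_nat (h * k)) ^ h)" if "Im z > 0" for z
      using h(1) k(1) by (simp add: h(3)[OF that] k(3)[OF that] eul_power)
  qed
qed

lemma meromorphic_at_ii_inf_inverse:
  assumes "meromorphic_at_ii_inf f"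
  shows "meromorphic_at_ii_inf (\<lambda>z. inverse (f z))"
proof -
  obtain h u where h: "h > 0" "u meromorphic_on {0}" "\<And>z. Im z > 0 \<Longrightarrow> f z = u (eul (z / of_nat h))"
    using meromorphic_at_ii_infE[OF assms(1)] by blast
  show ?thesis
    by (rule meromorphic_at_ii_infI[OF h(1) meromorphic_on_inverse[OF h(2)]]) (simp add: h(3))
qed

text \<open>For width d h in place of h, the substitution is Q -> c Q^a with a constant c, which
  preserves meromorphy at 0 because a > 0.\<close>

lemma meromorphic_at_ii_inf_affine:
  assumes "meromorphic_at_ii_inf f" "a > 0" "d > 0"
  shows "meromorphic_at_ii_inf (\<lambda>z. f ((of_nat a * z + of_int b) / of_nat d))"
proof -
  obtain h u where h: "h > 0" "u meromorphic_on {0}" "\<And>z. Im z > 0 \<Longrightarrow> f z = u (eul (z / of_nat h))"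
    using meromorphic_at_ii_infE[OF assms(1)] by blast
  let ?c = "eul (of_int b / of_nat (d * h))"
  show ?thesis
  proof (rule meromorphic_at_ii_infI)
    show "d * h > 0" using h assms by simp
    show "(\<lambda>Q. u (?c * Q ^ a)) meromorphic_on {0}"
      using h assms by (intro meromorphic_on_power_compose)
    show "f ((of_nat a * z + of_int b) / of_nat d) = u (?c * eul (z / of_nat (d * h)) ^ a)" if "Im z > 0" for z
    proof -
      have "Im ((of_nat a * z + of_int b) / of_nat d) > 0" using that assms by (simp add: Im_divide_of_nat)
      moreover have "(of_nat a * z + of_int b) / of_nat d / of_nat h =
          of_int b / of_nat (d * h) + of_nat a * (z / of_nat (d * h))"
        by (simp add: add_divide_distrib)
      ultimately show ?thesis by (simp add: h(3) eul_add eul_power)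
    qed
  qed
qed

lemma meromorphic_at_ii_inf_cong:
  assumes "meromorphic_at_ii_inf f" "\<And>z. Im z > 0 \<Longrightarrow> g z = f z"
  shows "meromorphic_at_ii_inf g"
  using assms by (elim meromorphic_at_ii_infE) (rule meromorphic_at_ii_infI, auto)

text \<open>The product expansion becomes a power of Q times a function analytic at Q = 0, once Q =
  e(z/h) has a width h clearing all denominators.\<close>

lemma siegel_class_meromorphic_at_ii_inf:
  assumes "siegel_class N f" "N > 0"
  shows "meromorphic_at_ii_inf f"
proof -
  \<comment> \<open>Reducing the characteristic to 0 \<le> m' < N makes both exponents 12 N m and 12
    N (N - m) of Q nonnegative.\<close>
  obtain \<epsilon> m' n where f: "0 \<le> m'" "m' < int N"
    "\<And>z. Im z > 0 \<Longrightarrow> f z = \<epsilon> * siegel (of_int m' / of_nat N) (of_int n / of_nat N) z"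
    using siegel_class_reduce[OF assms] by metis
  obtain m where m: "m' = int m" "m < N" using f by (metis nonneg_int_cases of_nat_less_iff)
  \<comment> \<open>This width is the denominator of B_2(m/N)/2 = (6 m^2 - 6 m N + N^2) / (12 N^2),
    and \<open>e\<close> below is the numerator. Since \<open>e\<close> may be negative, a pole can
    occur.\<close>
  define h where "h = 12 * N\<^sup>2"
  define e where "e = 6 * int m ^ 2 + int N ^ 2 - 6 * int m * int N"
  define C where "C = eul (of_int m' * of_int n / (2 * of_nat N ^ 2) - of_int n / (2 * of_nat N))"
  define \<zeta> where "\<zeta> = eul (of_int n / of_nat N)"
  define g where "g Q = \<epsilon> * C * Q powi e * qpinf (\<zeta> * Q ^ (12 * N * m)) (Q ^ h) *
    qpinf (inverse \<zeta> * Q ^ (12 * N * (N - m))) (Q ^ h)" for Q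
  have h: "h > 0" using assms(2) by (simp add: h_def)
  have "norm (Q ^ h) < 1" if "norm Q < 1" for Q :: complex
    using that h by (simp add: norm_power power_less_one_iff)
  then have "(\<lambda>Q. qpinf (c * Q ^ k) (Q ^ h)) holomorphic_on ball 0 1" for c k
    by (intro holomorphic_qpinf holomorphic_intros) auto
  then have "(\<lambda>Q. qpinf (c * Q ^ k) (Q ^ h)) analytic_on {0}" for c k
    unfolding analytic_at by (intro exI[of _ "ball 0 1"]) auto
  then have "g meromorphic_on {0}"
    unfolding g_def by (intro meromorphic_intros analytic_on_imp_meromorphic_on) auto
  then show ?thesis
  proof (rule meromorphic_at_ii_infI[OF h])
    fix z :: complex assume z: "Im z > 0"
    let ?Q = "eul (z / of_nat h)"
    have N0: "complex_of_nat N \<noteq> 0" using assms(2) by simp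
    have 1: "?Q ^ (12 * N * m) = eul (of_nat m * z / of_nat N)"
      using N0 by (simp add: eul_power h_def power2_eq_square)
    have 2: "?Q ^ h = eul z" using h by (simp add: eul_power)
    have 3: "?Q ^ (12 * N * (N - m)) = eul (z - of_nat m * z / of_nat N)"
    proof -
      have "of_nat (12 * N * (N - m)) * (z / of_nat h) = z - of_nat m * z / of_nat N"
        using N0 m(2) by (simp add: h_def power2_eq_square of_nat_diff field_simps)
      then show ?thesis by (simp only: eul_power)
    qed
    have w: "of_real (of_int m' / of_nat N) * z + of_real (of_int n / of_nat N) =
       of_nat m * z / of_nat N + of_int n / of_nat N" by (simp add: m)
    have "of_real (of_int m' / of_nat N) * (of_nat m * z / of_nat N + of_int n / of_nat N) / 2 +
       (z / 12 - (of_nat m * z / of_nat N + of_int n / of_nat N) / 2) =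
      of_int m' * of_int n / (2 * of_nat N ^ 2) - of_int n / (2 * of_nat N) + of_int e * (z / of_nat h)"
      using N0 by (simp add: m e_def h_def field_simps power2_eq_square)
    then have 4: "eul (of_real (of_int m' / of_nat N) * (of_nat m * z / of_nat N + of_int n / of_nat N) / 2) *
       eul (z / 12 - (of_nat m * z / of_nat N + of_int n / of_nat N) / 2) = C * ?Q powi e"
      unfolding C_def by (simp only: eul_add[symmetric] eul_power_int)
    have 5: "eul (of_nat m * z / of_nat N + of_int n / of_nat N) = \<zeta> * ?Q ^ (12 * N * m)"
      unfolding 1 \<zeta>_def by (simp add: eul_add)
    have 6: "eul z / eul (of_nat m * z / of_nat N + of_int n / of_nat N) = inverse \<zeta> * ?Q ^ (12 * N * (N - m))"
      unfolding 3 \<zeta>_def by (simp add: eul_add eul_diff divide_inverse mult_ac)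
    have "f z = \<epsilon> * (eul (of_real (of_int m' / of_nat N) * (of_nat m * z / of_nat N + of_int n / of_nat N) / 2) *
       eul (z / 12 - (of_nat m * z / of_nat N + of_int n / of_nat N) / 2)) *
       qpinf (eul (of_nat m * z / of_nat N + of_int n / of_nat N)) (eul z) *
       qpinf (eul z / eul (of_nat m * z / of_nat N + of_int n / of_nat N)) (eul z)"
      unfolding f(3)[OF z] siegel_def theta_eta_def w by (simp only: mult_ac)
    also have "\<dots> = g ?Q" unfolding 6 unfolding 4 5 g_def 2 by (simp only: mult_ac)
    finally show "f z = g ?Q" .
  qed
qed

text \<open>Values off the half-plane are set to 0, so that equality of functions means equality on
  the half-plane and an orbit can be counted as a set of functions.\<close>

definition restrict_uhp :: "(complex \<Rightarrow> complex) \<Rightarrow> complex \<Rightarrow> complex" where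
  "restrict_uhp f z = (if Im z > 0 then f z else 0)"

lemma restrict_uhp_eq_iff: "restrict_uhp f = restrict_uhp g \<longleftrightarrow> (\<forall>z. Im z > 0 \<longrightarrow> f z = g z)"
  by (auto simp: restrict_uhp_def fun_eq_iff)

definition modular_orbit :: "(complex \<Rightarrow> complex) \<Rightarrow> (complex \<Rightarrow> complex) set" where
  "modular_orbit f = {restrict_uhp (\<lambda>z. f (moebz a b c d z)) | a b c d. a * d - b * c = 1}"

text \<open>A form of modularity of weight 0 that refers to no particular group: products, inverses
  and rescalings can be treated without finding a common subgroup for the factors.\<close>

definition finite_orbit_modular :: "(complex \<Rightarrow> complex) \<Rightarrow> bool" where
  "finite_orbit_modular f \<longleftrightarrow> f holomorphic_on {z. Im z > 0} \<and> finite (modular_orbit f) \<and>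
     (\<forall>a b c d. a * d - b * c = 1 \<longrightarrow> meromorphic_at_ii_inf (\<lambda>z. f (moebz a b c d z)))"

lemma finite_orbit_modular_siegel:
  assumes N: "N > 0" "\<not> (int N dvd m \<and> int N dvd n)"
  shows "finite_orbit_modular (siegel (of_int m / of_nat N) (of_int n / of_nat N))"
proof -
  let ?f = "siegel (of_int m / of_nat N) (of_int n / of_nat N)"
  have cls: "siegel_class N ?f" using N(2) by (intro siegel_classI[of 1]) auto
  note cls' = siegel_class_moebz[OF N(1) cls]
  let ?X = "(\<lambda>(\<epsilon>, m, n). restrict_uhp (\<lambda>z. \<epsilon> * siegel (of_int m / of_nat N) (of_int n / of_nat N) z)) `
      ({\<epsilon>. \<epsilon> ^ (24 * N) = 1} \<times> {0..<int N} \<times> {0..<int N})"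
  have "modular_orbit ?f \<subseteq> ?X"
  proof
    fix u assume "u \<in> modular_orbit ?f"
    then obtain a b c d where u: "u = restrict_uhp (\<lambda>z. ?f (moebz a b c d z))" "a * d - b * c = 1"
      unfolding modular_orbit_def by blast
    obtain \<epsilon> k l where "\<epsilon> ^ (24 * N) = 1" "0 \<le> k" "k < int N" "0 \<le> l" "l < int N"
      "\<And>z. Im z > 0 \<Longrightarrow> ?f (moebz a b c d z) = \<epsilon> * siegel (of_int k / of_nat N) (of_int l / of_nat N) z"
      using siegel_class_reduce[OF cls'[OF u(2)] N(1)] by metis
    then show "u \<in> ?X"
      by (intro image_eqI[of _ _ "(\<epsilon>, k, l)"]) (auto simp: u(1) restrict_uhp_eq_iff)
  qed
  moreover have "finite ?X"
    using N(1) finite_roots_unity[of "24 * N"] by (intro finite_imageI finite_cartesian_product) auto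
  ultimately have "finite (modular_orbit ?f)" by (rule finite_subset)
  then show ?thesis
    unfolding finite_orbit_modular_def
    using holomorphic_siegel siegel_class_meromorphic_at_ii_inf[OF cls' N(1)] by blast
qed

lemma finite_orbit_modular_mult:
  assumes "finite_orbit_modular f" "finite_orbit_modular g"
  shows "finite_orbit_modular (\<lambda>z. f z * g z)"
proof -
  have sub: "modular_orbit (\<lambda>z. f z * g z) \<subseteq> (\<lambda>(u, v) z. u z * v z) ` (modular_orbit f \<times> modular_orbit g)"
  proof
    fix w assume "w \<in> modular_orbit (\<lambda>z. f z * g z)"
    then obtain a b c d where w: "w = restrict_uhp (\<lambda>z. f (moebz a b c d z) * g (moebz a b c d z))" "a * d - b * c = 1"
      unfolding modular_orbit_def by blast
    then have "restrict_uhp (\<lambda>z. f (moebz a b c d z)) \<in> modular_orbit f"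
      "restrict_uhp (\<lambda>z. g (moebz a b c d z)) \<in> modular_orbit g"
      unfolding modular_orbit_def by blast+
    moreover have "w = (\<lambda>(u, v) z. u z * v z)
       (restrict_uhp (\<lambda>z. f (moebz a b c d z)), restrict_uhp (\<lambda>z. g (moebz a b c d z)))"
      by (auto simp: w restrict_uhp_def fun_eq_iff)
    ultimately show "w \<in> (\<lambda>(u, v) z. u z * v z) ` (modular_orbit f \<times> modular_orbit g)"
      by blast
  qed
  have "finite (modular_orbit (\<lambda>z. f z * g z))"
    by (rule finite_subset[OF sub]) (use assms in \<open>simp add: finite_orbit_modular_def\<close>)
  then show ?thesis
    using assms unfolding finite_orbit_modular_def
    by (auto intro!: holomorphic_intros meromorphic_at_ii_inf_mult)
qed

lemma finite_orbit_modular_inverse: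
  assumes "finite_orbit_modular f" "\<And>z. Im z > 0 \<Longrightarrow> f z \<noteq> 0"
  shows "finite_orbit_modular (\<lambda>z. inverse (f z))"
proof -
  have sub: "modular_orbit (\<lambda>z. inverse (f z)) \<subseteq> (\<lambda>u z. inverse (u z)) ` modular_orbit f"
  proof
    fix w assume "w \<in> modular_orbit (\<lambda>z. inverse (f z))"
    then obtain a b c d where w: "w = restrict_uhp (\<lambda>z. inverse (f (moebz a b c d z)))" "a * d - b * c = 1"
      unfolding modular_orbit_def by blast
    then have "restrict_uhp (\<lambda>z. f (moebz a b c d z)) \<in> modular_orbit f"
      unfolding modular_orbit_def by blast
    moreover have "w = (\<lambda>z. inverse (restrict_uhp (\<lambda>z. f (moebz a b c d z)) z))"
      by (auto simp: w restrict_uhp_def fun_eq_iff)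
    ultimately show "w \<in> (\<lambda>u z. inverse (u z)) ` modular_orbit f"
      by blast
  qed
  have "finite (modular_orbit (\<lambda>z. inverse (f z)))"
    by (rule finite_subset[OF sub]) (use assms in \<open>simp add: finite_orbit_modular_def\<close>)
  then show ?thesis
    using assms unfolding finite_orbit_modular_def
    by (auto intro!: holomorphic_on_inverse meromorphic_at_ii_inf_inverse)
qed

text \<open>Hermite normal form: an integral matrix of determinant D > 0 is an element of SL(2,Z)
  times an upper triangular matrix, of which there are finitely many. Removing the gcd from the
  first column gives a primitive column, completed by a Bezout relation.\<close>

lemma int_matrix_decomposition:
  fixes x y u v :: int
  assumes "x * v - y * u = D" "D > 0"
  obtains a b c d \<alpha> \<beta> \<delta> where "a * d - b * c = 1" "x = a * \<alpha>" "u = c * \<alpha>" "y = a * \<beta> + b * \<delta>"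
    "v = c * \<beta> + d * \<delta>" "\<alpha> > 0" "\<delta> > 0" "\<alpha> * \<delta> = D" "0 \<le> \<beta>" "\<beta> < \<delta>"
proof -
  define g where "g = gcd x u"
  have g: "g > 0"
  proof -
    have "x \<noteq> 0 \<or> u \<noteq> 0" using assms by auto
    then show ?thesis by (simp add: g_def)
  qed
  obtain s t where st: "s * x + t * u = g" using bezout_int[of x u] by (auto simp: g_def)
  obtain a where a: "x = g * a" using gcd_dvd1[of x u] unfolding g_def[symmetric] by (elim dvdE)
  obtain c where c: "u = g * c" using gcd_dvd2[of x u] unfolding g_def[symmetric] by (elim dvdE)
  have sa: "s * a + t * c = 1"
  proof -
    have "g * (s * a + t * c) = g * 1" using st by (simp add: a c algebra_simps)
    then show ?thesis using g by simp
  qed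
  define \<delta> where "\<delta> = a * v - y * c"
  have D: "g * \<delta> = D" using assms(1) by (simp add: \<delta>_def a c algebra_simps)
  then have \<delta>: "\<delta> > 0" using zero_less_mult_pos[of g \<delta>] g assms(2) by simp
  \<comment> \<open>Subtracting k \<delta> from \<beta>0 is compensated by adding k times the first
    column (a, c) of the unimodular factor to its second one.\<close>
  define \<beta>0 k where "\<beta>0 = s * y + t * v" and "k = \<beta>0 div \<delta>"
  have y: "y = a * \<beta>0 - t * \<delta>"
  proof -
    have "a * \<beta>0 - t * \<delta> = y * (s * a + t * c)" by (simp add: \<beta>0_def \<delta>_def algebra_simps)
    then show ?thesis by (simp add: sa)
  qed
  have v: "v = c * \<beta>0 + s * \<delta>"
  proof -
    have "c * \<beta>0 + s * \<delta> = v * (s * a + t * c)" by (simp add: \<beta>0_def \<delta>_def algebra_simps)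
    then show ?thesis by (simp add: sa)
  qed
  show ?thesis
  proof (rule that[of a "s + k * c" "- t + k * a" c g "\<beta>0 - k * \<delta>" \<delta>])
    show "a * (s + k * c) - (- t + k * a) * c = 1" using sa by (simp add: algebra_simps)
    show "y = a * (\<beta>0 - k * \<delta>) + (- t + k * a) * \<delta>" using y by (simp add: algebra_simps)
    show "v = c * (\<beta>0 - k * \<delta>) + (s + k * c) * \<delta>" using v by (simp add: algebra_simps)
    have "\<beta>0 - k * \<delta> = \<beta>0 mod \<delta>" by (simp add: k_def minus_div_mult_eq_mod)
    then show "0 \<le> \<beta>0 - k * \<delta>" "\<beta>0 - k * \<delta> < \<delta>" using \<delta> by simp_all
  qed (use a c g \<delta> D in \<open>simp_all add: mult.commute\<close>)
qed

lemma linear_fractional_divide: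
  fixes t :: "'a :: field"
  assumes "t \<noteq> 0"
  shows "(x * w + y * t) / (x' * w + y' * t) = (x * (w / t) + y) / (x' * (w / t) + y')"
proof -
  have "(x * (w / t) + y) / (x' * (w / t) + y') = ((x * (w / t) + y) * t) / ((x' * (w / t) + y') * t)"
    using assms by simp
  then show ?thesis using assms by (simp add: distrib_right)
qed

text \<open>For \<gamma> in SL(2,Z) the matrix diag(p, n) \<gamma> has determinant p n, hence equals
  \<gamma>' times an upper triangular matrix from a finite list. The translates of f(p z/n) are thus
  translates of f at finitely many affine arguments.\<close>

lemma finite_orbit_modular_scale:
  assumes f: "finite_orbit_modular f" and p: "p > 0" "n > 0"
  shows "finite_orbit_modular (\<lambda>z. f (of_nat p * z / of_nat n))"
proof -
  have decomp: "\<exists>a' b' c' d' \<alpha> \<beta> \<delta>. a' * d' - b' * c' = 1 \<and> \<alpha> \<in> {1..p * n} \<and> \<delta> \<in> {1..p * n} \<and> \<beta> \<in> {0..int (p * n)} \<and>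
      (\<forall>z. Im z > 0 \<longrightarrow> f (of_nat p * moebz a b c d z / of_nat n) =
         f (moebz a' b' c' d' ((of_nat \<alpha> * z + of_int \<beta>) / of_nat \<delta>)))"
    if det: "a * d - b * c = 1" for a b c d
  proof -
    have "int p * a * (int n * d) - int p * b * (int n * c) = int (p * n)"
    proof -
      have "int p * a * (int n * d) - int p * b * (int n * c) = int p * int n * (a * d - b * c)"
        by (simp add: algebra_simps)
      then show ?thesis by (simp add: det)
    qed
    moreover have "int (p * n) > 0" using p by simp
    ultimately obtain a' b' c' d' \<alpha> \<beta> \<delta> where m: "a' * d' - b' * c' = 1" "int p * a = a' * \<alpha>" "int n * c = c' * \<alpha>"
      "int p * b = a' * \<beta> + b' * \<delta>" "int n * d = c' * \<beta> + d' * \<delta>" "\<alpha> > 0" "\<delta> > 0" "\<alpha> * \<delta> = int (p * n)"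
      "0 \<le> \<beta>" "\<beta> < \<delta>"
      by (rule int_matrix_decomposition)
    have le: "\<alpha> \<le> int (p * n)" "\<delta> \<le> int (p * n)"
      using m(6,7) unfolding m(8)[symmetric] by (simp_all add: mult_le_cancel_left1 mult_le_cancel_right1)
    have eq: "of_nat p * moebz a b c d z / of_nat n = moebz a' b' c' d' ((of_nat (nat \<alpha>) * z + of_int \<beta>) / of_nat (nat \<delta>))"
      if z: "Im z > 0" for z
    proof -
      have "of_nat p * moebz a b c d z / of_nat n =
         (of_int (int p * a) * z + of_int (int p * b)) / (of_int (int n * c) * z + of_int (int n * d))"
        by (simp add: moebz_def distrib_left mult_ac)
      also have "\<dots> = (of_int a' * (of_int \<alpha> * z + of_int \<beta>) + of_int b' * of_int \<delta>) /
         (of_int c' * (of_int \<alpha> * z + of_int \<beta>) + of_int d' * of_int \<delta>)"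
        unfolding m(2-5) by (simp add: algebra_simps)
      also have "\<dots> = moebz a' b' c' d' ((of_int \<alpha> * z + of_int \<beta>) / of_int \<delta>)"
        unfolding moebz_def using m(7) by (intro linear_fractional_divide) simp
      finally show ?thesis using m(6,7) by simp
    qed
    show ?thesis
    proof (intro exI conjI allI impI)
      show "a' * d' - b' * c' = 1" by (rule m(1))
      show "nat \<alpha> \<in> {1..p * n}" "nat \<delta> \<in> {1..p * n}"
        unfolding atLeastAtMost_iff using le m(6,7) by linarith+
      show "\<beta> \<in> {0..int (p * n)}"
        unfolding atLeastAtMost_iff using le m(9,10) by linarith
    qed (simp only: eq)
  qed
  have pos: "Im ((of_nat \<alpha> * z + of_int \<beta>) / of_nat \<delta>) > 0" if "\<alpha> > 0" "\<delta> > 0" "Im z > 0" for \<alpha> \<delta> :: nat and \<beta> z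
    using that by (simp add: Im_divide_of_nat)
  let ?f = "\<lambda>z. f (of_nat p * z / of_nat n)"
  let ?X = "(\<lambda>(u, \<alpha>, \<delta>, \<beta>). restrict_uhp (\<lambda>z. u ((of_nat \<alpha> * z + of_int \<beta>) / of_nat \<delta>))) `
     (modular_orbit f \<times> {1..p * n} \<times> {1..p * n} \<times> {0..int (p * n)})"
  have "modular_orbit ?f \<subseteq> ?X"
  proof
    fix w assume "w \<in> modular_orbit ?f"
    then obtain a b c d where w: "w = restrict_uhp (\<lambda>z. ?f (moebz a b c d z))" and det: "a * d - b * c = 1"
      unfolding modular_orbit_def by blast
    obtain a' b' c' d' \<alpha> \<beta> \<delta> where *: "a' * d' - b' * c' = 1" "\<alpha> \<in> {1..p * n}" "\<delta> \<in> {1..p * n}" "\<beta> \<in> {0..int (p * n)}"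
      "\<forall>z. Im z > 0 \<longrightarrow> ?f (moebz a b c d z) = f (moebz a' b' c' d' ((of_nat \<alpha> * z + of_int \<beta>) / of_nat \<delta>))"
      using decomp[OF det] by (elim exE conjE)
    let ?u = "restrict_uhp (\<lambda>z. f (moebz a' b' c' d' z))"
    have u: "?u \<in> modular_orbit f" using *(1) unfolding modular_orbit_def by blast
    have "w = restrict_uhp (\<lambda>z. ?u ((of_nat \<alpha> * z + of_int \<beta>) / of_nat \<delta>))"
      unfolding w restrict_uhp_eq_iff using *(2,3,5) pos by (simp add: restrict_uhp_def)
    with u *(2-4) show "w \<in> ?X" by (intro image_eqI[of _ _ "(?u, \<alpha>, \<delta>, \<beta>)"]) auto
  qed
  moreover have "finite ?X"
    using f by (intro finite_imageI finite_cartesian_product) (auto simp: finite_orbit_modular_def)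
  ultimately have "finite (modular_orbit ?f)" by (rule finite_subset)
  moreover have "?f holomorphic_on {z. Im z > 0}"
  proof -
    have "(f \<circ> (\<lambda>z. of_nat p * z / of_nat n)) holomorphic_on {z. Im z > 0}"
      using f p pos[of p n _ 0] unfolding finite_orbit_modular_def
      by (intro holomorphic_on_compose_gen[where t = "{z. Im z > 0}"] holomorphic_intros) auto
    then show ?thesis by (simp add: o_def)
  qed
  moreover have "meromorphic_at_ii_inf (\<lambda>z. ?f (moebz a b c d z))" if det: "a * d - b * c = 1" for a b c d
  proof -
    obtain a' b' c' d' \<alpha> \<beta> \<delta> where *: "a' * d' - b' * c' = 1" "\<alpha> \<in> {1..p * n}" "\<delta> \<in> {1..p * n}" "\<beta> \<in> {0..int (p * n)}"
      "\<forall>z. Im z > 0 \<longrightarrow> ?f (moebz a b c d z) = f (moebz a' b' c' d' ((of_nat \<alpha> * z + of_int \<beta>) / of_nat \<delta>))"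
      using decomp[OF det] by (elim exE conjE)
    have "meromorphic_at_ii_inf (\<lambda>z. f (moebz a' b' c' d' z))"
      using f *(1) unfolding finite_orbit_modular_def by blast
    from meromorphic_at_ii_inf_affine[OF this, of \<alpha> \<delta> \<beta>] *(2,3)
    have "meromorphic_at_ii_inf (\<lambda>z. f (moebz a' b' c' d' ((of_nat \<alpha> * z + of_int \<beta>) / of_nat \<delta>)))" by simp
    then show ?thesis by (rule meromorphic_at_ii_inf_cong) (use *(5) in blast)
  qed
  ultimately show ?thesis unfolding finite_orbit_modular_def by blast
qed

lemma finite_orbit_modular_cong:
  assumes "finite_orbit_modular f" "\<And>z. Im z > 0 \<Longrightarrow> g z = f z"
  shows "finite_orbit_modular g"
proof -
  have eq: "g (moebz a b c d z) = f (moebz a b c d z)" if "a * d - b * c = 1" "Im z > 0" for a b c d z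
    using that by (intro assms(2) Im_moebz) auto
  have "modular_orbit g \<subseteq> modular_orbit f"
  proof
    fix w assume "w \<in> modular_orbit g"
    then obtain a b c d where w: "w = restrict_uhp (\<lambda>z. g (moebz a b c d z))" "a * d - b * c = 1"
      unfolding modular_orbit_def by blast
    then have "w = restrict_uhp (\<lambda>z. f (moebz a b c d z))"
      using eq by (simp add: restrict_uhp_eq_iff)
    with w(2) show "w \<in> modular_orbit f" unfolding modular_orbit_def by blast
  qed
  then have "finite (modular_orbit g)"
    using assms(1) unfolding finite_orbit_modular_def by (auto intro: finite_subset)
  moreover have "g holomorphic_on {z. Im z > 0}"
    by (rule holomorphic_transform[of f]) (use assms in \<open>simp_all add: finite_orbit_modular_def\<close>)
  moreover have "meromorphic_at_ii_inf (\<lambda>z. g (moebz a b c d z))" if "a * d - b * c = 1" for a b c d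
  proof (rule meromorphic_at_ii_inf_cong)
    show "meromorphic_at_ii_inf (\<lambda>z. f (moebz a b c d z))"
      using assms(1) that unfolding finite_orbit_modular_def by blast
  qed (rule eq[OF that])
  ultimately show ?thesis unfolding finite_orbit_modular_def by blast
qed

section \<open>From finite orbits to modular functions for subgroups of finite index\<close>

definition moeb :: "int ^ 2 ^ 2 \<Rightarrow> complex \<Rightarrow> complex" where
  "moeb M = moebz (M $ 1 $ 1) (M $ 1 $ 2) (M $ 2 $ 1) (M $ 2 $ 2)"

lemma slash_0: "slash 0 f M z = f (moeb M z)"
  by (simp add: slash_def moeb_def moebz_def)

lemma Im_moeb: "M \<in> carrier SL2Z \<Longrightarrow> Im z > 0 \<Longrightarrow> Im (moeb M z) > 0"
  unfolding moeb_def SL2Z_det_iff by (intro Im_moebz) auto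

lemma moeb_one: "moeb \<one>\<^bsub>SL2Z\<^esub> z = z"
  by (simp add: moeb_def moebz_def SL2Z_def mat_def)

lemma moeb_mult:
  assumes M: "M \<in> carrier SL2Z" "N \<in> carrier SL2Z" and z: "Im z > 0"
  shows "moeb (M \<otimes>\<^bsub>SL2Z\<^esub> N) z = moeb M (moeb N z)"
proof -
  define t where "t = complex_of_int (N $ 2 $ 1) * z + of_int (N $ 2 $ 2)"
  define w where "w = complex_of_int (N $ 1 $ 1) * z + of_int (N $ 1 $ 2)"
  have t: "t \<noteq> 0"
    unfolding t_def using M(2) z unfolding SL2Z_det_iff by (intro moebz_denom_nonzero[where a = "N $ 1 $ 1" and b = "N $ 1 $ 2"]) auto
  note linear_fractional_divide[OF t, symmetric]
  then have "moeb M (moeb N z) =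
    (of_int (M $ 1 $ 1) * w + of_int (M $ 1 $ 2) * t) / (of_int (M $ 2 $ 1) * w + of_int (M $ 2 $ 2) * t)"
    unfolding moeb_def moebz_def t_def[symmetric] w_def[symmetric] .
  also have "\<dots> = moeb (M ** N) z"
    by (simp add: moeb_def moebz_def matrix_matrix_mult_def sum_2 w_def t_def algebra_simps)
  finally show ?thesis by (simp add: SL2Z_def)
qed

text \<open>The group is the stabiliser of f, and its right cosets are separated by the translates
  of f, as in the orbit-stabiliser theorem.\<close>

theorem modular_function_if_finite_orbit:
  assumes "finite_orbit_modular f"
  shows "modular_function f"
proof -
  interpret group SL2Z by (rule group_SL2Z)
  define \<Gamma> where "\<Gamma> = {M \<in> carrier SL2Z. \<forall>z. Im z > 0 \<longrightarrow> f (moeb M z) = f z}"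
  have sub: "subgroup \<Gamma> SL2Z"
  proof
    show "\<Gamma> \<subseteq> carrier SL2Z" by (auto simp: \<Gamma>_def)
    show "\<one>\<^bsub>SL2Z\<^esub> \<in> \<Gamma>" by (simp add: \<Gamma>_def moeb_one)
    show "M \<otimes>\<^bsub>SL2Z\<^esub> N \<in> \<Gamma>" if "M \<in> \<Gamma>" "N \<in> \<Gamma>" for M N
      using that by (auto simp: \<Gamma>_def moeb_mult Im_moeb)
    show "inv\<^bsub>SL2Z\<^esub> M \<in> \<Gamma>" if M: "M \<in> \<Gamma>" for M
    proof -
      have c: "M \<in> carrier SL2Z" using M by (simp add: \<Gamma>_def)
      have "f (moeb (inv\<^bsub>SL2Z\<^esub> M) z) = f z" if z: "Im z > 0" for z
      proof -
        have "f (moeb (inv\<^bsub>SL2Z\<^esub> M) z) = f (moeb M (moeb (inv\<^bsub>SL2Z\<^esub> M) z))"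
          using M Im_moeb[OF inv_closed[OF c] z] by (simp add: \<Gamma>_def)
        also have "\<dots> = f (moeb (M \<otimes>\<^bsub>SL2Z\<^esub> inv\<^bsub>SL2Z\<^esub> M) z)"
          by (simp only: moeb_mult[OF c inv_closed[OF c] z])
        also have "\<dots> = f z" by (simp add: c r_inv moeb_one)
        finally show ?thesis .
      qed
      then show ?thesis using c by (simp add: \<Gamma>_def)
    qed
  qed
  define F where "F M = restrict_uhp (\<lambda>z. f (moeb M z))" for M
  have "F ` carrier SL2Z \<subseteq> modular_orbit f"
  proof (rule image_subsetI)
    fix M assume "M \<in> carrier SL2Z"
    then show "F M \<in> modular_orbit f"
      unfolding modular_orbit_def F_def moeb_def SL2Z_det_iff by blast
  qed
  then have fin: "finite (F ` carrier SL2Z)"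
    using assms unfolding finite_orbit_modular_def by (auto intro: finite_subset)
  have coset: "\<Gamma> #>\<^bsub>SL2Z\<^esub> M = \<Gamma> #>\<^bsub>SL2Z\<^esub> N" if MN: "M \<in> carrier SL2Z" "N \<in> carrier SL2Z" "F M = F N" for M N
  proof -
    have eq: "f (moeb M z) = f (moeb N z)" if "Im z > 0" for z
      using MN(3) that by (simp add: F_def restrict_uhp_eq_iff)
    have "f (moeb (M \<otimes>\<^bsub>SL2Z\<^esub> inv\<^bsub>SL2Z\<^esub> N) z) = f z" if z: "Im z > 0" for z
    proof -
      have "f (moeb (M \<otimes>\<^bsub>SL2Z\<^esub> inv\<^bsub>SL2Z\<^esub> N) z) = f (moeb N (moeb (inv\<^bsub>SL2Z\<^esub> N) z))"
        by (simp only: moeb_mult[OF MN(1) inv_closed[OF MN(2)] z] eq[OF Im_moeb[OF inv_closed[OF MN(2)] z]])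
      also have "\<dots> = f (moeb (N \<otimes>\<^bsub>SL2Z\<^esub> inv\<^bsub>SL2Z\<^esub> N) z)"
        by (simp only: moeb_mult[OF MN(2) inv_closed[OF MN(2)] z])
      also have "\<dots> = f z" by (simp add: MN r_inv moeb_one)
      finally show ?thesis .
    qed
    then have "M \<otimes>\<^bsub>SL2Z\<^esub> inv\<^bsub>SL2Z\<^esub> N \<in> \<Gamma>" using MN by (simp add: \<Gamma>_def)
    moreover have "M = (M \<otimes>\<^bsub>SL2Z\<^esub> inv\<^bsub>SL2Z\<^esub> N) \<otimes>\<^bsub>SL2Z\<^esub> N" using MN by (simp add: m_assoc)
    ultimately have "M \<in> \<Gamma> #>\<^bsub>SL2Z\<^esub> N" unfolding r_coset_def by blast
    then show ?thesis using repr_independence[OF _ MN(2) sub] by simp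
  qed
  \<comment> \<open>Matrices with the same value of \<open>F\<close> lie in the same coset, so
    choosing one matrix for each value already reaches all cosets.\<close>
  have index: "rcosets\<^bsub>SL2Z\<^esub> \<Gamma> \<subseteq> (\<lambda>v. \<Gamma> #>\<^bsub>SL2Z\<^esub> (SOME M. M \<in> carrier SL2Z \<and> F M = v)) ` (F ` carrier SL2Z)"
  proof
    fix S assume "S \<in> rcosets\<^bsub>SL2Z\<^esub> \<Gamma>"
    then obtain M where M: "M \<in> carrier SL2Z" "S = \<Gamma> #>\<^bsub>SL2Z\<^esub> M" by (auto simp: RCOSETS_def)
    let ?N = "SOME N. N \<in> carrier SL2Z \<and> F N = F M"
    have "?N \<in> carrier SL2Z \<and> F ?N = F M" by (rule someI[of _ M]) (use M in auto)
    then have "S = \<Gamma> #>\<^bsub>SL2Z\<^esub> ?N" unfolding M(2) using M(1) by (intro coset) auto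
    then show "S \<in> (\<lambda>v. \<Gamma> #>\<^bsub>SL2Z\<^esub> (SOME M. M \<in> carrier SL2Z \<and> F M = v)) ` (F ` carrier SL2Z)"
      using M(1) by blast
  qed
  have "finite (rcosets\<^bsub>SL2Z\<^esub> \<Gamma>)" by (rule finite_subset[OF index]) (intro finite_imageI fin)
  moreover have "modular_function_of 0 \<Gamma> f"
    unfolding modular_function_of_def
  proof (intro conjI ballI)
    show "f holomorphic_on upper_half_plane"
      using assms by (simp add: finite_orbit_modular_def upper_half_plane_def)
    show "slash 0 f M z = f z" if "M \<in> \<Gamma>" "z \<in> upper_half_plane" for M z
      using that by (simp add: slash_0 \<Gamma>_def upper_half_plane_def)
    show "meromorphic_at_ii_inf (slash 0 f M)" if "M \<in> carrier SL2Z" for M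
    proof -
      have "meromorphic_at_ii_inf (\<lambda>z. f (moeb M z))"
        using assms that unfolding finite_orbit_modular_def moeb_def SL2Z_det_iff by blast
      then show ?thesis by (simp add: slash_0[abs_def])
    qed
  qed
  ultimately show ?thesis using sub unfolding modular_function_def by blast
qed

section \<open>The Nahm sums\<close>

lemma summable_square_qpoch:
  assumes "norm x < 1" "norm s < 1"
  shows "summable (\<lambda>n. x ^ n\<^sup>2 / qpoch s n)"
proof -
  obtain C where C: "C > 0" "\<And>n. norm (1 / qpoch s n) \<le> C"
    using inverse_qpoch_bound[OF assms(2)] by blast
  show ?thesis
  proof (rule summable_comparison_test'[where N = 0])
    show "summable (\<lambda>n. norm x ^ n * C)"
      using assms by (intro summable_mult2 summable_geometric) auto
    show "norm (x ^ n\<^sup>2 / qpoch s n) \<le> norm x ^ n * C" for n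
    proof -
      have "norm x ^ n\<^sup>2 \<le> norm x ^ n"
        using assms power2_nat_le_imp_le[of n "n\<^sup>2"] by (intro power_decreasing) auto
      then have "norm x ^ n\<^sup>2 * norm (1 / qpoch s n) \<le> norm x ^ n * C"
        using C by (intro mult_mono) (auto intro: less_imp_le)
      then show ?thesis by (simp add: norm_divide norm_power)
    qed
  qed
qed

text \<open>In terms of sum and difference of the indices the exponent is C + \<mu> (i+j)^2/2 +
  (i-j)(i-j+1)/4. With s = e(z/2) the last part is s to a triangular number, and the sum along i + j
  = n is \<open>rogers_szego_half_inverse_base\<close>.\<close>

lemma nahm_sum_eq:
  fixes A :: "real ^ 2 ^ 2" and \<mu> :: real
  assumes z: "Im z > 0" and \<mu>: "\<mu> > 0"
    and A: "A = vector [vector [\<mu> + 1 / 2, \<mu> - 1 / 2], vector [\<mu> - 1 / 2, \<mu> + 1 / 2]]"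
  shows "nahm_sum A (vector [1 / 4, - 1 / 4]) C z =
    eul (z * of_real C) * suminf (\<lambda>n. eul (z * of_real (\<mu> / 2)) ^ n\<^sup>2 / qpoch (eul (z / 2)) n)"
proof -
  define x where "x = eul (z * of_real (\<mu> / 2))"
  define s where "s = eul (z / 2)"
  \<comment> \<open>For every integer k, negative ones included, k(k+1) is even and nonnegative, so
    the triangular number is a genuine natural exponent.\<close>
  define T where "T k = nat (k * (k + 1) div 2)" for k :: int
  have T: "2 * int (T k) = k * (k + 1)" for k
  proof -
    have "k * (k + 1) \<ge> 0" by (cases "k \<ge> 0") (auto simp: mult_nonpos_nonpos)
    moreover have "even (k * (k + 1))" by simp
    ultimately show ?thesis by (simp add: T_def pos_imp_zdiv_nonneg_iff)
  qed
  have x: "norm x < 1" and s: "norm s < 1"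
    using z \<mu> by (auto simp: x_def s_def intro!: norm_eul_less_1)
  have s2: "s\<^sup>2 = eul z" by (simp add: s_def eul_power)
  have s2': "norm (s\<^sup>2) < 1" unfolding s2 using z by (rule norm_eul_less_1)
  define f where "f = (\<lambda>(i, j). eul (z * of_real C) *
     (x ^ (i + j)\<^sup>2 * s ^ T (int i - int j) / (qpoch (s\<^sup>2) i * qpoch (s\<^sup>2) j)))"
  define v :: "nat \<times> nat \<Rightarrow> nat ^ 2" where "v = (\<lambda>(i, j). vector [i, j])"
  have v: "v x $ 1 = fst x" "v x $ 2 = snd x" "v (n $ 1, n $ 2) = n" for x n
    by (simp_all add: v_def case_prod_unfold vec_eq_iff forall_2 vector_2)
  have bij: "bij_betw v UNIV UNIV"
    by (rule bij_betw_byWitness[where f' = "\<lambda>n. (n $ 1, n $ 2)"]) (simp_all add: v)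
  have summand: "exp (2 * of_real pi * \<i> * z * of_real (nahm_exponent A (vector [1 / 4, - 1 / 4]) C (v (i, j)))) /
       (\<Prod>k\<in>UNIV. qpoch (exp (2 * of_real pi * \<i> * z)) (v (i, j) $ k)) = f (i, j)" for i j
  proof -
    have "nahm_exponent A (vector [1 / 4, - 1 / 4]) C (v (i, j)) =
       C + of_nat ((i + j)\<^sup>2) * (\<mu> / 2) + (real_of_int (int i - int j) * (int i - int j + 1)) / 4"
    proof -
      define a b where "a = real i" and "b = real j"
      have "nahm_exponent A (vector [1 / 4, - 1 / 4]) C (v (i, j)) =
         (a * ((\<mu> + 1 / 2) * a + (\<mu> - 1 / 2) * b) + b * ((\<mu> - 1 / 2) * a + (\<mu> + 1 / 2) * b)) / 2 +
         (a / 4 - b / 4) + C"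
        by (simp add: nahm_exponent_def A v a_def b_def inner_vec_def sum_2 matrix_vector_mult_def
            vector_2 Let_def)
      also have "\<dots> = C + (a + b)\<^sup>2 * (\<mu> / 2) + ((a - b) * (a - b + 1)) / 4"
      proof -
        have "2 * (a * (p * a + r * b) + b * (r * a + p * b)) = (p + r) * (a + b)\<^sup>2 + (p - r) * (a - b)\<^sup>2" for p r
          by (simp add: power2_eq_square algebra_simps)
        from this[of "\<mu> + 1 / 2" "\<mu> - 1 / 2"]
        have 1: "a * ((\<mu> + 1 / 2) * a + (\<mu> - 1 / 2) * b) + b * ((\<mu> - 1 / 2) * a + (\<mu> + 1 / 2) * b) =
           \<mu> * (a + b)\<^sup>2 + (a - b)\<^sup>2 / 2" by simp
        have 2: "(a - b) * (a - b + 1) = (a - b)\<^sup>2 + (a - b)" by (simp add: power2_eq_square distrib_left)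
        show ?thesis unfolding 1 2 by (simp add: add_divide_distrib diff_divide_distrib mult.commute)
      qed
      finally show ?thesis by (simp add: a_def b_def)
    qed
    also have "real_of_int (int i - int j) * (int i - int j + 1) = of_int (2 * int (T (int i - int j)))"
      unfolding T by simp
    finally have "nahm_exponent A (vector [1 / 4, - 1 / 4]) C (v (i, j)) =
       C + of_nat ((i + j)\<^sup>2) * (\<mu> / 2) + of_nat (T (int i - int j)) * (1 / 2)" by simp
    then have "z * of_real (nahm_exponent A (vector [1 / 4, - 1 / 4]) C (v (i, j))) =
       z * of_real C + of_nat ((i + j)\<^sup>2) * (z * of_real (\<mu> / 2)) + of_nat (T (int i - int j)) * (z / 2)"
      by (simp only: of_real_add of_real_mult of_real_of_nat_eq distrib_left mult.left_commute[of z])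
         simp
    then have "eul (z * of_real (nahm_exponent A (vector [1 / 4, - 1 / 4]) C (v (i, j)))) =
       eul (z * of_real C) * x ^ (i + j)\<^sup>2 * s ^ T (int i - int j)"
      by (simp only: eul_add x_def s_def eul_power)
    moreover have "(\<Prod>k\<in>UNIV. qpoch (exp (2 * of_real pi * \<i> * z)) (v (i, j) $ k)) = qpoch (s\<^sup>2) i * qpoch (s\<^sup>2) j"
      unfolding s2 by (simp add: eul_def v UNIV_2)
    ultimately show ?thesis by (simp add: eul_def f_def mult.assoc)
  qed
  obtain K where K: "K > 0" "\<And>n. norm (1 / qpoch (s\<^sup>2) n) \<le> K"
    using inverse_qpoch_bound[OF s2'] by blast
  \<comment> \<open>The power of s is at most 1 in absolute value and (i+j)^2 \<ge> i + j, so a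
    product of two geometric series in |x| dominates.\<close>
  have bound: "norm (f (i, j)) \<le> norm (eul (z * of_real C)) * (K * K) * (norm x ^ i * norm x ^ j)" for i j
  proof -
    have "norm x ^ (i + j)\<^sup>2 \<le> norm x ^ (i + j)"
      using x power2_nat_le_imp_le[of "i + j" "(i + j)\<^sup>2"] by (intro power_decreasing) auto
    moreover have "norm s ^ T (int i - int j) \<le> 1"
      using s by (intro power_le_one) auto
    ultimately have 1: "norm x ^ (i + j)\<^sup>2 * norm s ^ T (int i - int j) \<le> norm x ^ (i + j) * 1"
      by (intro mult_mono) auto
    have 2: "norm (1 / qpoch (s\<^sup>2) i) * norm (1 / qpoch (s\<^sup>2) j) \<le> K * K"
      using K by (intro mult_mono) (auto intro: less_imp_le)
    have "norm (eul (z * of_real C)) * ((norm x ^ (i + j)\<^sup>2 * norm s ^ T (int i - int j)) *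
         (norm (1 / qpoch (s\<^sup>2) i) * norm (1 / qpoch (s\<^sup>2) j))) \<le>
       norm (eul (z * of_real C)) * ((norm x ^ (i + j) * 1) * (K * K))"
      by (rule mult_left_mono[OF mult_mono[OF 1 2]]) auto
    then show ?thesis by (simp add: f_def norm_mult norm_divide norm_power power_add mult_ac)
  qed
  have "nahm_sum A (vector [1 / 4, - 1 / 4]) C z = infsum f UNIV"
    unfolding nahm_sum_def infsum_reindex_bij_betw[OF bij, symmetric]
    by (rule infsum_cong) (use summand in auto)
  also have "\<dots> = suminf (\<lambda>n. \<Sum>i\<le>n. f (i, n - i))"
    by (rule infsum_antidiagonal(1)[OF norm_ge_zero x bound])
  also have "(\<lambda>n. \<Sum>i\<le>n. f (i, n - i)) = (\<lambda>n. eul (z * of_real C) * (x ^ n\<^sup>2 / qpoch s n))"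
  proof
    fix n
    have "(\<Sum>i\<le>n. f (i, n - i)) = (\<Sum>i\<le>n. eul (z * of_real C) * x ^ n\<^sup>2 *
        (s ^ T (int i - int (n - i)) / (qpoch (s\<^sup>2) i * qpoch (s\<^sup>2) (n - i))))"
      by (rule sum.cong) (auto simp: f_def)
    also have "\<dots> = eul (z * of_real C) * x ^ n\<^sup>2 * (1 / qpoch s n)"
      unfolding sum_distrib_left[symmetric] rogers_szego_half_inverse_base[OF s T] ..
    finally show "(\<Sum>i\<le>n. f (i, n - i)) = eul (z * of_real C) * (x ^ n\<^sup>2 / qpoch s n)" by simp
  qed
  also have "suminf (\<lambda>n. eul (z * of_real C) * (x ^ n\<^sup>2 / qpoch s n)) =
      eul (z * of_real C) * suminf (\<lambda>n. x ^ n\<^sup>2 / qpoch s n)"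
    by (rule suminf_mult[OF summable_square_qpoch[OF x s]])
  finally show ?thesis unfolding x_def s_def .
qed

section \<open>The remaining single series as quotients of Siegel functions\<close>

lemma siegel_fifth:
  "siegel (1 / 5) 0 (5 * w) = eul (w / 60) * (qpinf (eul w) (eul w ^ 5) * qpinf (eul w ^ 4) (eul w ^ 5))"
proof -
  have q: "eul (5 * w) = eul w ^ 5" by (simp add: eul_power)
  have "eul w ^ 5 / eul w = eul w ^ 4" by (simp add: eval_nat_numeral)
  \<comment> \<open>The exponent 1/60 is 5 B_2(1/5)/2, since B_2(1/5) = 1/150.\<close>
  moreover have "eul (w / 10) * eul (5 * w / 12 - w / 2) = eul (w / 60)"
    by (simp add: eul_add[symmetric] field_simps)
  ultimately show ?thesis by (simp add: siegel_def theta_eta_def q mult.assoc[symmetric])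
qed

lemma rogers_ramanujan_siegel:
  assumes "Im w > 0"
  shows "suminf (\<lambda>n. eul w ^ n\<^sup>2 / qpoch (eul w) n) = eul (w / 60) * inverse (siegel (1 / 5) 0 (5 * w))"
proof -
  note rr = rogers_ramanujan[OF norm_eul_less_1[OF assms] eul_nonzero]
  have "suminf (\<lambda>n. eul w ^ n\<^sup>2 / qpoch (eul w) n) * siegel (1 / 5) 0 (5 * w) = eul (w / 60)"
    unfolding siegel_fifth using rr by (simp add: mult.left_commute)
  moreover have "siegel (1 / 5) 0 (5 * w) \<noteq> 0"
  proof
    assume "siegel (1 / 5) 0 (5 * w) = 0"
    with rr show False unfolding siegel_fifth by auto
  qed
  ultimately show ?thesis by (simp add: field_simps)
qed

lemma siegel_quarter:
  assumes "Im w > 0"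
  shows "siegel (1 / 4) 0 (4 * w) = eul (- w / 24) * qpinf (eul w) (eul w ^ 2)"
proof -
  have q: "eul (4 * w) = eul w ^ 4" by (simp add: eul_power)
  have "norm (eul w ^ 2) < 1"
    using norm_eul_less_1[OF assms] by (simp add: norm_power power_less_one_iff)
  from qpinf_dissect[OF this, of 2 "eul w"]
  have "qpinf (eul w) (eul w ^ 2) = qpinf (eul w) (eul w ^ 4) * qpinf (eul w ^ 3) (eul w ^ 4)"
    by (simp add: lessThan_Suc numeral_2_eq_2 mult_ac eval_nat_numeral)
  moreover have "eul w ^ 4 / eul w = eul w ^ 3" by (simp add: eval_nat_numeral)
  \<comment> \<open>The exponent -1/24 is 4 B_2(1/4)/2, since B_2(1/4) = -1/48.\<close>
  moreover have "eul (w / 8) * eul (4 * w / 12 - w / 2) = eul (- w / 24)"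
    by (simp add: eul_add[symmetric] field_simps)
  ultimately show ?thesis by (simp add: siegel_def theta_eta_def q mult.assoc[symmetric])
qed

lemma finite_orbit_modular_siegel_fifth:
  assumes "p > 0" "n > 0"
  shows "finite_orbit_modular (\<lambda>z. inverse (siegel (1 / 5) 0 (of_nat p * z / of_nat n)))"
proof -
  have "finite_orbit_modular (siegel (1 / 5) 0)"
    using finite_orbit_modular_siegel[of 5 1 0] by simp
  moreover have "siegel (1 / 5) 0 z \<noteq> 0" if "Im z > 0" for z
  proof -
    have "(1 / 5 :: real) \<notin> \<int>"
    proof
      assume "(1 / 5 :: real) \<in> \<int>"
      then obtain n :: int where "1 / 5 = real_of_int n" by (auto simp: Ints_def)
      then have "real_of_int (5 * n) = of_int 1" by simp
      then have "5 * n = 1" by (simp only: of_int_eq_iff)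
      then show False by presburger
    qed
    then show ?thesis by (simp add: siegel_eq_0_iff[OF that])
  qed
  ultimately have "finite_orbit_modular (\<lambda>z. inverse (siegel (1 / 5) 0 z))"
    by (rule finite_orbit_modular_inverse)
  from finite_orbit_modular_scale[OF this assms] show ?thesis .
qed

text \<open>Here \<mu> = 1, and the reduced series is the Rogers--Ramanujan sum at w = z/2. Its
  factor e(w/60) = e(z/120) determines C = -1/120.\<close>

lemma modular_nahm_sum_2:
  "modular_function (nahm_sum (vector [vector [3/2, 1/2], vector [1/2, 3/2]] :: real ^ 2 ^ 2) (vector [1 / 4, - 1 / 4]) (- 1 / 120))"
proof (rule modular_function_if_finite_orbit, rule finite_orbit_modular_cong)
  show "finite_orbit_modular (\<lambda>z. inverse (siegel (1 / 5) 0 (of_nat 5 * z / of_nat 2)))"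
    by (rule finite_orbit_modular_siegel_fifth) auto
  show "nahm_sum (vector [vector [3/2, 1/2], vector [1/2, 3/2]] :: real ^ 2 ^ 2) (vector [1 / 4, - 1 / 4]) (- 1 / 120) z =
     inverse (siegel (1 / 5) 0 (of_nat 5 * z / of_nat 2))" if z: "Im z > 0" for z
  proof -
    have "nahm_sum (vector [vector [3/2, 1/2], vector [1/2, 3/2]] :: real ^ 2 ^ 2) (vector [1 / 4, - 1 / 4]) (- 1 / 120) z =
        eul (z * of_real (- 1 / 120)) * suminf (\<lambda>n. eul (z / 2) ^ n\<^sup>2 / qpoch (eul (z / 2)) n)"
      using nahm_sum_eq[OF z, of 1 "vector [vector [3/2, 1/2], vector [1/2, 3/2]]" "- 1 / 120"] by simp
    also have "\<dots> = eul (z * of_real (- 1 / 120)) * eul (z / 2 / 60) * inverse (siegel (1 / 5) 0 (5 * (z / 2)))"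
      using z by (subst rogers_ramanujan_siegel) simp_all
    also have "eul (z * of_real (- 1 / 120)) * eul (z / 2 / 60) = 1"
      by (simp add: eul_add[symmetric])
    finally show ?thesis by simp
  qed
qed

text \<open>Here \<mu> = 1/4, so the series has numerators r^(n^2) with r = e(z/8) while its base is
  e(z/2) = r^4. The constant is C = -(1/480 + 1/96) = -1/80, from the Rogers--Ramanujan factor at
  z/8 and the quarter-characteristic factor at z/4.\<close>

lemma modular_nahm_sum_1:
  "modular_function (nahm_sum (vector [vector [3/4, -1/4], vector [-1/4, 3/4]] :: real ^ 2 ^ 2) (vector [1 / 4, - 1 / 4]) (- 1 / 80))"
proof (rule modular_function_if_finite_orbit, rule finite_orbit_modular_cong)
  show "finite_orbit_modular (\<lambda>z. siegel (1 / 4) 0 z * inverse (siegel (1 / 5) 0 (of_nat 5 * z / of_nat 8)))"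
    using finite_orbit_modular_siegel[of 4 1 0]
    by (intro finite_orbit_modular_mult finite_orbit_modular_siegel_fifth) auto
  show "nahm_sum (vector [vector [3/4, -1/4], vector [-1/4, 3/4]] :: real ^ 2 ^ 2) (vector [1 / 4, - 1 / 4]) (- 1 / 80) z =
     siegel (1 / 4) 0 z * inverse (siegel (1 / 5) 0 (of_nat 5 * z / of_nat 8))" if z: "Im z > 0" for z
  proof -
    define r where "r = eul (z / 8)"
    have r: "norm r < 1" unfolding r_def using z by (intro norm_eul_less_1) simp
    have r2: "norm (r\<^sup>2) < 1" using r by (simp add: norm_power power_less_one_iff)
    have rp: "r\<^sup>2 = eul (z / 4)" "eul (z / 2) = r ^ 4" by (simp_all add: r_def eul_power)
    have "nahm_sum (vector [vector [3/4, -1/4], vector [-1/4, 3/4]] :: real ^ 2 ^ 2) (vector [1 / 4, - 1 / 4]) (- 1 / 80) z =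
        eul (z * of_real (- 1 / 80)) * suminf (\<lambda>n. r ^ n\<^sup>2 / qpoch (r ^ 4) n)"
      using nahm_sum_eq[OF z, of "1 / 4" "vector [vector [3/4, -1/4], vector [-1/4, 3/4]]" "- 1 / 80"]
      by (simp add: r_def[symmetric] rp(2))
    \<comment> \<open>By Euler's identity (r^2; r^4)_\<infinity> is the inverse of (-r^2;
      r^2)_\<infinity>, so \<open>slater_20\<close> can be solved for its left-hand series.\<close>
    also have "suminf (\<lambda>n. r ^ n\<^sup>2 / qpoch (r ^ 4) n) =
        suminf (\<lambda>n. r ^ n\<^sup>2 / qpoch r n) * qpinf (r\<^sup>2) ((r\<^sup>2)\<^sup>2)"
      unfolding slater_20[OF r, symmetric] using qpinf_neg_mult_odd[OF r2] by (simp add: mult.assoc)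
    also have "suminf (\<lambda>n. r ^ n\<^sup>2 / qpoch r n) = eul (z / 480) * inverse (siegel (1 / 5) 0 (5 * z / 8))"
      using rogers_ramanujan_siegel[of "z / 8"] z by (simp add: r_def)
    also have "qpinf (r\<^sup>2) ((r\<^sup>2)\<^sup>2) = eul (z / 96) * siegel (1 / 4) 0 z"
    proof -
      have "siegel (1 / 4) 0 z = eul (- (z / 96)) * qpinf (r\<^sup>2) ((r\<^sup>2)\<^sup>2)"
        using siegel_quarter[of "z / 4"] z by (simp add: rp(1))
      then show ?thesis by (simp add: eul_minus)
    qed
    also have "eul (z * of_real (- 1 / 80)) * (eul (z / 480) * inverse (siegel (1 / 5) 0 (5 * z / 8)) *
         (eul (z / 96) * siegel (1 / 4) 0 z)) =
       (eul (z * of_real (- 1 / 80)) * eul (z / 480) * eul (z / 96)) * (siegel (1 / 4) 0 z * inverse (siegel (1 / 5) 0 (5 * z / 8)))"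
      by (simp only: mult_ac)
    also have "eul (z * of_real (- 1 / 80)) * eul (z / 480) * eul (z / 96) = 1"
      by (simp add: eul_add[symmetric])
    finally show ?thesis by simp
  qed
qed

section \<open>The Bloch--Wigner function\<close>

text \<open>The term for \<open>n = 0\<close> vanishes because of \<open>1 / 0 = 0\<close>.\<close>

definition dilog_series :: "complex \<Rightarrow> complex" where
  "dilog_series u = suminf (\<lambda>n. u ^ n / of_nat n ^ 2)"

text \<open>The series \<Sum> 1/n^2 dominates on the whole closed disc, so continuity includes the
  unit circle, where the values of interest lie.\<close>

lemma continuous_on_dilog_series: "continuous_on (cball 0 1) dilog_series"
proof -
  have "uniform_limit (cball 0 1) (\<lambda>N u. \<Sum>n<N. u ^ n / of_nat n ^ 2) dilog_series sequentially"
    unfolding dilog_series_def[abs_def]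
  proof (rule Weierstrass_m_test)
    show "norm (u ^ n / complex_of_nat n ^ 2) \<le> 1 / real n ^ 2" if "u \<in> cball 0 1" for n u
      using that by (auto simp: norm_divide norm_power power_le_one intro!: divide_right_mono)
    show "summable (\<lambda>n. 1 / real n ^ 2)"
      using inverse_power_summable[of 2, where ?'a = real] by (simp add: inverse_eq_divide)
  qed
  then show ?thesis
    by (rule uniform_limit_theorem[rotated])
       (auto simp: divide_inverse intro!: always_eventually continuous_intros)
qed

lemma dilog_series_has_field_derivative:
  assumes "norm u < 1" "u \<noteq> 0"
  shows "(dilog_series has_field_derivative - ln (1 - u) / u) (at u)"
proof -
  define c :: "nat \<Rightarrow> complex" where "c n = 1 / of_nat n ^ 2" for n
  obtain K :: real where K: "norm u < K" "K < 1" using dense assms(1) by blast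
  have "summable (\<lambda>n. c n * of_real K ^ n)"
  proof (rule summable_comparison_test'[where N = 0])
    have "0 \<le> K" using K(1) norm_ge_zero[of u] by linarith
    then show "summable (\<lambda>n. K ^ n)" using K(2) by (intro summable_geometric) simp
    show "norm (c n * of_real K ^ n) \<le> K ^ n" for n
    proof -
      have "1 / real n ^ 2 \<le> 1" by (cases "n = 0") (auto simp: divide_le_eq_1)
      moreover have "K \<ge> 0" using K norm_ge_zero[of u] by linarith
      ultimately have "1 / real n ^ 2 * K ^ n \<le> 1 * K ^ n" by (intro mult_right_mono) auto
      then show ?thesis using \<open>K \<ge> 0\<close> by (simp add: c_def norm_mult norm_divide norm_power)
    qed
  qed
  moreover have "norm u < norm (complex_of_real K)" using K norm_ge_zero[of u] by simp
  ultimately have "((\<lambda>x. suminf (\<lambda>n. c n * x ^ n)) has_field_derivative suminf (\<lambda>n. diffs c n * u ^ n)) (at u)"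
    by (rule termdiffs_strong)
  moreover have "(\<lambda>x. suminf (\<lambda>n. c n * x ^ n)) = dilog_series"
    by (simp add: dilog_series_def[abs_def] c_def)
  moreover have "suminf (\<lambda>n. diffs c n * u ^ n) = - ln (1 - u) / u"
  proof -
    have "(\<lambda>n. - (u ^ n) / of_nat n) sums ln (1 - u)"
      using Ln_series'[of "- u"] assms by simp
    then have "(\<lambda>n. - (u ^ Suc n) / of_nat (Suc n)) sums ln (1 - u)"
      unfolding sums_Suc_iff[of "\<lambda>n. - (u ^ n) / of_nat n"] by simp
    from sums_divide[OF sums_minus[OF this], of u]
    have "(\<lambda>n. diffs c n * u ^ n) sums (- ln (1 - u) / u)"
      using assms(2) by (simp add: diffs_def c_def power2_eq_square field_simps del: of_nat_Suc)
    then show ?thesis by (simp add: sums_iff)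
  qed
  ultimately show ?thesis by simp
qed

text \<open>On the unit circle this is Clausen's function, the value at cis \<theta> being \<Sum>
  sin(n \<theta>) / n^2.\<close>

definition clausen :: "complex \<Rightarrow> real" where
  "clausen u = Im (dilog_series u)"

lemma continuous_on_clausen: "continuous_on (cball 0 1) clausen"
  unfolding clausen_def[abs_def] by (intro continuous_intros continuous_on_dilog_series)

lemma clausen_cnj:
  assumes "norm u \<le> 1"
  shows "clausen (cnj u) = - clausen u"
proof -
  have "summable (\<lambda>n. u ^ n / of_nat n ^ 2)"
  proof (rule summable_comparison_test'[where N = 0])
    show "summable (\<lambda>n. 1 / real n ^ 2)"
      using inverse_power_summable[of 2, where ?'a = real] by (simp add: inverse_eq_divide)
    show "norm (u ^ n / of_nat n ^ 2) \<le> 1 / real n ^ 2" for n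
      using assms by (auto simp: norm_divide norm_power power_le_one intro!: divide_right_mono)
  qed
  from sums_cnj[THEN iffD2, OF summable_sums[OF this]]
  have "dilog_series (cnj u) = cnj (dilog_series u)"
    by (simp add: dilog_series_def sums_iff)
  then show ?thesis by (simp add: clausen_def)
qed

text \<open>On the circle itself the differentiated series is not absolutely convergent. The
  derivative is therefore computed on circles of radius r_n < 1 and carried to the boundary by
  uniform convergence of the derivatives near \<theta>.\<close>

lemma clausen_cis_has_real_derivative:
  assumes "cis \<theta> \<noteq> 1"
  shows "((\<lambda>t. clausen (cis t)) has_real_derivative - ln (norm (1 - cis \<theta>))) (at \<theta>)"
proof -
  have "continuous_on UNIV (\<lambda>t::real. cis t)" by (intro continuous_intros)
  then have "isCont cis \<theta>" by (simp add: continuous_on_eq_continuous_at)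
  from continuous_at_avoid[OF this assms] obtain \<epsilon> where \<epsilon>: "\<epsilon> > 0" "\<And>t. dist \<theta> t < \<epsilon> \<Longrightarrow> cis t \<noteq> 1"
    by blast
  define I where "I = {\<theta> - \<epsilon> / 2..\<theta> + \<epsilon> / 2}"
  have I: "cis t \<noteq> 1" if "t \<in> I" for t
    using that \<epsilon> by (intro \<epsilon>(2)) (auto simp: I_def dist_real_def)
  \<comment> \<open>With n + 2 all radii lie strictly between 0 and 1, including the one for n = 0;
    the derivative formula of the dilogarithm divides by u.\<close>
  define r where "r n = 1 - 1 / real (n + 2)" for n
  have r: "0 < r n" "r n < 1" for n by (auto simp: r_def field_simps)
  have r1: "r \<longlonglongrightarrow> 1"
  proof -
    have "(\<lambda>n. 1 - 1 / real (n + 2)) \<longlonglongrightarrow> 1 - 0"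
      by (intro tendsto_diff tendsto_const LIMSEQ_ignore_initial_segment[OF lim_1_over_n])
    then show ?thesis by (simp add: r_def[abs_def])
  qed
  define \<psi> where "\<psi> s t = - ln (norm (1 - complex_of_real s * cis t))" for s t
  have der: "((\<lambda>t. clausen (of_real (r n) * cis t)) has_real_derivative \<psi> (r n) t) (at t)" for n t
  proof -
    define u where "u = of_real (r n) * exp (\<i> * of_real t)"
    have u: "norm u < 1" "u \<noteq> 0" using r[of n] by (simp_all add: u_def norm_mult)
    have "((\<lambda>w. dilog_series (of_real (r n) * exp (\<i> * w))) has_field_derivative
        (- ln (1 - u) / u) * (of_real (r n) * (exp (\<i> * of_real t) * \<i>))) (at (of_real t))"
      by (rule DERIV_chain2[where f = dilog_series and g = "\<lambda>w. of_real (r n) * exp (\<i> * w)"])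
         (use dilog_series_has_field_derivative[OF u] in \<open>auto intro!: derivative_eq_intros simp: u_def\<close>)
    moreover have "(- ln (1 - u) / u) * (of_real (r n) * (exp (\<i> * of_real t) * \<i>)) = - \<i> * ln (1 - u)"
    proof -
      have eq: "of_real (r n) * (exp (\<i> * of_real t) * \<i>) = u * \<i>" by (simp add: u_def)
      show ?thesis unfolding eq using u(2) by simp
    qed
    ultimately have "((\<lambda>w. dilog_series (of_real (r n) * exp (\<i> * w))) has_field_derivative - \<i> * ln (1 - u)) (at (of_real t))"
      by simp
    from bounded_linear.has_vector_derivative[OF bounded_linear_Im has_vector_derivative_real_field[OF this]]
    have "((\<lambda>s. clausen (of_real (r n) * cis s)) has_vector_derivative Im (- \<i> * ln (1 - u))) (at t)"
      by (simp add: clausen_def cis_conv_exp)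
    moreover have "Im (- \<i> * ln (1 - u)) = \<psi> (r n) t"
    proof -
      have "1 - u \<noteq> 0" using u(1) by auto
      then show ?thesis by (simp add: \<psi>_def u_def cis_conv_exp)
    qed
    ultimately show ?thesis by (simp add: has_real_derivative_iff_has_vector_derivative)
  qed
  have \<theta>: "\<theta> \<in> I" using \<epsilon> by (simp add: I_def)
  have nz: "1 - complex_of_real s * cis t \<noteq> 0" if "s \<in> {0..1}" "t \<in> I" for s t
  proof
    assume 0: "1 - complex_of_real s * cis t = 0"
    then have "norm (complex_of_real s * cis t) = 1" by simp
    then have "s = 1" using that by (simp add: norm_mult)
    with 0 I[OF that(2)] show False by simp
  qed
  \<comment> \<open>Uniform continuity in radius and angle jointly gives convergence of the
    derivatives uniform in the angle; \<open>I\<close> was chosen to avoid the logarithmic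
    singularity at cis t = 1.\<close>
  have "continuous_on ({0..1} \<times> I) (\<lambda>(s, t). \<psi> s t)"
    unfolding \<psi>_def case_prod_unfold using nz by (intro continuous_intros) auto
  moreover have "compact ({0..1::real} \<times> I)" unfolding I_def by (intro compact_Times compact_Icc)
  ultimately have uc: "uniformly_continuous_on ({0..1} \<times> I) (\<lambda>(s, t). \<psi> s t)"
    by (rule compact_uniformly_continuous)
  have "\<exists>g. \<forall>t\<in>I. (\<lambda>n. clausen (of_real (r n) * cis t)) \<longlonglongrightarrow> g t \<and>
      (g has_derivative (\<lambda>h. h * \<psi> 1 t)) (at t within I)"
  proof (rule has_derivative_sequence[where f' = "\<lambda>n t h. h * \<psi> (r n) t"])
    show "convex I" by (simp add: I_def)
    show "((\<lambda>t. clausen (of_real (r n) * cis t)) has_derivative (\<lambda>h. h * \<psi> (r n) t)) (at t within I)" for n t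
      using der[of n t] by (auto simp: has_field_derivative_def mult.commute[of _ "\<psi> (r n) t"] intro: has_derivative_at_withinI)
    show "\<theta> \<in> I" by (rule \<theta>)
    show lim: "(\<lambda>n. clausen (of_real (r n) * cis \<theta>)) \<longlonglongrightarrow> clausen (cis \<theta>)"
    proof (rule continuous_on_tendsto_compose[OF continuous_on_clausen])
      have "(\<lambda>n. of_real (r n) * cis \<theta>) \<longlonglongrightarrow> of_real 1 * cis \<theta>" by (intro tendsto_intros r1)
      then show "(\<lambda>n. of_real (r n) * cis \<theta>) \<longlonglongrightarrow> cis \<theta>" by simp
      show "eventually (\<lambda>n. of_real (r n) * cis \<theta> \<in> cball 0 1) sequentially"
        using r by (intro always_eventually) (auto simp: norm_mult less_imp_le)
    qed simp
    fix e :: real assume "e > 0"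
    from uniformly_continuous_onE[OF uc this] obtain d where d: "d > 0"
      "\<And>x x'. x \<in> {0..1} \<times> I \<Longrightarrow> x' \<in> {0..1} \<times> I \<Longrightarrow> dist x' x < d \<Longrightarrow>
         dist (case x' of (s, t) \<Rightarrow> \<psi> s t) (case x of (s, t) \<Rightarrow> \<psi> s t) < e" by blast
    have "eventually (\<lambda>n. dist (r n) 1 < d) sequentially" using r1 d(1) by (rule tendstoD)
    then show "\<forall>\<^sub>F n in sequentially. \<forall>t\<in>I. \<forall>h. norm (h * \<psi> (r n) t - h * \<psi> 1 t) \<le> e * norm h"
    proof eventually_elim
      case (elim n)
      show ?case
      proof (intro ballI allI)
        fix t h assume t: "t \<in> I"
        have "dist (\<psi> (r n) t) (\<psi> 1 t) < e"
          using d(2)[of "(1, t)" "(r n, t)"] t elim r[of n] by (simp add: dist_Pair_Pair less_imp_le)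
        then have "\<bar>\<psi> (r n) t - \<psi> 1 t\<bar> \<le> e" by (simp add: dist_real_def)
        then have "\<bar>h\<bar> * \<bar>\<psi> (r n) t - \<psi> 1 t\<bar> \<le> \<bar>h\<bar> * e" by (intro mult_left_mono) auto
        then show "norm (h * \<psi> (r n) t - h * \<psi> 1 t) \<le> e * norm h"
          by (simp add: right_diff_distrib[symmetric] abs_mult mult.commute)
      qed
    qed
  qed
  then obtain g where g: "\<And>t. t \<in> I \<Longrightarrow> (\<lambda>n. clausen (of_real (r n) * cis t)) \<longlonglongrightarrow> g t"
    "\<And>t. t \<in> I \<Longrightarrow> (g has_derivative (\<lambda>h. h * \<psi> 1 t)) (at t within I)" by blast
  have g_eq: "g t = clausen (cis t)" if "t \<in> I" for t
  proof (rule LIMSEQ_unique[OF g(1)[OF that]])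
    show "(\<lambda>n. clausen (of_real (r n) * cis t)) \<longlonglongrightarrow> clausen (cis t)"
    proof (rule continuous_on_tendsto_compose[OF continuous_on_clausen])
      have "(\<lambda>n. of_real (r n) * cis t) \<longlonglongrightarrow> of_real 1 * cis t" by (intro tendsto_intros r1)
      then show "(\<lambda>n. of_real (r n) * cis t) \<longlonglongrightarrow> cis t" by simp
      show "eventually (\<lambda>n. of_real (r n) * cis t \<in> cball 0 1) sequentially"
        using r by (intro always_eventually) (auto simp: norm_mult less_imp_le)
    qed simp
  qed
  have "\<theta> \<in> interior I" using \<epsilon> by (simp add: I_def)
  then have "at \<theta> within I = at \<theta>" by (rule at_within_interior)
  then have "(g has_derivative (\<lambda>h. h * \<psi> 1 \<theta>)) (at \<theta>)" using g(2)[OF \<theta>] by simp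
  then have "(g has_real_derivative \<psi> 1 \<theta>) (at \<theta>)"
  proof -
    have "(\<lambda>h. h * \<psi> 1 \<theta>) = (*) (\<psi> 1 \<theta>)" by (simp add: fun_eq_iff)
    with \<open>(g has_derivative (\<lambda>h. h * \<psi> 1 \<theta>)) (at \<theta>)\<close> show ?thesis
      by (simp add: has_field_derivative_def)
  qed
  moreover have "eventually (\<lambda>t. g t = clausen (cis t)) (nhds \<theta>)"
  proof -
    have "eventually (\<lambda>t. t \<in> interior I) (nhds \<theta>)"
      using \<open>\<theta> \<in> interior I\<close> by (intro eventually_nhds_in_open) auto
    then show ?thesis by eventually_elim (use g_eq interior_subset in blast)
  qed
  ultimately show ?thesis
    by (subst (asm) DERIV_cong_ev[OF refl _ refl]) (auto simp: \<psi>_def)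
qed

text \<open>\<open>clausen_arg w\<close> is twice Lobachevsky's function at \<open>arg w\<close>; the Bloch--Wigner function is the volume of
  the ideal tetrahedron with angles \<open>arg z\<close>, \<open>arg (1 - 1/z)\<close>, \<open>arg (1/(1 - z))\<close>.\<close>

definition clausen_arg :: "complex \<Rightarrow> real" where
  "clausen_arg w = clausen (w / cnj w)"

definition bloch_wigner :: "complex \<Rightarrow> real" where
  "bloch_wigner z = (clausen_arg z + clausen_arg ((z - 1) / z) - clausen_arg (1 - z)) / 2"

lemma clausen_arg_cnj: "clausen_arg (cnj w) = - clausen_arg w"
  using clausen_cnj[of "w / cnj w"] by (simp add: clausen_arg_def norm_divide)

lemma clausen_arg_inverse: "clausen_arg (1 / w) = - clausen_arg w"
  using clausen_arg_cnj[of w] by (simp add: clausen_arg_def)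

lemma clausen_arg_minus: "clausen_arg (- w) = clausen_arg w"
  by (simp add: clausen_arg_def)

lemma bloch_wigner_one_minus: "bloch_wigner (1 - z) = - bloch_wigner z"
proof -
  have "clausen_arg ((1 - z - 1) / (1 - z)) = - clausen_arg ((z - 1) / z)"
    using clausen_arg_inverse[of "(z - 1) / z"] clausen_arg_minus[of "z / (1 - z)"]
    by (simp add: divide_simps flip: minus_divide_left) (metis minus_diff_eq minus_divide_right)
  then show ?thesis by (simp add: bloch_wigner_def)
qed

lemma bloch_wigner_inverse:
  assumes "z \<noteq> 0"
  shows "bloch_wigner (1 / z) = - bloch_wigner z"
proof -
  have "(1 / z - 1) / (1 / z) = 1 - z" "1 - 1 / z = (z - 1) / z"
    using assms by (simp_all add: field_simps)
  then show ?thesis by (simp add: bloch_wigner_def clausen_arg_inverse)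
qed

lemma continuous_on_clausen_arg: "continuous_on (- {0}) clausen_arg"
proof -
  have "continuous_on (- {0}) (\<lambda>w. clausen (w / cnj w))"
    by (rule continuous_on_compose2[OF continuous_on_clausen]) (auto intro!: continuous_intros simp: norm_divide split: if_splits)
  then show ?thesis by (simp add: clausen_arg_def[abs_def])
qed

lemma continuous_on_bloch_wigner: "continuous_on (- {0, 1}) bloch_wigner"
  unfolding bloch_wigner_def[abs_def]
  by (intro continuous_intros continuous_on_compose2[OF continuous_on_clausen_arg]) auto

lemma tendsto_bloch_wigner:
  assumes "(f \<longlongrightarrow> z) F" "z \<noteq> 0" "z \<noteq> 1"
  shows "((\<lambda>x. bloch_wigner (f x)) \<longlongrightarrow> bloch_wigner z) F"
proof -
  have "isCont bloch_wigner z"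
    using continuous_on_bloch_wigner assms by (simp add: continuous_on_eq_continuous_at open_Compl)
  then show ?thesis by (rule isCont_tendsto_compose[OF _ assms(1)])
qed

text \<open>As z tends to 0 its argument need not converge, but the arguments of z and (1 - z)/z
  become opposite. Uniform continuity of Clausen's function on the circle makes these two terms
  cancel in the limit, and the third tends to 0.\<close>

lemma bloch_wigner_tendsto_0:
  assumes f: "(f \<longlongrightarrow> 0) F" and nz: "eventually (\<lambda>x. f x \<noteq> 0) F"
  shows "((\<lambda>x. bloch_wigner (f x)) \<longlongrightarrow> 0) F"
proof -
  have "compact (sphere 0 1 :: complex set)" by simp
  moreover have "continuous_on (sphere 0 1) clausen"
    by (rule continuous_on_subset[OF continuous_on_clausen]) auto
  ultimately have uc: "uniformly_continuous_on (sphere 0 1) clausen"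
    by (intro compact_uniformly_continuous)
  define c where "c z = (1 - z) / cnj (1 - z)" for z
  have c: "((\<lambda>x. c (f x)) \<longlongrightarrow> c 0) F"
    unfolding c_def by (intro tendsto_intros f) auto
  have f1: "eventually (\<lambda>x. f x \<noteq> 1) F"
    using f by (rule tendsto_imp_eventually_ne) simp
  have lim1: "((\<lambda>x. clausen_arg (1 - f x)) \<longlongrightarrow> 0) F"
  proof -
    have "((\<lambda>x. clausen_arg (1 - f x)) \<longlongrightarrow> clausen_arg (1 - 0)) F"
    proof (rule continuous_on_tendsto_compose[OF continuous_on_clausen_arg])
      show "((\<lambda>x. 1 - f x) \<longlongrightarrow> 1 - 0) F" by (intro tendsto_intros f)
      show "eventually (\<lambda>x. 1 - f x \<in> - {0}) F" using f1 by eventually_elim auto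
    qed simp
    moreover have "clausen_arg 1 = 0" using clausen_arg_cnj[of 1] by simp
    ultimately show ?thesis by simp
  qed
  have lim2: "((\<lambda>x. clausen_arg (f x) + clausen_arg ((f x - 1) / f x)) \<longlongrightarrow> 0) F"
  proof (rule tendstoI)
    fix e :: real assume "e > 0"
    from uniformly_continuous_onE[OF uc this] obtain d where d: "d > 0"
      "\<And>u u'. u \<in> sphere 0 1 \<Longrightarrow> u' \<in> sphere 0 1 \<Longrightarrow> dist u' u < d \<Longrightarrow> dist (clausen u') (clausen u) < e" by blast
    have "eventually (\<lambda>x. dist (c (f x)) (c 0) < d) F" using c d(1) by (rule tendstoD)
    with nz f1 show "eventually (\<lambda>x. dist (clausen_arg (f x) + clausen_arg ((f x - 1) / f x)) 0 < e) F"
    proof eventually_elim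
      case (elim x)
      define v where "v = cnj (f x) / f x"
      have v: "norm v = 1" using elim by (simp add: v_def norm_divide)
      have c1: "norm (c (f x)) = 1" using elim by (simp add: c_def norm_divide del: complex_cnj_diff)
      have "clausen_arg (f x) = - clausen v"
        using clausen_arg_cnj[of "f x"] by (simp add: clausen_arg_def v_def)
      moreover have "clausen_arg ((f x - 1) / f x) = clausen (c (f x) * v)"
      proof -
        have "clausen_arg ((f x - 1) / f x) = clausen_arg (- ((f x - 1) / f x))" by (simp only: clausen_arg_minus)
        also have "- ((f x - 1) / f x) = (1 - f x) / f x" by (simp add: minus_divide_left)
        finally show ?thesis by (simp add: clausen_arg_def c_def v_def mult.commute)
      qed
      moreover have "dist (c (f x) * v) v < d"
      proof -
        have "c (f x) * v - v = (c (f x) - c 0) * v" by (simp add: c_def algebra_simps)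
        then show ?thesis using elim(3) v by (simp add: dist_norm norm_mult)
      qed
      ultimately show ?case
        using d(2)[of v "c (f x) * v"] v c1 by (simp add: dist_real_def norm_mult)
    qed
  qed
  have "((\<lambda>x. (clausen_arg (f x) + clausen_arg ((f x - 1) / f x) - clausen_arg (1 - f x)) / 2) \<longlongrightarrow> (0 - 0) / 2) F"
    by (intro tendsto_intros lim1 lim2) auto
  then show ?thesis by (simp add: bloch_wigner_def)
qed

text \<open>The chain rule for Clausen's function at 2 arg w; the logarithm contains |1 - w / cnj w|
  = 2 |Im w| / |w|.\<close>

lemma clausen_arg_has_real_derivative:
  assumes w: "(w has_field_derivative w') (at (of_real t))" and im: "Im (w (of_real t)) \<noteq> 0"
  shows "((\<lambda>s. clausen_arg (w (of_real s))) has_real_derivative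
    - 2 * ln (2 * \<bar>Im (w (of_real t))\<bar> / norm (w (of_real t))) * Im (w' / w (of_real t))) (at t)"
proof -
  define w0 where "w0 = w (of_real t)"
  have w0: "w0 \<noteq> 0" using im by (auto simp: w0_def)
  define \<theta> where "\<theta> = 2 * Arg w0"
  have polar: "z / cnj z = cis (2 * Arg z)" if "z \<noteq> 0" for z
  proof -
    have "z = of_real (norm z) * cis (Arg z)" using rcis_cmod_Arg[of z] by (simp add: rcis_def)
    then have "z / cnj z = (of_real (norm z) * cis (Arg z)) / cnj (of_real (norm z) * cis (Arg z))" by (rule arg_cong)
    also have "\<dots> = cis (Arg z) / cis (- Arg z)" using that by (simp add: cis_cnj)
    finally show ?thesis by (simp add: cis_divide)
  qed
  \<comment> \<open>Dividing by the value at t moves the logarithm to a neighbourhood of 1, so the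
    branch cut plays no part wherever w lies.\<close>
  have eq: "clausen_arg (w (of_real s)) = clausen (cis (\<theta> + 2 * Im (Ln (w (of_real s) / w0))))"
    if "w (of_real s) \<noteq> 0" for s
  proof -
    have "w (of_real s) = w0 * (w (of_real s) / w0)" using w0 by simp
    then have "w (of_real s) / cnj (w (of_real s)) = (w0 / cnj w0) * ((w (of_real s) / w0) / cnj (w (of_real s) / w0))"
      using w0 by simp
    also have "\<dots> = cis \<theta> * cis (2 * Arg (w (of_real s) / w0))"
      using polar[OF w0] polar[of "w (of_real s) / w0"] that w0 by (simp add: \<theta>_def)
    also have "Arg (w (of_real s) / w0) = Im (Ln (w (of_real s) / w0))"
      using that w0 by (simp add: Arg_def)
    finally show ?thesis by (simp add: clausen_arg_def cis_mult)
  qed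
  have "cis \<theta> \<noteq> 1"
  proof
    assume "cis \<theta> = 1"
    then have "w0 = cnj w0" using polar[OF w0] w0 by (simp add: \<theta>_def field_simps)
    then have "Im w0 = Im (cnj w0)" by (rule arg_cong)
    with im show False by (simp add: w0_def)
  qed
  from clausen_cis_has_real_derivative[OF this]
  have H: "((\<lambda>t. clausen (cis t)) has_real_derivative - ln (norm (1 - cis \<theta>))) (at (\<theta> + 2 * Im (Ln (w (of_real t) / w0))))"
    using w0 by (simp add: w0_def)
  have "((\<lambda>s. Ln (w s / w0)) has_field_derivative w' / w0) (at (of_real t))"
    using w w0 by (auto intro!: derivative_eq_intros simp: w0_def)
  from bounded_linear.has_vector_derivative[OF bounded_linear_Im has_vector_derivative_real_field[OF this]]
  have "((\<lambda>s. Im (Ln (w (of_real s) / w0))) has_real_derivative Im (w' / w0)) (at t)"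
    unfolding has_real_derivative_iff_has_vector_derivative .
  from DERIV_add[OF DERIV_const[of \<theta>] DERIV_cmult[OF this, of 2]]
  have "((\<lambda>s. \<theta> + 2 * Im (Ln (w (of_real s) / w0))) has_real_derivative 2 * Im (w' / w0)) (at t)"
    by (simp only: add_0)
  from DERIV_chain2[where f = "\<lambda>t. clausen (cis t)" and x = t and
    g = "\<lambda>s. \<theta> + 2 * Im (Ln (w (of_real s) / w0))", OF H this]
  have "((\<lambda>s. clausen (cis (\<theta> + 2 * Im (Ln (w (of_real s) / w0))))) has_real_derivative
     - ln (norm (1 - cis \<theta>)) * (2 * Im (w' / w0))) (at t)" .
  moreover have "eventually (\<lambda>s. clausen (cis (\<theta> + 2 * Im (Ln (w (of_real s) / w0)))) = clausen_arg (w (of_real s))) (nhds t)"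
  proof -
    have "isCont complex_of_real t" by (intro continuous_intros)
    then have "isCont (\<lambda>s. w (of_real s)) t" by (rule isCont_o2[where f = complex_of_real and g = w, OF _ DERIV_isCont[OF w]])
    then have "((\<lambda>s. w (of_real s)) \<longlongrightarrow> w (of_real t)) (nhds t)"
      by (simp only: tendsto_nhds_iff isCont_def)
    then have "((\<lambda>s. w (of_real s)) \<longlongrightarrow> w0) (nhds t)" by (simp only: w0_def)
    then have "eventually (\<lambda>s. w (of_real s) \<noteq> 0) (nhds t)" using w0 by (rule tendsto_imp_eventually_ne)
    then show ?thesis by eventually_elim (simp add: eq)
  qed
  moreover have "norm (1 - cis \<theta>) = 2 * \<bar>Im w0\<bar> / norm w0"
  proof -
    have "1 - cis \<theta> = (cnj w0 - w0) / cnj w0"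
      using polar[OF w0] w0 by (simp add: \<theta>_def diff_divide_distrib)
    also have "cnj w0 - w0 = of_real (- 2 * Im w0) * \<i>" by (simp add: complex_eq_iff)
    finally show ?thesis by (simp add: norm_divide norm_mult)
  qed
  ultimately show ?thesis
    by (subst (asm) DERIV_cong_ev[OF refl _ refl]) (auto simp: w0_def mult_ac)
qed

text \<open>The classical formula dD = log |z| d arg(1 - z) - log |1 - z| d arg z. The three Clausen
  terms share the summand ln (2 |Im z|), which drops out because the differentials of the three
  angles add up to zero.\<close>

lemma bloch_wigner_has_real_derivative:
  assumes z: "(z has_field_derivative z') (at (of_real t))" and im: "Im (z (of_real t)) \<noteq> 0"
  defines "z0 \<equiv> z (of_real t)"
  shows "((\<lambda>s. bloch_wigner (z (of_real s))) has_real_derivative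
    ln (norm z0) * Im (z' / (z0 - 1)) - ln (norm (1 - z0)) * Im (z' / z0)) (at t)"
proof -
  have z0: "z0 \<noteq> 0" "z0 \<noteq> 1" "z0 - 1 \<noteq> 0" using im by (auto simp: z0_def)
  have im0: "Im z0 \<noteq> 0" using im by (simp add: z0_def)
  have im2: "Im ((z0 - 1) / z0) = Im z0 / (norm z0)\<^sup>2"
    by (simp add: Im_divide cmod_power2 algebra_simps)
  have d2: "((\<lambda>s. (z s - 1) / z s) has_field_derivative (z' * z0 - (z0 - 1) * z') / (z0 * z0)) (at (of_real t))"
    using z z0 by (auto intro!: derivative_eq_intros simp: z0_def)
  have d3: "((\<lambda>s. 1 - z s) has_field_derivative - z') (at (of_real t))"
    using z by (auto intro!: derivative_eq_intros)
  have l2: "((z' * z0 - (z0 - 1) * z') / (z0 * z0)) / ((z0 - 1) / z0) = z' / (z0 - 1) - z' / z0"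
    using z0 by (simp add: field_simps)
  have l3: "- z' / (1 - z0) = z' / (z0 - 1)"
    by (metis minus_diff_eq minus_divide_divide)
  have n1: "norm (1 - z0) = norm (z0 - 1)" by (rule norm_minus_commute)
  define l a b A B where "l = ln (2 * \<bar>Im z0\<bar>)" and "a = ln (norm z0)" and "b = ln (norm (z0 - 1))"
    and "A = Im (z' / z0)" and "B = Im (z' / (z0 - 1))"
  have e1: "ln (2 * \<bar>Im z0\<bar> / norm z0) = l - a"
    using z0 im0 by (simp add: l_def a_def ln_div)
  have e2: "ln (2 * \<bar>Im ((z0 - 1) / z0)\<bar> / norm ((z0 - 1) / z0)) = l - a - b"
  proof -
    have "2 * \<bar>Im ((z0 - 1) / z0)\<bar> / norm ((z0 - 1) / z0) = 2 * \<bar>Im z0\<bar> / (norm z0 * norm (z0 - 1))"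
      unfolding im2 using z0 by (simp add: norm_divide power2_eq_square)
    then show ?thesis
      using z0 im0 by (simp add: l_def a_def b_def ln_div ln_mult)
  qed
  have e3: "ln (2 * \<bar>Im (1 - z0)\<bar> / norm (1 - z0)) = l - b"
    unfolding n1 using z0 im0 by (simp add: l_def b_def ln_div)
  have D1: "((\<lambda>s. clausen_arg (z (of_real s))) has_real_derivative - 2 * (l - a) * A) (at t)"
    using clausen_arg_has_real_derivative[OF z im] unfolding z0_def[symmetric] e1 A_def .
  have D2: "((\<lambda>s. clausen_arg ((z (of_real s) - 1) / z (of_real s))) has_real_derivative - 2 * (l - a - b) * (B - A)) (at t)"
  proof -
    have "Im ((z (of_real t) - 1) / z (of_real t)) \<noteq> 0"
      unfolding z0_def[symmetric] im2 using im0 z0 by simp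
    from clausen_arg_has_real_derivative[OF d2 this] show ?thesis
      unfolding z0_def[symmetric] e2 l2 by (simp add: A_def B_def)
  qed
  have D3: "((\<lambda>s. clausen_arg (1 - z (of_real s))) has_real_derivative - 2 * (l - b) * B) (at t)"
  proof -
    have "Im (1 - z (of_real t)) \<noteq> 0" using im by simp
    from clausen_arg_has_real_derivative[OF d3 this] show ?thesis
      unfolding z0_def[symmetric] e3 l3 B_def .
  qed
  have "((\<lambda>s. bloch_wigner (z (of_real s))) has_real_derivative
     (- 2 * (l - a) * A + - 2 * (l - a - b) * (B - A) - - 2 * (l - b) * B) / 2) (at t)"
    unfolding bloch_wigner_def by (intro DERIV_cdivide DERIV_diff DERIV_add D1 D2 D3)
  moreover have "(- 2 * (l - a) * A + - 2 * (l - a - b) * (B - A) - - 2 * (l - b) * B) / 2 = a * B - b * A"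
    by (simp add: algebra_simps)
  ultimately show ?thesis unfolding n1 a_def b_def A_def B_def by simp
qed

section \<open>The five-term relation\<close>

lemma Im_of_real_mult: "Im (of_real r * z) = r * Im z"
  by simp

text \<open>The point y is moved to 0 along the ray t y. The five-term sum has derivative zero there
  apart from finitely many t, hence is constant, and its limit is D(x) + D(1 - x) = 0.\<close>

lemma bloch_wigner_five_term_generic:
  assumes x: "Im x \<noteq> 0" and y: "Im y \<noteq> 0" and xy: "Im (x * y) \<noteq> 0"
  shows "bloch_wigner x + bloch_wigner y + bloch_wigner (1 - x * y) +
     bloch_wigner ((1 - x) / (1 - x * y)) + bloch_wigner ((1 - y) / (1 - x * y)) = 0"
proof -
  define z2 z3 z4 z5 :: "complex \<Rightarrow> complex" where "z2 t = t * y" and "z3 t = 1 - x * (t * y)"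
    and "z4 t = (1 - x) / (1 - x * (t * y))" and "z5 t = (1 - t * y) / (1 - x * (t * y))" for t
  define f where "f t = bloch_wigner x + bloch_wigner (z2 (of_real t)) + bloch_wigner (z3 (of_real t)) +
     bloch_wigner (z4 (of_real t)) + bloch_wigner (z5 (of_real t))" for t :: real
  have x0: "x \<noteq> 0" "1 - x \<noteq> 0" and y0: "y \<noteq> 0" using x y by auto
  have imy: "Im (of_real t * y) \<noteq> 0" and imxy: "Im (x * (of_real t * y)) \<noteq> 0" if "t > 0" for t :: real
  proof -
    show "Im (of_real t * y) \<noteq> 0" using that y by simp
    have "x * (of_real t * y) = of_real t * (x * y)" by (simp add: mult_ac)
    then have "Im (x * (of_real t * y)) = t * Im (x * y)" by (simp only: Im_of_real_mult)
    then show "Im (x * (of_real t * y)) \<noteq> 0" using that xy by simp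
  qed
  have nz: "of_real t * y \<noteq> 0" "1 - of_real t * y \<noteq> 0" "1 - x * (of_real t * y) \<noteq> 0" if "t > 0" for t :: real
  proof -
    show "of_real t * y \<noteq> 0" using that y0 by simp
    show "1 - of_real t * y \<noteq> 0" using imy[OF that] by (metis Im_complex_of_real of_real_1 right_minus_eq)
    show "1 - x * (of_real t * y) \<noteq> 0" using imxy[OF that] by (metis Im_complex_of_real of_real_1 right_minus_eq)
  qed
  have z01: "z2 (of_real t) \<noteq> 0" "z2 (of_real t) \<noteq> 1" "z3 (of_real t) \<noteq> 0" "z3 (of_real t) \<noteq> 1"
    "z4 (of_real t) \<noteq> 0" "z4 (of_real t) \<noteq> 1" "z5 (of_real t) \<noteq> 0" "z5 (of_real t) \<noteq> 1" if "t > 0" for t :: real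
    using nz[OF that] x0 by (auto simp: z2_def z3_def z4_def z5_def)
  have f_const: "f a = f 1" if a: "0 < a" "a \<le> 1" for a
  proof -
    define K where "K = {t. t > 0 \<and> (Im (z4 (of_real t)) = 0 \<or> Im (z5 (of_real t)) = 0)}"
    have quot: "Im (u / v) = 0 \<longleftrightarrow> Im (u * cnj v) = 0" if "v \<noteq> 0" for u v :: complex
      using that by (simp add: Im_complex_div_eq_0)
    have "K \<subseteq> {Im (1 - x) / Im ((1 - x) * cnj (x * y)), (Im (x * y) - Im y) / ((norm y)\<^sup>2 * Im x)}"
    proof
      fix t assume "t \<in> K"
      then have t: "t > 0" "Im (z4 (of_real t)) = 0 \<or> Im (z5 (of_real t)) = 0" by (auto simp: K_def)
      from t(2) show "t \<in> {Im (1 - x) / Im ((1 - x) * cnj (x * y)), (Im (x * y) - Im y) / ((norm y)\<^sup>2 * Im x)}"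
      proof
        assume "Im (z4 (of_real t)) = 0"
        then have "Im ((1 - x) * cnj (1 - x * (of_real t * y))) = 0"
          unfolding z4_def quot[OF nz(3)[OF t(1)]] .
        also have "(1 - x) * cnj (1 - x * (of_real t * y)) = (1 - x) - of_real t * ((1 - x) * cnj (x * y))"
          by (simp add: algebra_simps)
        finally have "t * Im ((1 - x) * cnj (x * y)) = Im (1 - x)"
          by (simp only: minus_complex.sel Im_of_real_mult)
        moreover have "Im (1 - x) \<noteq> 0" using x by simp
        ultimately have "t = Im (1 - x) / Im ((1 - x) * cnj (x * y))"
          by (metis mult_eq_0_iff nonzero_eq_divide_eq)
        then show ?thesis by blast
      next
        assume "Im (z5 (of_real t)) = 0"
        then have "Im ((1 - of_real t * y) * cnj (1 - x * (of_real t * y))) = 0"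
          unfolding z5_def quot[OF nz(3)[OF t(1)]] .
        also have "(1 - of_real t * y) * cnj (1 - x * (of_real t * y)) =
            1 - of_real t * (y + cnj (x * y)) + of_real (t * t) * ((y * cnj y) * cnj x)"
          by (simp add: algebra_simps)
        also have "y * cnj y = of_real ((norm y)\<^sup>2)" by (simp only: complex_norm_square)
        finally have "t * (Im (x * y) - Im y) = t * (t * ((norm y)\<^sup>2 * Im x))"
          by (simp only: minus_complex.sel plus_complex.sel Im_of_real_mult complex_cnj) (simp add: algebra_simps)
        then have "Im (x * y) - Im y = t * ((norm y)\<^sup>2 * Im x)" using t(1) by simp
        then have "t = (Im (x * y) - Im y) / ((norm y)\<^sup>2 * Im x)" using x y0 by (simp add: field_simps)
        then show ?thesis by blast
      qed
    qed
    then have "finite K" by (rule finite_subset) simp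
    have "f 1 = f a"
    proof (rule has_derivative_zero_unique_strong_interval[where f = f and k = K and a = a and b = 1])
      show "continuous_on {a..1} f"
        unfolding f_def z2_def z3_def z4_def z5_def
        using a z01 nz unfolding z2_def z3_def z4_def z5_def
        by (intro continuous_intros continuous_on_compose2[OF continuous_on_bloch_wigner]) auto
      show "finite K" by fact
      show "f a = f a" ..
      show "1 \<in> {a..1}" using a by simp
      fix t assume "t \<in> {a..1} - K"
      then have t: "t > 0" "Im (z4 (of_real t)) \<noteq> 0" "Im (z5 (of_real t)) \<noteq> 0" using a by (auto simp: K_def)
      define T Y W where "T = complex_of_real t" and "Y = T * y" and "W = 1 - x * Y"
      have im2: "Im (z2 T) \<noteq> 0" and im3: "Im (z3 T) \<noteq> 0"
        using imy[OF t(1)] imxy[OF t(1)] by (simp_all add: z2_def z3_def T_def)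
      have T0: "T \<noteq> 0" and Y0: "Y \<noteq> 0" "1 - Y \<noteq> 0" and W0: "W \<noteq> 0"
        using nz[OF t(1)] t(1) by (simp_all add: T_def Y_def W_def)
      \<comment> \<open>The logarithmic derivatives of 1 - Y and W. Together with 1/T, which is
        real, they express the logarithmic derivatives of all moving arguments and of their
        complements to 1.\<close>
      define P R where "P = - y / (1 - Y)" and "R = - (x * y) / W"
      have d2: "(z2 has_field_derivative y) (at T)"
        unfolding z2_def by (auto intro!: derivative_eq_intros)
      have d3: "(z3 has_field_derivative - (x * y)) (at T)"
        unfolding z3_def by (auto intro!: derivative_eq_intros)
      have d4: "(z4 has_field_derivative (1 - x) * (x * y) / (W * W)) (at T)"
        unfolding z4_def using W0 by (auto intro!: derivative_eq_intros simp: W_def Y_def)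
      have d5: "(z5 has_field_derivative (- y * W + (1 - Y) * (x * y)) / (W * W)) (at T)"
        unfolding z5_def using W0 by (auto intro!: derivative_eq_intros simp: W_def Y_def)
      have l2: "y / z2 T = 1 / T" "y / (z2 T - 1) = P"
      proof -
        show "y / z2 T = 1 / T" using T0 y0 by (simp add: z2_def)
        have "z2 T - 1 = - (1 - Y)" by (simp add: z2_def Y_def)
        then show "y / (z2 T - 1) = P" 
          using minus_divide_divide[of "- y" "1 - Y"] by (simp only: P_def minus_minus)
      qed
      have l3: "- (x * y) / z3 T = R" "- (x * y) / (z3 T - 1) = 1 / T"
        using T0 y0 x0 W0 by (simp_all add: z3_def R_def W_def Y_def)
      have z4: "z4 T = (1 - x) / W" "z4 T - 1 = - (x * (1 - Y)) / W" "1 - z4 T = x * (1 - Y) / W"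
        using W0 by (simp_all add: z4_def W_def Y_def field_simps)
      have z5: "z5 T = (1 - Y) / W" "z5 T - 1 = - (Y * (1 - x)) / W" "1 - z5 T = Y * (1 - x) / W"
        using W0 by (simp_all add: z5_def W_def Y_def field_simps)
      have l4: "(1 - x) * (x * y) / (W * W) / z4 T = - R" "(1 - x) * (x * y) / (W * W) / (z4 T - 1) = P - R"
      proof -
        show "(1 - x) * (x * y) / (W * W) / z4 T = - R"
          unfolding z4(1) R_def using W0 x0 by simp
        have "(1 - x) * (x * y) / (W * W) / (- (x * (1 - Y)) / W) = - ((1 - x) * y) / ((1 - Y) * W)"
          using W0 x0 Y0 by (simp add: divide_simps)
        also have "\<dots> = (- y * W + x * y * (1 - Y)) / ((1 - Y) * W)" by (simp add: W_def algebra_simps)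
        also have "\<dots> = P - R" unfolding P_def R_def using W0 Y0 by (simp add: divide_simps)
        finally show "(1 - x) * (x * y) / (W * W) / (z4 T - 1) = P - R" unfolding z4(2) .
      qed
      have l5: "(- y * W + (1 - Y) * (x * y)) / (W * W) / z5 T = P - R"
        "(- y * W + (1 - Y) * (x * y)) / (W * W) / (z5 T - 1) = 1 / T - R"
      proof -
        show "(- y * W + (1 - Y) * (x * y)) / (W * W) / z5 T = P - R"
        proof -
          have "n / (W * W) / ((1 - Y) / W) = n / ((1 - Y) * W)" for n
            using W0 by simp
          then show ?thesis
            unfolding z5(1) P_def R_def diff_frac_eq[OF Y0(2) W0] by (simp add: mult.commute)
        qed
        have e: "- y * W + (1 - Y) * (x * y) = - (y * (1 - x))" by (simp add: W_def algebra_simps)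
        have "(- y * W + (1 - Y) * (x * y)) / (W * W) / (- (Y * (1 - x)) / W) = y / (Y * W)"
          unfolding e using W0 x0 Y0 by simp
        also have "\<dots> = 1 / (T * W)" using y0 T0 by (simp add: Y_def)
        also have "\<dots> = (W + T * (x * y)) / (T * W)" by (simp add: W_def Y_def algebra_simps)
        also have "\<dots> = 1 / T - R" unfolding R_def diff_frac_eq[OF T0 W0] by (simp add: mult.commute)
        finally show "(- y * W + (1 - Y) * (x * y)) / (W * W) / (z5 T - 1) = 1 / T - R" unfolding z5(2) .
      qed
      have imT: "Im (1 / T) = 0" by (simp add: T_def)
      define lx lx' ly ly' lw where "lx = ln (norm x)" and "lx' = ln (norm (1 - x))" and "ly = ln (norm Y)"
        and "ly' = ln (norm (1 - Y))" and "lw = ln (norm W)"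
      have D2: "((\<lambda>s. bloch_wigner (z2 (of_real s))) has_real_derivative ly * Im P) (at t)"
        using bloch_wigner_has_real_derivative[of z2 y t] d2 im2
        unfolding T_def[symmetric] l2 imT by (simp add: ly_def z2_def Y_def)
      have D3: "((\<lambda>s. bloch_wigner (z3 (of_real s))) has_real_derivative - (lx + ly) * Im R) (at t)"
      proof -
        have "1 - z3 T = x * Y" by (simp add: z3_def Y_def)
        then have "ln (norm (1 - z3 T)) = lx + ly" using x0 Y0 by (simp add: lx_def ly_def norm_mult ln_mult)
        then show ?thesis
          using bloch_wigner_has_real_derivative[of z3 "- (x * y)" t] d3 im3
          unfolding T_def[symmetric] l3 imT by (simp del: minus_add_distrib)
      qed
      have D4: "((\<lambda>s. bloch_wigner (z4 (of_real s))) has_real_derivative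
          (lx' - lw) * Im (P - R) - (lx + ly' - lw) * Im (- R)) (at t)"
      proof -
        have "ln (norm (z4 T)) = lx' - lw" "ln (norm (1 - z4 T)) = lx + ly' - lw"
        proof -
          show "ln (norm (z4 T)) = lx' - lw"
            unfolding z4(1) using x0 W0 by (simp add: lx'_def lw_def norm_divide ln_div)
          show "ln (norm (1 - z4 T)) = lx + ly' - lw"
            unfolding z4(3) using x0 Y0 W0 by (simp add: lx_def ly'_def lw_def norm_mult norm_divide ln_mult ln_div)
        qed
        then show ?thesis
          using bloch_wigner_has_real_derivative[of z4 "(1 - x) * (x * y) / (W * W)" t] d4 t(2)
          unfolding T_def[symmetric] l4 by simp
      qed
      have D5: "((\<lambda>s. bloch_wigner (z5 (of_real s))) has_real_derivative
          (ly' - lw) * Im (1 / T - R) - (ly + lx' - lw) * Im (P - R)) (at t)"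
      proof -
        have "ln (norm (z5 T)) = ly' - lw" "ln (norm (1 - z5 T)) = ly + lx' - lw"
        proof -
          show "ln (norm (z5 T)) = ly' - lw"
            unfolding z5(1) using Y0 W0 by (simp add: ly'_def lw_def norm_divide ln_div)
          show "ln (norm (1 - z5 T)) = ly + lx' - lw"
            unfolding z5(3) using x0 Y0 W0 by (simp add: ly_def lx'_def lw_def norm_mult norm_divide ln_mult ln_div)
        qed
        then show ?thesis
          using bloch_wigner_has_real_derivative[of z5 "(- y * W + (1 - Y) * (x * y)) / (W * W)" t] d5 t(3)
          unfolding T_def[symmetric] l5 by simp
      qed
      have "(f has_real_derivative 0 + ly * Im P + - (lx + ly) * Im R +
          ((lx' - lw) * Im (P - R) - (lx + ly' - lw) * Im (- R)) +
          ((ly' - lw) * Im (1 / T - R) - (ly + lx' - lw) * Im (P - R))) (at t)"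
        unfolding f_def by (intro DERIV_add DERIV_const D2 D3 D4 D5)
      \<comment> \<open>The coefficients of Im P and Im R cancel separately. This is the relation
        \<Sum> z \<and> (1 - z) = 0 for the five arguments, read through log |.| and d arg.\<close>
      moreover have "0 + ly * Im P + - (lx + ly) * Im R +
          ((lx' - lw) * Im (P - R) - (lx + ly' - lw) * Im (- R)) +
          ((ly' - lw) * Im (1 / T - R) - (ly + lx' - lw) * Im (P - R)) = 0"
        using imT by (simp add: algebra_simps)
      ultimately have "(f has_real_derivative 0) (at t)" by simp
      then show "(f has_derivative (\<lambda>h. 0)) (at t within {a..1})"
      proof -
        have "(*) (0 :: real) = (\<lambda>h. 0)" by (simp add: fun_eq_iff)
        with \<open>(f has_real_derivative 0) (at t)\<close> have "(f has_derivative (\<lambda>h. 0)) (at t)"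
          by (simp only: has_field_derivative_def)
        then show ?thesis by (rule has_derivative_at_withinI)
      qed
    qed
    then show ?thesis ..
  qed
  \<comment> \<open>As t tends to 0 the second argument tends to 0, the third and fifth to 1, the
    fourth to 1 - x; limits at 1 are reduced to limits at 0 by the antisymmetry under z -> 1 -
    z.\<close>
  have "(f \<longlongrightarrow> bloch_wigner x + 0 + 0 + bloch_wigner (1 - x) + 0) (at_right 0)"
  proof -
    have pos: "eventually (\<lambda>t::real. t > 0) (at_right 0)" by (rule eventually_at_right_less)
    have l2: "((\<lambda>t. z2 (of_real t)) \<longlongrightarrow> 0) (at_right 0)"
    proof -
      have "((\<lambda>t. z2 (of_real t)) \<longlongrightarrow> of_real 0 * y) (at_right 0)"
        unfolding z2_def by (intro tendsto_intros)
      then show ?thesis by simp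
    qed
    have l3: "((\<lambda>t. 1 - z3 (of_real t)) \<longlongrightarrow> 0) (at_right 0)"
    proof -
      have "((\<lambda>t. 1 - z3 (of_real t)) \<longlongrightarrow> 1 - (1 - x * (of_real 0 * y))) (at_right 0)"
        unfolding z3_def by (intro tendsto_intros)
      then show ?thesis by simp
    qed
    have l4: "((\<lambda>t. z4 (of_real t)) \<longlongrightarrow> 1 - x) (at_right 0)"
    proof -
      have "((\<lambda>t. z4 (of_real t)) \<longlongrightarrow> (1 - x) / (1 - x * (of_real 0 * y))) (at_right 0)"
        unfolding z4_def by (intro tendsto_intros) simp
      then show ?thesis by simp
    qed
    have l5: "((\<lambda>t. 1 - z5 (of_real t)) \<longlongrightarrow> 0) (at_right 0)"
    proof -
      have "((\<lambda>t. 1 - z5 (of_real t)) \<longlongrightarrow> 1 - (1 - of_real 0 * y) / (1 - x * (of_real 0 * y))) (at_right 0)"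
        unfolding z5_def by (intro tendsto_intros) simp
      then show ?thesis by simp
    qed
    have b2: "((\<lambda>t. bloch_wigner (z2 (of_real t))) \<longlongrightarrow> 0) (at_right 0)"
      by (rule bloch_wigner_tendsto_0[OF l2]) (use pos in \<open>eventually_elim, use z01 in auto\<close>)
    have b3: "((\<lambda>t. bloch_wigner (z3 (of_real t))) \<longlongrightarrow> 0) (at_right 0)"
    proof -
      have "((\<lambda>t. bloch_wigner (1 - z3 (of_real t))) \<longlongrightarrow> 0) (at_right 0)"
        by (rule bloch_wigner_tendsto_0[OF l3]) (use pos in \<open>eventually_elim, use z01 in auto\<close>)
      from tendsto_minus[OF this] show ?thesis by (simp add: bloch_wigner_one_minus)
    qed
    have b5: "((\<lambda>t. bloch_wigner (z5 (of_real t))) \<longlongrightarrow> 0) (at_right 0)"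
    proof -
      have "((\<lambda>t. bloch_wigner (1 - z5 (of_real t))) \<longlongrightarrow> 0) (at_right 0)"
        by (rule bloch_wigner_tendsto_0[OF l5]) (use pos in \<open>eventually_elim, use z01 in auto\<close>)
      from tendsto_minus[OF this] show ?thesis by (simp add: bloch_wigner_one_minus)
    qed
    have b4: "((\<lambda>t. bloch_wigner (z4 (of_real t))) \<longlongrightarrow> bloch_wigner (1 - x)) (at_right 0)"
      by (rule tendsto_bloch_wigner[OF l4]) (use x0 in auto)
    show ?thesis unfolding f_def by (intro tendsto_add tendsto_const b2 b3 b4 b5)
  qed
  moreover have "(f \<longlongrightarrow> f 1) (at_right 0)"
  proof (rule tendsto_eventually)
    have "eventually (\<lambda>t::real. t \<in> {0<..<1}) (at_right 0)" by (rule eventually_at_right_real) simp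
    then show "eventually (\<lambda>t. f t = f 1) (at_right 0)" by eventually_elim (rule f_const, auto)
  qed
  ultimately have "f 1 = bloch_wigner x + 0 + 0 + bloch_wigner (1 - x) + 0"
    using tendsto_unique[OF trivial_limit_at_right_real] by blast
  then show ?thesis
    by (simp add: f_def z2_def z3_def z4_def z5_def bloch_wigner_one_minus)
qed

text \<open>Rotating x and y by the same small angle t > 0 makes x, y and x y nonreal, so the
  generic case applies; continuity gives the relation at t = 0.\<close>

lemma bloch_wigner_five_term:
  assumes x: "x \<noteq> 0" "x \<noteq> 1" and y: "y \<noteq> 0" "y \<noteq> 1" and xy: "x * y \<noteq> 1"
  shows "bloch_wigner x + bloch_wigner y + bloch_wigner (1 - x * y) +
     bloch_wigner ((1 - x) / (1 - x * y)) + bloch_wigner ((1 - y) / (1 - x * y)) = 0"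
proof -
  define xt yt where "xt t = x * cis t" and "yt t = y * cis t" for t
  define f where "f t = bloch_wigner (xt t) + bloch_wigner (yt t) + bloch_wigner (1 - xt t * yt t) +
     bloch_wigner ((1 - xt t) / (1 - xt t * yt t)) + bloch_wigner ((1 - yt t) / (1 - xt t * yt t))" for t
  have nonreal: "eventually (\<lambda>t. Im (w * cis (c * t)) \<noteq> 0) (at_right 0)" if w: "w \<noteq> 0" and c: "c > 0" for w c
  proof (cases "Im w = 0")
    case True
    have "eventually (\<lambda>t. t \<in> {0<..<pi / c}) (at_right 0)"
      using c by (intro eventually_at_right_real) simp
    then show ?thesis
    proof eventually_elim
      case (elim t)
      then have "sin (c * t) > 0" using c by (intro sin_gt_zero) (auto simp: field_simps)
      moreover have "Re w \<noteq> 0" using True w by (auto simp: complex_eq_iff)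
      ultimately show ?case using True by simp
    qed
  next
    case False
    have "((\<lambda>t. Im (w * cis (c * t))) \<longlongrightarrow> Im (w * cis (c * 0))) (at_right 0)"
      unfolding cis_conv_exp by (intro tendsto_intros)
    then show ?thesis by (rule tendsto_imp_eventually_ne) (use False in simp)
  qed
  have "eventually (\<lambda>t. f t = 0) (at_right 0)"
  proof -
    have "eventually (\<lambda>t. Im (x * y * cis (2 * t)) \<noteq> 0) (at_right 0)"
      by (rule nonreal) (use x y in auto)
    with nonreal[OF x(1) zero_less_one] nonreal[OF y(1) zero_less_one] show ?thesis
    proof eventually_elim
      case (elim t)
      have "xt t * yt t = x * y * (cis t * cis t)" by (simp only: xt_def yt_def mult_ac)
      then have "xt t * yt t = x * y * cis (2 * t)" by (simp only: cis_mult mult_2)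
      with elim have "Im (xt t) \<noteq> 0" "Im (yt t) \<noteq> 0" "Im (xt t * yt t) \<noteq> 0"
        by (simp_all only: xt_def yt_def mult_1 not_False_eq_True)
      then show ?case unfolding f_def by (rule bloch_wigner_five_term_generic)
    qed
  qed
  then have "(f \<longlongrightarrow> 0) (at_right 0)" by (rule tendsto_eventually)
  moreover have "(f \<longlongrightarrow> f 0) (at_right 0)"
  proof -
    have xt: "(xt \<longlongrightarrow> xt 0) (at_right 0)" and yt: "(yt \<longlongrightarrow> yt 0) (at_right 0)"
      unfolding xt_def yt_def cis_conv_exp by (intro tendsto_intros)+
    have 0: "xt 0 = x" "yt 0 = y" by (simp_all add: xt_def yt_def)
    have nz: "1 - xt 0 * yt 0 \<noteq> 0" using xy by (simp add: 0)
    show ?thesis unfolding f_def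
    proof (intro tendsto_add tendsto_bloch_wigner tendsto_divide tendsto_diff tendsto_mult tendsto_const xt yt nz)
    qed (use x y xy in \<open>auto simp: 0 field_simps\<close>)
  qed
  ultimately have "f 0 = 0" using tendsto_unique[OF trivial_limit_at_right_real] by blast
  then show ?thesis by (simp add: f_def xt_def yt_def)
qed

text \<open>The three angles all equal pi/3 (the regular ideal tetrahedron), so the value is 3/2
  times Clausen's function at 2 pi/3. That function decreases on [2 pi/3, pi], where |1 - cis t| >
  1, and vanishes at pi.\<close>

lemma bloch_wigner_sixth_root_pos: "bloch_wigner (cis (pi / 3)) > 0"
proof -
  let ?z = "cis (pi / 3)"
  have z: "?z = Complex (1 / 2) (sqrt 3 / 2)" by (simp add: complex_eq_iff cos_60 sin_60)
  have 1: "(?z - 1) / ?z = ?z"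
    unfolding z by (simp add: complex_eq_iff Re_divide Im_divide power2_eq_square)
  have 2: "1 - ?z = cnj ?z" unfolding z by (simp add: complex_eq_iff)
  have "clausen_arg ?z = clausen (cis (2 * pi / 3))"
    by (simp add: clausen_arg_def cis_cnj cis_divide)
  then have "bloch_wigner ?z = 3 / 2 * clausen (cis (2 * pi / 3))"
    unfolding bloch_wigner_def 1 unfolding 2 clausen_arg_cnj by simp
  moreover have "clausen (cis (2 * pi / 3)) > clausen (cis pi)"
  proof (rule DERIV_neg_imp_decreasing[where f = "\<lambda>t. clausen (cis t)"])
    show "2 * pi / 3 < pi" by simp
    fix t assume t: "2 * pi / 3 \<le> t" "t \<le> pi"
    have "cos t \<le> cos (2 * pi / 3)" using t by (intro cos_monotone_0_pi_le) auto
    also have "\<dots> = - 1 / 2" using cos_120 by simp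
    finally have c: "cos t \<le> - 1 / 2" .
    have "(norm (1 - cis t))\<^sup>2 = (1 - cos t)\<^sup>2 + (sin t)\<^sup>2" by (simp add: cmod_power2)
    also have "\<dots> = 2 - 2 * cos t" by (simp add: sin_squared_eq power2_eq_square algebra_simps)
    finally have n: "(norm (1 - cis t))\<^sup>2 > 1" using c by simp
    have n1: "norm (1 - cis t) > 1"
      by (rule power2_less_imp_less) (use n in \<open>simp_all only: one_power2 norm_ge_zero\<close>)
    then have "cis t \<noteq> 1" by auto
    from clausen_cis_has_real_derivative[OF this] n1
    show "\<exists>y. ((\<lambda>t. clausen (cis t)) has_real_derivative y) (at t) \<and> y < 0"
      by (intro exI[of _ "- ln (norm (1 - cis t))"]) (simp add: ln_gt_zero)
  qed
  moreover have "clausen (cis pi) = 0"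
    using clausen_cnj[of "cis pi"] by simp
  ultimately show ?thesis by simp
qed

section \<open>Non-torsion elements of Bloch groups\<close>

definition bloch_wigner_hom :: "(complex \<Rightarrow>\<^sub>0 int) \<Rightarrow> real" where
  "bloch_wigner_hom \<xi> = (\<Sum>x\<in>Poly_Mapping.keys \<xi>. of_int (Poly_Mapping.lookup \<xi> x) * bloch_wigner x)"

lemma bloch_wigner_hom_superset:
  assumes "finite A" "Poly_Mapping.keys \<xi> \<subseteq> A"
  shows "bloch_wigner_hom \<xi> = (\<Sum>x\<in>A. of_int (Poly_Mapping.lookup \<xi> x) * bloch_wigner x)"
  unfolding bloch_wigner_hom_def
  by (rule sum.mono_neutral_left) (use assms in \<open>auto simp: in_keys_iff\<close>)

lemma bloch_wigner_hom_add: "bloch_wigner_hom (\<xi> + \<eta>) = bloch_wigner_hom \<xi> + bloch_wigner_hom \<eta>"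
proof -
  let ?A = "Poly_Mapping.keys \<xi> \<union> Poly_Mapping.keys \<eta>"
  have fin: "finite ?A" by simp
  have "Poly_Mapping.keys (\<xi> + \<eta>) \<subseteq> ?A" by (rule keys_add)
  then show ?thesis
    using bloch_wigner_hom_superset[OF fin, of \<xi>] bloch_wigner_hom_superset[OF fin, of \<eta>]
      bloch_wigner_hom_superset[OF fin, of "\<xi> + \<eta>"]
    by (simp add: lookup_add distrib_right sum.distrib)
qed

lemma bloch_wigner_hom_0: "bloch_wigner_hom 0 = 0"
  by (simp add: bloch_wigner_hom_def)

lemma bloch_wigner_hom_minus: "bloch_wigner_hom (- \<xi>) = - bloch_wigner_hom \<xi>"
  using bloch_wigner_hom_add[of \<xi> "- \<xi>"] by (simp add: bloch_wigner_hom_0)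

lemma bloch_wigner_hom_frag_of: "bloch_wigner_hom (frag_of x) = bloch_wigner x"
  by (simp add: bloch_wigner_hom_def)

text \<open>Each kind of generator is a functional equation of the Bloch--Wigner function. Their
  supports are carried along because negation in the free abelian group is identified with
  \<open>-\<close> only on its carrier.\<close>

lemma bloch_wigner_hom_relations:
  assumes K: "subfield K ring_of_type_algebra" and \<xi>: "\<xi> \<in> bloch_relations K"
  shows "bloch_wigner_hom \<xi> = 0"
proof -
  interpret bloch_subfield K by (rule bloch_subfield.intro[OF K])
  let ?S = "K - {0, 1}"
  let ?R = "{frag_of x + frag_of (1 - x) | x. x \<in> ?S} \<union>
      {frag_of x + frag_of (1 / x) | x. x \<in> ?S} \<union>
      {frag_of x + frag_of y + frag_of (1 - x * y) + frag_of ((1 - x) / (1 - x * y)) +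
         frag_of ((1 - y) / (1 - x * y)) | x y. x \<in> ?S \<and> y \<in> ?S \<and> x * y \<noteq> 1}"
  have keys_plus: "Poly_Mapping.keys (a + b) \<subseteq> ?S" if "Poly_Mapping.keys a \<subseteq> ?S" "Poly_Mapping.keys b \<subseteq> ?S" for a b :: "complex \<Rightarrow>\<^sub>0 int"
    using keys_add[of a b] that by blast
  have keys_of: "Poly_Mapping.keys (frag_of x) \<subseteq> ?S" if "x \<in> ?S" for x
    using that by simp
  have R: "bloch_wigner_hom \<rho> = 0 \<and> Poly_Mapping.keys \<rho> \<subseteq> ?S" if "\<rho> \<in> ?R" for \<rho>
    using that
  proof (elim UnE CollectE exE conjE)
    fix x assume \<rho>: "\<rho> = frag_of x + frag_of (1 - x)" and x: "x \<in> ?S"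
    have "1 - x \<in> ?S" using x closed(2,5) by auto
    then show ?thesis
      unfolding \<rho> using x by (intro conjI keys_plus keys_of)
        (simp_all add: bloch_wigner_hom_add bloch_wigner_hom_frag_of bloch_wigner_one_minus)
  next
    fix x assume \<rho>: "\<rho> = frag_of x + frag_of (1 / x)" and x: "x \<in> ?S"
    have "1 / x \<in> ?S" using x closed(2,8) by auto
    then show ?thesis
      unfolding \<rho> using x by (intro conjI keys_plus keys_of)
        (simp_all add: bloch_wigner_hom_add bloch_wigner_hom_frag_of bloch_wigner_inverse)
  next
    fix x y assume \<rho>: "\<rho> = frag_of x + frag_of y + frag_of (1 - x * y) + frag_of ((1 - x) / (1 - x * y)) +
         frag_of ((1 - y) / (1 - x * y))" and x: "x \<in> ?S" and y: "y \<in> ?S" and xy: "x * y \<noteq> 1"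
    have K: "x \<in> K" "y \<in> K" "1 - x * y \<in> K" "1 - x \<in> K" "1 - y \<in> K"
      using x y closed(2,5,6) by auto
    have "1 - x * y \<in> ?S" using x y xy K by auto
    moreover have "(1 - x) / (1 - x * y) \<in> ?S"
      using x y xy closed(8)[OF K(4,3)] by auto
    moreover have "(1 - y) / (1 - x * y) \<in> ?S"
      using x y xy closed(8)[OF K(5,3)] by auto
    moreover have "bloch_wigner_hom \<rho> = 0"
      unfolding \<rho> bloch_wigner_hom_add bloch_wigner_hom_frag_of
      using x y xy by (intro bloch_wigner_five_term) auto
    ultimately show ?thesis
      using x y unfolding \<rho> by (intro conjI keys_plus keys_of) simp_all
  qed
  from \<xi> show ?thesis unfolding bloch_relations_def
  proof (induction rule: generate.induct)
    case one
    show ?case by (simp add: bloch_wigner_hom_0)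
  next
    case (incl \<rho>)
    then show ?case using R by blast
  next
    case (inv \<rho>)
    from R[OF inv] show ?case by (simp add: bloch_wigner_hom_minus)
  next
    case (eng \<rho> \<sigma>)
    then show ?case by (simp add: bloch_wigner_hom_add)
  qed
qed

text \<open>The homomorphism is constant on a coset of the relations and takes n times that value on
  the n-th power of the coset. If this power is trivial it contains 0, so the value
  vanishes.\<close>

theorem bloch_wigner_hom_torsion:
  assumes K: "subfield K ring_of_type_algebra"
    and tors: "bloch_class K \<xi> \<in> torsion_elements (bloch_group K)"
  shows "bloch_wigner_hom \<xi> = 0"
proof -
  let ?H = "bloch_relations K"
  let ?S = "bloch_class K \<xi>"
  obtain n :: nat where n: "n > 0" "?S [^]\<^bsub>bloch_group K\<^esub> n = \<one>\<^bsub>bloch_group K\<^esub>"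
    using tors by (auto simp: torsion_elements_def)
  have S: "bloch_wigner_hom \<eta> = bloch_wigner_hom \<xi>" if \<eta>: "\<eta> \<in> ?S" for \<eta>
  proof -
    obtain h where "h \<in> ?H" "\<eta> = h + \<xi>"
      using \<eta> by (auto simp: bloch_class_def r_coset_def free_Abelian_group_def)
    then show ?thesis by (simp add: bloch_wigner_hom_add bloch_wigner_hom_relations[OF K])
  qed
  have pow: "bloch_wigner_hom \<eta> = of_nat m * bloch_wigner_hom \<xi>"
    if "\<eta> \<in> ?S [^]\<^bsub>bloch_group K\<^esub> m" for \<eta> and m :: nat
    using that
  proof (induction m arbitrary: \<eta>)
    case 0
    then have "\<eta> \<in> ?H" by (simp add: bloch_group_def FactGroup_def nat_pow_def)
    then show ?case by (simp add: bloch_wigner_hom_relations[OF K])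
  next
    case (Suc m)
    then have "\<eta> \<in> ?S [^]\<^bsub>bloch_group K\<^esub> m \<otimes>\<^bsub>bloch_group K\<^esub> ?S"
      by (simp add: nat_pow_def)
    then obtain a b where "a \<in> ?S [^]\<^bsub>bloch_group K\<^esub> m" "b \<in> ?S" "\<eta> = a + b"
      by (auto simp: bloch_group_def FactGroup_def set_mult_def free_Abelian_group_def)
    then show ?case using Suc.IH S by (simp add: bloch_wigner_hom_add algebra_simps)
  qed
  have "0 \<in> ?H"
    unfolding bloch_relations_def using generate.one[of "free_Abelian_group (K - {0, 1})"] by simp
  then have "0 \<in> ?S [^]\<^bsub>bloch_group K\<^esub> n"
    unfolding n(2) by (simp add: bloch_group_def FactGroup_def)
  from pow[OF this] n(1) show ?thesis by (simp add: bloch_wigner_hom_0)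
qed

section \<open>The solution at the sixth root of unity\<close>

definition sixth_root_solution :: "complex ^ 2" where
  "sixth_root_solution = vector [cis (pi / 3), cis (pi / 3)]"

lemma bloch_class_sixth_root_not_torsion:
  "bloch_class (solution_field sixth_root_solution)
     (frag_of (sixth_root_solution $ 1) + frag_of (sixth_root_solution $ 2))
   \<notin> torsion_elements (bloch_group (solution_field sixth_root_solution))"
proof
  assume "bloch_class (solution_field sixth_root_solution)
     (frag_of (sixth_root_solution $ 1) + frag_of (sixth_root_solution $ 2))
   \<in> torsion_elements (bloch_group (solution_field sixth_root_solution))"
  from bloch_wigner_hom_torsion[OF subfield_solution_field this]
  have "2 * bloch_wigner (cis (pi / 3)) = 0"
    by (simp only: bloch_wigner_hom_add bloch_wigner_hom_frag_of sixth_root_solution_def vector_2 mult_2)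
  with bloch_wigner_sixth_root_pos show False by simp
qed

lemma one_minus_sixth_root: "1 - cis (pi / 3) = cis (- (pi / 3))"
  by (simp add: complex_eq_iff cos_60)

lemma sixth_root_neq: "cis (pi / 3) \<noteq> 0" "cis (pi / 3) \<noteq> 1"
  by (auto simp: complex_eq_iff sin_60)

lemma cis_add_2pi: "cis (t + 2 * pi) = cis t"
  unfolding cis_mult[symmetric] by simp

lemma nahm_solutionI_2:
  fixes A :: "real ^ 2 ^ 2" and Q :: "complex ^ 2"
  assumes "Q $ 1 \<noteq> 0" "Q $ 1 \<noteq> 1" "Q $ 2 \<noteq> 0" "Q $ 2 \<noteq> 1"
    and "x \<noteq> 0" "x ^ d = Q $ 1" "y \<noteq> 0" "y ^ d = Q $ 2"
    and "1 - Q $ 1 = x powi \<lfloor>real d * A $ 1 $ 1\<rfloor> * y powi \<lfloor>real d * A $ 1 $ 2\<rfloor>"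
    and "1 - Q $ 2 = x powi \<lfloor>real d * A $ 2 $ 1\<rfloor> * y powi \<lfloor>real d * A $ 2 $ 2\<rfloor>"
  shows "nahm_solution d A Q"
  unfolding nahm_solution_def forall_2 UNIV_2
  using assms by (intro conjI exI[of _ "vector [x, y]"]) (simp_all add: vector_2)

text \<open>The fourth roots are x = cis (pi/12) and y = \<i> x. Then x^3 / y = y^3 / x = -\<i> x^2
  = cis (-pi/3) = 1 - \<zeta>.\<close>

lemma nahm_solution_sixth_root_1:
  "nahm_solution 4 (vector [vector [3/4, -1/4], vector [-1/4, 3/4]]) sixth_root_solution"
proof -
  have fl: "\<lfloor>real 4 * (3 / 4)\<rfloor> = 3" "\<lfloor>real 4 * (- 1 / 4)\<rfloor> = - 1"
    by (rule floor_unique; simp)+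
  have p1: "cis (pi / 12) ^ 4 = cis (pi / 3)" by (simp add: Complex.DeMoivre)
  have p2: "cis (7 * pi / 12) ^ 4 = cis (pi / 3)"
  proof -
    have "cis (7 * pi / 12) ^ 4 = cis (pi / 3 + 2 * pi)"
      unfolding Complex.DeMoivre by (rule arg_cong[of _ _ cis]) (simp add: field_simps)
    also have "\<dots> = cis (pi / 3)" by (rule cis_add_2pi)
    finally show ?thesis .
  qed
  have q1: "cis (- (pi / 3)) = cis (pi / 12) powi 3 * cis (7 * pi / 12) powi (- 1)"
    unfolding cis_power_int cis_mult by (rule arg_cong[of _ _ cis]) (simp add: field_simps)
  have q2: "cis (- (pi / 3)) = cis (pi / 12) powi (- 1) * cis (7 * pi / 12) powi 3"
  proof -
    have "cis (pi / 12) powi (- 1) * cis (7 * pi / 12) powi 3 = cis (- (pi / 3) + 2 * pi)"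
      unfolding cis_power_int cis_mult by (rule arg_cong[of _ _ cis]) (simp add: field_simps)
    also have "\<dots> = cis (- (pi / 3))" by (rule cis_add_2pi)
    finally show ?thesis by (rule sym)
  qed
  show ?thesis
    by (rule nahm_solutionI_2[where x = "cis (pi / 12)" and y = "cis (7 * pi / 12)"])
       (simp_all only: sixth_root_solution_def vector_2 fl one_minus_sixth_root q1[symmetric] q2[symmetric]
          p1 p2 sixth_root_neq cis_neq_zero not_False_eq_True)
qed

text \<open>The square roots are x = cis (pi/6) and y = -x. Then x^3 y = x y^3 = -x^4 = cis (-pi/3);
  with these angles the two exponents exceed -pi/3 by one and by two full turns.\<close>

lemma nahm_solution_sixth_root_2:
  "nahm_solution 2 (vector [vector [3/2, 1/2], vector [1/2, 3/2]]) sixth_root_solution"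
proof -
  have fl: "\<lfloor>real 2 * (3 / 2)\<rfloor> = 3" "\<lfloor>real 2 * (1 / 2)\<rfloor> = 1" by simp_all
  have p1: "cis (pi / 6) ^ 2 = cis (pi / 3)" by (simp add: power2_eq_square cis_mult)
  have p2: "cis (7 * pi / 6) ^ 2 = cis (pi / 3)"
  proof -
    have "cis (7 * pi / 6) ^ 2 = cis (pi / 3 + 2 * pi)"
      unfolding Complex.DeMoivre by (rule arg_cong[of _ _ cis]) (simp add: field_simps)
    also have "\<dots> = cis (pi / 3)" by (rule cis_add_2pi)
    finally show ?thesis .
  qed
  have q1: "cis (- (pi / 3)) = cis (pi / 6) powi 3 * cis (7 * pi / 6) powi 1"
  proof -
    have "cis (pi / 6) powi 3 * cis (7 * pi / 6) powi 1 = cis (- (pi / 3) + 2 * pi)"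
      unfolding cis_power_int cis_mult by (rule arg_cong[of _ _ cis]) (simp add: field_simps)
    also have "\<dots> = cis (- (pi / 3))" by (rule cis_add_2pi)
    finally show ?thesis by (rule sym)
  qed
  have q2: "cis (- (pi / 3)) = cis (pi / 6) powi 1 * cis (7 * pi / 6) powi 3"
  proof -
    have "cis (pi / 6) powi 1 * cis (7 * pi / 6) powi 3 = cis (- (pi / 3) + 2 * pi + 2 * pi)"
      unfolding cis_power_int cis_mult by (rule arg_cong[of _ _ cis]) (simp add: field_simps)
    also have "\<dots> = cis (- (pi / 3))" unfolding cis_add_2pi ..
    finally show ?thesis by (rule sym)
  qed
  show ?thesis
    by (rule nahm_solutionI_2[where x = "cis (pi / 6)" and y = "cis (7 * pi / 6)"])
       (simp_all only: sixth_root_solution_def vector_2 fl one_minus_sixth_root q1[symmetric] q2[symmetric]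
          p1 p2 sixth_root_neq cis_neq_zero not_False_eq_True)
qed

theorem mainTheorem3:
  fixes A :: "real ^ 2 ^ 2" and d :: nat
  assumes "A = vector [vector [3/4, -1/4], vector [-1/4, 3/4]] \<and> d = 4 \<or>
           A = vector [vector [3/2, 1/2], vector [1/2, 3/2]] \<and> d = 2"
  shows "(\<exists>(B :: real ^ 2) (C :: real). (\<forall>i. B $ i \<in> \<rat>) \<and> C \<in> \<rat> \<and>
            modular_function (nahm_sum A B C)) \<and>
         \<not> (\<forall>Q :: complex ^ 2. nahm_solution d A Q \<longrightarrow>
              bloch_class (solution_field Q) (frag_of (Q $ 1) + frag_of (Q $ 2))
                \<in> torsion_elements (bloch_group (solution_field Q)))"
proof
  let ?B = "vector [1 / 4, - 1 / 4] :: real ^ 2"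
  have B: "\<forall>i. ?B $ i \<in> \<rat>" unfolding forall_2 by (simp add: vector_2)
  have C: "- 1 / 80 \<in> (\<rat> :: real set)" "- 1 / 120 \<in> (\<rat> :: real set)" by simp_all
  from assms show "\<exists>(B :: real ^ 2) (C :: real). (\<forall>i. B $ i \<in> \<rat>) \<and> C \<in> \<rat> \<and> modular_function (nahm_sum A B C)"
  proof (elim disjE conjE)
    assume A: "A = vector [vector [3/4, -1/4], vector [-1/4, 3/4]]"
    show ?thesis unfolding A using B C modular_nahm_sum_1 by blast
  next
    assume A: "A = vector [vector [3/2, 1/2], vector [1/2, 3/2]]"
    show ?thesis unfolding A using B C modular_nahm_sum_2 by blast
  qed
  have "nahm_solution d A sixth_root_solution"
    using assms nahm_solution_sixth_root_1 nahm_solution_sixth_root_2 by blast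
  with bloch_class_sixth_root_not_torsion
  show "\<not> (\<forall>Q :: complex ^ 2. nahm_solution d A Q \<longrightarrow>
              bloch_class (solution_field Q) (frag_of (Q $ 1) + frag_of (Q $ 2))
                \<in> torsion_elements (bloch_group (solution_field Q)))"
    by blast
qed

end
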